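(* Let $T>0$, $Z\in C_T\mathcal{C}^\alpha_0$, $p\ge2$ an even integer, $\chi>0$, $\mathfrak m\in\{0,1\}$, $\zeta\in\mathcal{C}^{\alpha_0}_{\mathfrak m}(\mathbb{T})$, and let $w=w(\zeta)\in C_{\eta;T}\mathcal{C}^\alpha$ be a mild solution of the remainder equation on $[0,T]$. Then there exists a constant $C>0$, independent of $\zeta$, $Z$, $p$ and $\chi$, such that for all $t\in(0,T]$ $$\|w_t(\zeta)\|_{L^p}\le\max\Big\{(\chi t/4)^{-1/2},\;C(p\vee\chi)^{\gamma}\|Z\|^{1/\alpha}_{C_t\mathcal{C}^\alpha},\;C(p\vee\chi)^{\frac{p+1}{p+2}}\mathfrak m\Big\},\qquad \gamma=\frac{p(1+\alpha)+2+\alpha}{\alpha(p+2)}.$$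
   Context: $\mathbb{T}=\mathbb{R}/\mathbb{Z}$; $\bar f=\langle f,1\rangle$; $\mathcal{C}^\beta=\mathcal{B}^\beta_{\infty,\infty}(\mathbb{T})$ (Hölder–Besov space), subscript $\mathfrak m$ meaning mean $\mathfrak m$; $C_tE=C([0,t];E)$ with sup norm; $C_{\eta;T}E$ is the space of continuous $f:(0,T]\to E$ with $\sup_t(t^\eta\wedge1)\|f_t\|_E<\infty$. Fixed parameters $\alpha_0\in(-\tfrac12,0)$, $\alpha\in(0,\alpha_0+\tfrac12)$, $\frac{\alpha-\alpha_0}2<\eta<\frac14$. $\rho_f$ is the mean-zero solution of $-\partial_{xx}\rho_f=f-\bar f$. A mild solution of the remainder equation on $[0,T]$ is $w\in C_{\eta;T}\mathcal{C}^\alpha$ with $w_t=e^{t\Delta}\zeta+\int_0^te^{(t-s)\Delta}\chi\partial_x((w_s+Z_s)^2\partial_x\rho_{w_s+Z_s})ds$ for all $t\in(0,T]$. *)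

theory Defs
  imports "HOL-Analysis.Analysis"
begin

text \<open>Distributions on the torus T = R/Z are represented by their Fourier
coefficients: f = sum over k of f k * e_k, with e_k(x) = exp(2 pi i k x).
The pairing with the constant 1 (the mean) is then f 0.\<close>

type_synonym tdistr = "int \<Rightarrow> complex"

definition real_distr :: "tdistr \<Rightarrow> bool" where
  "real_distr f \<longleftrightarrow> (\<forall>k. f (-k) = cnj (f k))"

definition tmean :: "tdistr \<Rightarrow> complex" where
  "tmean f = f 0"

definition ek :: "int \<Rightarrow> real \<Rightarrow> complex" where
  "ek k x = cis (2 * pi * real_of_int k * x)"

definition smooth_fun :: "(real \<Rightarrow> real) \<Rightarrow> bool" where
  "smooth_fun f \<longleftrightarrow> (\<exists>D :: nat \<Rightarrow> real \<Rightarrow> real. D 0 = f \<and>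
      (\<forall>n x. (D n has_real_derivative D (Suc n) x) (at x)))"

text \<open>Dyadic partition of unity (chi0, phi) on R (Bahouri-Chemin-Danchin).\<close>
definition dyadic_partition :: "(real \<Rightarrow> real) \<Rightarrow> (real \<Rightarrow> real) \<Rightarrow> bool" where
  "dyadic_partition chi0 phi \<longleftrightarrow>
     smooth_fun chi0 \<and> smooth_fun phi \<and>
     (\<forall>x. chi0 x \<ge> 0 \<and> phi x \<ge> 0 \<and> chi0 (-x) = chi0 x \<and> phi (-x) = phi x) \<and>
     (\<forall>x. chi0 x \<noteq> 0 \<longrightarrow> \<bar>x\<bar> < 4/3) \<and>
     (\<forall>x. phi x \<noteq> 0 \<longrightarrow> 3/4 < \<bar>x\<bar> \<and> \<bar>x\<bar> < 8/3) \<and>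
     (\<forall>x. chi0 x + (\<Sum>j. phi (x / 2 ^ j)) = 1)"

text \<open>Littlewood-Paley blocks; block 0 is Delta_{-1}, block (Suc j) is Delta_j.
The sums range over a finite set containing the support of the multiplier.\<close>
definition lp_block :: "(real \<Rightarrow> real) \<Rightarrow> (real \<Rightarrow> real) \<Rightarrow> nat \<Rightarrow> tdistr \<Rightarrow> real \<Rightarrow> complex" where
  "lp_block chi0 phi j f x =
     (if j = 0 then (\<Sum>k\<in>{-2..2}. complex_of_real (chi0 (real_of_int k)) * f k * ek k x)
      else (\<Sum>k\<in>{-(2 ^ (j + 2))..2 ^ (j + 2)}.
              complex_of_real (phi (real_of_int k / 2 ^ (j - 1))) * f k * ek k x))"

definition besov_norm :: "(real \<Rightarrow> real) \<Rightarrow> (real \<Rightarrow> real) \<Rightarrow> real \<Rightarrow> tdistr \<Rightarrow> real" where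
  "besov_norm chi0 phi \<beta> f =
     (SUP j. 2 powr ((real j - 1) * \<beta>) * (SUP x\<in>{0..1}. cmod (lp_block chi0 phi j f x)))"

definition besov :: "(real \<Rightarrow> real) \<Rightarrow> (real \<Rightarrow> real) \<Rightarrow> real \<Rightarrow> tdistr \<Rightarrow> bool" where
  "besov chi0 phi \<beta> f \<longleftrightarrow> real_distr f \<and>
     bdd_above (range (\<lambda>j. 2 powr ((real j - 1) * \<beta>) * (SUP x\<in>{0..1}. cmod (lp_block chi0 phi j f x))))"

text \<open>Pointwise function represented by an element of C^beta, beta > 0
(the Littlewood-Paley series converges uniformly).\<close>
definition tfun :: "(real \<Rightarrow> real) \<Rightarrow> (real \<Rightarrow> real) \<Rightarrow> tdistr \<Rightarrow> real \<Rightarrow> real" where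
  "tfun chi0 phi f x = Re (\<Sum>j. lp_block chi0 phi j f x)"

definition fcoeff :: "(real \<Rightarrow> real) \<Rightarrow> tdistr" where
  "fcoeff g k = integral {0..1} (\<lambda>x. complex_of_real (g x) * cis (- (2 * pi * real_of_int k * x)))"

definition dx :: "tdistr \<Rightarrow> tdistr" where
  "dx f k = \<i> * complex_of_real (2 * pi * real_of_int k) * f k"

text \<open>rho_f: mean-zero solution of - rho'' = f - mean f.\<close>
definition rho :: "tdistr \<Rightarrow> tdistr" where
  "rho f k = (if k = 0 then 0 else f k / complex_of_real (4 * pi\<^sup>2 * (real_of_int k)\<^sup>2))"

definition heat :: "real \<Rightarrow> tdistr \<Rightarrow> tdistr" where
  "heat t f k = complex_of_real (exp (- 4 * pi\<^sup>2 * (real_of_int k)\<^sup>2 * t)) * f k"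

definition nonlin :: "(real \<Rightarrow> real) \<Rightarrow> (real \<Rightarrow> real) \<Rightarrow> tdistr \<Rightarrow> real \<Rightarrow> real" where
  "nonlin chi0 phi u x = (tfun chi0 phi u x)\<^sup>2 * tfun chi0 phi (dx (rho u)) x"

definition Lp_norm :: "nat \<Rightarrow> (real \<Rightarrow> real) \<Rightarrow> real" where
  "Lp_norm p g = (integral {0..1} (\<lambda>x. \<bar>g x\<bar> ^ p)) powr (1 / real p)"

definition CT_besov0 :: "(real \<Rightarrow> real) \<Rightarrow> (real \<Rightarrow> real) \<Rightarrow> real \<Rightarrow> real \<Rightarrow> (real \<Rightarrow> tdistr) \<Rightarrow> bool" where
  "CT_besov0 chi0 phi T \<alpha> Z \<longleftrightarrow>
     (\<forall>t\<in>{0..T}. besov chi0 phi \<alpha> (Z t) \<and> tmean (Z t) = 0 \<and>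
        ((\<lambda>s. besov_norm chi0 phi \<alpha> (\<lambda>k. Z s k - Z t k)) \<longlongrightarrow> 0) (at t within {0..T}))"

definition sup_norm_CT :: "(real \<Rightarrow> real) \<Rightarrow> (real \<Rightarrow> real) \<Rightarrow> real \<Rightarrow> real \<Rightarrow> (real \<Rightarrow> tdistr) \<Rightarrow> real" where
  "sup_norm_CT chi0 phi t \<alpha> Z = (SUP s\<in>{0..t}. besov_norm chi0 phi \<alpha> (Z s))"

definition C_eta_besov :: "(real \<Rightarrow> real) \<Rightarrow> (real \<Rightarrow> real) \<Rightarrow> real \<Rightarrow> real \<Rightarrow> real \<Rightarrow> (real \<Rightarrow> tdistr) \<Rightarrow> bool" where
  "C_eta_besov chi0 phi \<eta> T \<alpha> w \<longleftrightarrow>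
     (\<forall>t\<in>{0<..T}. besov chi0 phi \<alpha> (w t) \<and>
        ((\<lambda>s. besov_norm chi0 phi \<alpha> (\<lambda>k. w s k - w t k)) \<longlongrightarrow> 0) (at t within {0<..T})) \<and>
     bdd_above ((\<lambda>t. min (t powr \<eta>) 1 * besov_norm chi0 phi \<alpha> (w t)) ` {0<..T})"

text \<open>Mild solution of the remainder equation, the Duhamel integral read
mode by mode (tested against each e_k).\<close>
definition mild_solution ::
  "(real \<Rightarrow> real) \<Rightarrow> (real \<Rightarrow> real) \<Rightarrow> real \<Rightarrow> real \<Rightarrow> real \<Rightarrow> real \<Rightarrow> tdistr \<Rightarrow> (real \<Rightarrow> tdistr) \<Rightarrow> (real \<Rightarrow> tdistr) \<Rightarrow> bool" where
  "mild_solution chi0 phi \<eta> \<alpha> T chi \<zeta> Z w \<longleftrightarrow>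
     C_eta_besov chi0 phi \<eta> T \<alpha> w \<and>
     (\<forall>t\<in>{0<..T}. \<forall>k.
        (\<lambda>s. heat (t - s) (dx (fcoeff (nonlin chi0 phi (\<lambda>k. w s k + Z s k)))) k) integrable_on {0..t} \<and>
        w t k = heat t \<zeta> k + complex_of_real chi *
           integral {0..t} (\<lambda>s. heat (t - s) (dx (fcoeff (nonlin chi0 phi (\<lambda>k. w s k + Z s k)))) k))"

end

theory Submission
  imports Defs "HOL-Complex_Analysis.Conformal_Mappings"
begin

text \<open>Let \<open>y = \<parallel>w\<^sub>t\<parallel>\<close> be the \<open>L\<^sup>p\<close> norm. Testing the equation with \<open>w\<^sup>p\<^sup>-\<^sup>1\<close> and using \<open>\<rho>'' = m - w - Z\<close> turns the
  leading term of the drift into the damping \<open>- \<chi> (p-1)/(p+1) \<integral> w\<^sup>p\<^sup>+\<^sup>2\<close>. The remaining terms contain \<open>w' Z\<close>,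
  where \<open>Z\<close> is only Hoelder continuous: split \<open>Z\<close> at a Littlewood--Paley level \<open>N\<close>, integrate by parts against the
  smooth part (Bernstein's inequality bounds its derivative) and absorb the rough part into the dissipation
  \<open>\<integral> w\<^sup>p\<^sup>-\<^sup>2 |w'|\<^sup>2\<close>. Optimising \<open>N\<close> shows that \<open>y' \<le> - (\<chi>/8) y\<^sup>3\<close> as long as \<open>y\<close> exceeds the last two terms of
  the maximum and \<open>(\<chi>T/4)\<^sup>-\<^sup>1\<^sup>/\<^sup>2\<close>, so \<open>y\<^sup>-\<^sup>2\<close> grows at rate at least \<open>\<chi>/4\<close>; if \<open>y\<close> exceeds the bound
  at time \<open>t\<close>, it lies above this threshold at all earlier times, and integrating from time \<open>0\<close> gives a contradiction.

  A mild solution is too irregular for this computation, so it is carried out for the smooth Littlewood--Paley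
  cutoff of \<open>w\<close>, whose modes solve ordinary differential equations. The commutator of the cutoff with the nonlinearity
  is an error that tends to \<open>0\<close> in \<open>L\<^sup>2\<close>, and because it is multiplied by \<open>w'\<close> only once, the dissipation absorbs
  it. No regularity of \<open>w\<close> beyond its Hoelder continuity is needed.\<close>

section \<open>Trigonometric sums\<close>

text \<open>The norm of \<open>w\<close> may blow up at time 0, so the analysis runs on
  \<open>[a, T]\<close> with \<open>a > 0\<close>. The bounds on \<open>w\<close> there depend on
  \<open>a\<close>, but they enter only through errors that vanish as the regularising level
  \<open>n\<close> tends to infinity. The inequality left on \<open>[a, t]\<close> contains none of
  them, so \<open>a\<close> can go to 0. Of the starting value only the nonnegativity of
  \<open>y^-2\<close> is kept, which is why the bound forgets \<zeta>.

  The level \<open>N\<close> that splits \<open>Z\<close> is a second level, and it stays finite.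
  Absorbing the rough part asks that sqrt(p \<chi>) ||Z|| 2^(-\<alpha> N) be small, so 2^(\<alpha>
  N) is of order sqrt(p \<chi>) ||Z||. The derivative of the smooth part, of order ||Z||
  2^((1-\<alpha>) N), then scales as ||Z||^(1/\<alpha>). This is the origin of the exponent
  1/\<alpha>.\<close>

definition tsum :: "nat \<Rightarrow> tdistr \<Rightarrow> real \<Rightarrow> complex" where
  "tsum M c x = (\<Sum>k\<in>{-int M..int M}. c k * ek k x)"

lemma cmod_ek [simp]: "cmod (ek k x) = 1"
  by (simp add: ek_def)

lemma ek_0 [simp]: "ek 0 x = 1"
  by (simp add: ek_def)

lemma ek_add: "ek (k + l) x = ek k x * ek l x"
  by (simp add: ek_def cis_mult algebra_simps)

lemma ek_minus: "ek (- k) x = cnj (ek k x)"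
  by (simp add: ek_def cis_cnj)

lemma ek_eq_cis_power: "ek (int n) x = ek 1 x ^ n"
  by (induction n) (simp_all add: ek_add)

lemma ek_of_int [simp]: "ek k (of_int n) = 1"
proof -
  have "2 * pi * real_of_int k * real_of_int n = 2 * pi * real_of_int (k * n)"
    by simp
  then show ?thesis
    unfolding ek_def by (metis cis_multiple_2pi Ints_of_int)
qed

lemma ek_at_0 [simp]: "ek k 0 = 1" and ek_at_1 [simp]: "ek k 1 = 1"
  using ek_of_int[of k 0] ek_of_int[of k 1] by simp_all

lemma ek_add_int: "ek k (x + of_int n) = ek k x"
proof -
  have "ek k (x + of_int n) = ek k x * ek k (of_int n)"
    by (simp add: ek_def cis_mult algebra_simps)
  then show ?thesis by simp
qed

lemma has_vector_derivative_ek: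
  "((\<lambda>x. ek k x) has_vector_derivative (\<i> * complex_of_real (2 * pi * real_of_int k) * ek k x)) (at x within S)"
proof -
  let ?a = "\<i> * complex_of_real (2 * pi * real_of_int k)"
  have "((\<lambda>z. exp (?a * z)) has_field_derivative ?a * exp (?a * of_real x)) (at (of_real x))"
    by (auto intro!: derivative_eq_intros)
  from has_vector_derivative_real_field[OF this] show ?thesis
    by (simp add: ek_def cis_conv_exp mult_ac)
qed

lemma continuous_on_ek [continuous_intros]:
  "continuous_on S f \<Longrightarrow> continuous_on S (\<lambda>x. ek k (f x))"
  unfolding ek_def by (intro continuous_intros)

lemma has_vector_derivative_tsum:
  "(tsum M c has_vector_derivative tsum M (dx c) x) (at x within S)"
  unfolding tsum_def[abs_def]
  by (rule has_vector_derivative_eq_rhs[OF has_vector_derivative_sum[OF has_vector_derivative_mult_right[OF has_vector_derivative_ek]]])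
     (simp add: dx_def algebra_simps)

lemma has_real_derivative_Re_tsum:
  "((\<lambda>x. Re (tsum M c x)) has_real_derivative Re (tsum M (dx c) x)) (at x within S)"
  using bounded_linear.has_vector_derivative[OF bounded_linear_Re has_vector_derivative_tsum[of M c x S]]
  by (simp add: has_real_derivative_iff_has_vector_derivative)

lemma continuous_on_tsum [continuous_intros]:
  "continuous_on S f \<Longrightarrow> continuous_on S (\<lambda>x. tsum M c (f x))"
  unfolding tsum_def by (intro continuous_intros)

lemma tsum_at_1: "tsum M c 1 = tsum M c 0"
  by (simp add: tsum_def)

lemma tsum_add_int: "tsum M c (x + of_int n) = tsum M c x"
  by (simp add: tsum_def ek_add_int)

lemma tsum_add: "tsum M (\<lambda>k. c k + d k) x = tsum M c x + tsum M d x"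
  by (simp add: tsum_def sum.distrib algebra_simps)

lemma tsum_diff: "tsum M (\<lambda>k. c k - d k) x = tsum M c x - tsum M d x"
  by (simp add: tsum_def sum_subtractf algebra_simps)

lemma tsum_cmult: "tsum M (\<lambda>k. a * c k) x = a * tsum M c x"
  by (simp add: tsum_def sum_distrib_left algebra_simps)

lemma tsum_cong:
  "(\<And>k. \<bar>k\<bar> \<le> int M \<Longrightarrow> c k = d k) \<Longrightarrow> tsum M c x = tsum M d x"
  unfolding tsum_def by (rule sum.cong) auto

lemma tsum_extend:
  assumes "M \<le> M'" "\<And>k. int M < \<bar>k\<bar> \<Longrightarrow> c k = 0"
  shows "tsum M' c x = tsum M c x"
  unfolding tsum_def
  by (rule sum.mono_neutral_right) (use assms in \<open>auto simp: not_le\<close>)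

section \<open>Orthogonality, Fourier coefficients and Parseval for trigonometric
  polynomials\<close>

lemma integral_ek: "((ek k) has_integral (if k = 0 then 1 else 0)) {0..1}"
proof (cases "k = 0")
  case True
  then show ?thesis using has_integral_const_real[of "1::complex" 0 1] by (simp add: ek_0[abs_def])
next
  case False
  let ?a = "\<i> * complex_of_real (2 * pi * real_of_int k)"
  have a: "?a \<noteq> 0" using False by simp
  have "((\<lambda>x. ?a * ek k x) has_integral (ek k 1 - ek k 0)) {0..1}"
    by (rule fundamental_theorem_of_calculus) (simp, rule has_vector_derivative_ek)
  then have "((\<lambda>x. ?a * ek k x) has_integral 0) {0..1}" by simp
  from has_integral_mult_right[OF this, of "1 / ?a"] show ?thesis using False a by simp
qed

text \<open>The complex counterpart of \<open>fcoeff\<close>: trigonometric polynomials are complex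
  valued, and their coefficients have to be compared with those of real products.\<close>

definition cf :: "(real \<Rightarrow> complex) \<Rightarrow> int \<Rightarrow> complex" where
  "cf F k = integral {0..1} (\<lambda>x. F x * ek (- k) x)"

lemma fcoeff_eq_cf: "fcoeff g = cf (\<lambda>x. complex_of_real (g x))"
  by (simp add: fcoeff_def cf_def ek_def fun_eq_iff)

lemma cf_tsum:
  assumes "\<bar>k\<bar> \<le> int M"
  shows "cf (tsum M c) k = c k"
proof -
  have "((\<lambda>x. tsum M c x * ek (-k) x) has_integral
      (\<Sum>l\<in>{-int M..int M}. c l * (if l + - k = 0 then 1 else 0))) {0..1}"
    unfolding tsum_def sum_distrib_right mult.assoc ek_add[symmetric]
    by (intro has_integral_sum has_integral_mult_right integral_ek) auto
  moreover have "(\<Sum>l\<in>{-int M..int M}. c l * (if l + - k = 0 then 1 else 0)) =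
      (\<Sum>l\<in>{-int M..int M}. if l = k then c l else 0)"
    by (rule sum.cong) auto
  also have "\<dots> = c k" using assms by (auto simp: sum.delta')
  ultimately show ?thesis unfolding cf_def by (auto intro: integral_unique)
qed

lemma integral_tsum: "(tsum M c has_integral c 0) {0..1}"
proof -
  have "(tsum M c has_integral (\<Sum>l\<in>{-int M..int M}. c l * (if l = 0 then 1 else 0))) {0..1}"
    unfolding tsum_def[abs_def]
    by (intro has_integral_sum has_integral_mult_right integral_ek) auto
  moreover have "(\<Sum>l\<in>{-int M..int M}. c l * (if l = 0 then 1 else 0)) =
      (\<Sum>l\<in>{-int M..int M}. if l = 0 then c l else 0)"
    by (rule sum.cong) auto
  also have "\<dots> = c 0" by (auto simp: sum.delta')
  ultimately show ?thesis by simp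
qed

lemma integral_cnj_tsum:
  assumes "continuous_on {0..1} g"
  shows "((\<lambda>x. cnj (tsum M c x) * g x) has_integral (\<Sum>k\<in>{-int M..int M}. cnj (c k) * cf g k)) {0..1}"
proof -
  have "((\<lambda>x. \<Sum>k\<in>{-int M..int M}. cnj (c k) * (g x * ek (-k) x)) has_integral
     (\<Sum>k\<in>{-int M..int M}. cnj (c k) * cf g k)) {0..1}"
    unfolding cf_def
    by (intro has_integral_sum has_integral_mult_right integrable_integral
        integrable_continuous_interval continuous_intros assms) auto
  then show ?thesis
    by (simp add: tsum_def sum_distrib_left ek_minus mult_ac)
qed

text \<open>With \<open>T = \<Sum> \<theta>\<^sub>k g\<^sub>k e\<^sub>k\<close>, Parseval and \<open>\<theta>\<^sup>2 \<le> \<theta>\<close> give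
  \<open>\<integral>|T|\<^sup>2 \<le> \<integral> cnj T \<cdot> g\<close>, and \<open>2ab \<le> a\<^sup>2 + b\<^sup>2\<close> closes the estimate.\<close>
lemma multiplier_L2_contraction:
  fixes M :: nat
  assumes g: "continuous_on {0..1} g" and th: "\<And>k. 0 \<le> \<theta> k \<and> \<theta> k \<le> (1::real)"
  defines "T \<equiv> tsum M (\<lambda>k. complex_of_real (\<theta> k) * cf g k)"
  shows "integral {0..1} (\<lambda>x. (cmod (T x))\<^sup>2) \<le> integral {0..1} (\<lambda>x. (cmod (g x))\<^sup>2)"
proof -
  let ?c = "\<lambda>k. complex_of_real (\<theta> k) * cf g k"
  have T: "continuous_on {0..1} T" unfolding T_def by (intro continuous_intros)
  have "((\<lambda>x. cnj (T x) * T x) has_integral (\<Sum>k\<in>{-int M..int M}. cnj (?c k) * cf T k)) {0..1}"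
    using integral_cnj_tsum[OF T, of M ?c] by (simp add: T_def)
  moreover have "(\<Sum>k\<in>{-int M..int M}. cnj (?c k) * cf T k) =
      complex_of_real (\<Sum>k\<in>{-int M..int M}. (\<theta> k)\<^sup>2 * (cmod (cf g k))\<^sup>2)"
    unfolding T_def of_real_sum
    by (rule sum.cong) (auto simp: cf_tsum power2_eq_square complex_norm_square[symmetric] algebra_simps
        simp flip: complex_norm_square)
  ultimately have 1: "((\<lambda>x. cnj (T x) * T x) has_integral
     complex_of_real (\<Sum>k\<in>{-int M..int M}. (\<theta> k)\<^sup>2 * (cmod (cf g k))\<^sup>2)) {0..1}" by simp
  have "((\<lambda>x. (cmod (T x))\<^sup>2) has_integral (\<Sum>k\<in>{-int M..int M}. (\<theta> k)\<^sup>2 * (cmod (cf g k))\<^sup>2)) {0..1}"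
  proof -
    have "Re (cnj (T x) * T x) = (cmod (T x))\<^sup>2" for x
      unfolding cmod_power2 by (simp add: power2_eq_square)
    then show ?thesis using has_integral_Re[OF 1] by simp
  qed
  then have TT: "integral {0..1} (\<lambda>x. (cmod (T x))\<^sup>2) = (\<Sum>k\<in>{-int M..int M}. (\<theta> k)\<^sup>2 * (cmod (cf g k))\<^sup>2)"
    by (rule integral_unique)
  have "((\<lambda>x. cnj (T x) * g x) has_integral (\<Sum>k\<in>{-int M..int M}. cnj (?c k) * cf g k)) {0..1}"
    using integral_cnj_tsum[OF g, of M ?c] by (simp add: T_def)
  moreover have "(\<Sum>k\<in>{-int M..int M}. cnj (?c k) * cf g k) =
      complex_of_real (\<Sum>k\<in>{-int M..int M}. \<theta> k * (cmod (cf g k))\<^sup>2)"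
    unfolding of_real_sum
    by (rule sum.cong) (auto simp: algebra_simps simp flip: complex_norm_square)
  ultimately have 2: "((\<lambda>x. cnj (T x) * g x) has_integral
     complex_of_real (\<Sum>k\<in>{-int M..int M}. \<theta> k * (cmod (cf g k))\<^sup>2)) {0..1}" by simp
  have Tg: "integral {0..1} (\<lambda>x. Re (cnj (T x) * g x)) = (\<Sum>k\<in>{-int M..int M}. \<theta> k * (cmod (cf g k))\<^sup>2)"
    using has_integral_Re[OF 2] by (auto intro: integral_unique)
  have "integral {0..1} (\<lambda>x. (cmod (T x))\<^sup>2) \<le> integral {0..1} (\<lambda>x. Re (cnj (T x) * g x))"
    unfolding TT Tg
  proof (rule sum_mono)
    fix k
    have "(\<theta> k)\<^sup>2 \<le> \<theta> k" using th[of k] by (simp add: power2_eq_square mult_left_le)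
    then show "(\<theta> k)\<^sup>2 * (cmod (cf g k))\<^sup>2 \<le> \<theta> k * (cmod (cf g k))\<^sup>2"
      by (rule mult_right_mono) simp
  qed
  also have "\<dots> \<le> integral {0..1} (\<lambda>x. ((cmod (T x))\<^sup>2 + (cmod (g x))\<^sup>2) / 2)"
  proof (rule integral_le)
    fix x :: real
    have "Re (cnj (T x) * g x) \<le> cmod (T x) * cmod (g x)"
      using complex_Re_le_cmod[of "cnj (T x) * g x"] by (simp add: norm_mult)
    also have "\<dots> \<le> ((cmod (T x))\<^sup>2 + (cmod (g x))\<^sup>2) / 2"
      using sum_squares_bound[of "cmod (T x)" "cmod (g x)"] by simp
    finally show "Re (cnj (T x) * g x) \<le> ((cmod (T x))\<^sup>2 + (cmod (g x))\<^sup>2) / 2" .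
  qed (auto intro!: integrable_continuous_interval continuous_intros T g)
  also have "\<dots> = (integral {0..1} (\<lambda>x. (cmod (T x))\<^sup>2) + integral {0..1} (\<lambda>x. (cmod (g x))\<^sup>2)) / 2"
    by (subst integral_add[symmetric])
       (auto intro!: integrable_continuous_interval continuous_intros T g simp: integral_divide)
  finally show ?thesis by simp
qed

text \<open>Degree at most \<open>M\<close>, with the coefficients forgotten. A cubic product of
  cutoffs only has to be located in frequency, and degrees simply add under products.\<close>

definition tspan :: "nat \<Rightarrow> (real \<Rightarrow> complex) \<Rightarrow> bool" where
  "tspan M F \<longleftrightarrow> (\<exists>c. \<forall>x. F x = tsum M c x)"

lemma tspan_tsum: "tspan M (\<lambda>x. tsum M c x)"
  by (auto simp: tspan_def)

lemma tspan_sum: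
  assumes "finite I" "\<And>i. i \<in> I \<Longrightarrow> tspan M (F i)"
  shows "tspan M (\<lambda>x. \<Sum>i\<in>I. F i x)"
  using assms
proof (induction I rule: finite_induct)
  case empty
  have "0 = tsum M (\<lambda>_. 0) x" for x by (simp add: tsum_def)
  then show ?case by (auto simp: tspan_def)
next
  case (insert i I)
  obtain c where "\<And>x. F i x = tsum M c x"
    using insert.prems[of i] by (auto simp: tspan_def)
  moreover obtain d where "\<And>x. (\<Sum>i\<in>I. F i x) = tsum M d x"
    using insert.IH insert.prems by (auto simp: tspan_def)
  ultimately have "(\<Sum>i\<in>insert i I. F i x) = tsum M (\<lambda>k. c k + d k) x" for x
    using insert by (simp add: tsum_add)
  then show ?case by (auto simp: tspan_def)
qed

lemma tspan_cmult: "tspan M F \<Longrightarrow> tspan M (\<lambda>x. a * F x)"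
  unfolding tspan_def by (metis tsum_cmult)

lemma tspan_ek:
  assumes "\<bar>k\<bar> \<le> int M"
  shows "tspan M (\<lambda>x. ek k x)"
proof -
  have "ek k x = tsum M (\<lambda>l. if l = k then 1 else 0) x" for x
  proof -
    have "tsum M (\<lambda>l. if l = k then 1 else 0) x = (\<Sum>l\<in>{-int M..int M}. if l = k then ek l x else 0)"
      unfolding tsum_def by (rule sum.cong) auto
    then show ?thesis using assms by (auto simp: sum.delta')
  qed
  then show ?thesis by (auto simp: tspan_def)
qed

lemma tspan_mult:
  assumes "tspan M F" "tspan M' G"
  shows "tspan (M + M') (\<lambda>x. F x * G x)"
proof -
  obtain c d where F: "\<And>x. F x = tsum M c x" and G: "\<And>x. G x = tsum M' d x"
    using assms by (auto simp: tspan_def)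
  have "F x * G x = (\<Sum>k\<in>{-int M..int M}. \<Sum>l\<in>{-int M'..int M'}. (c k * d l) * ek (k + l) x)" for x
    unfolding F G tsum_def sum_product by (simp add: ek_add mult_ac)
  moreover have "tspan (M + M') (\<lambda>x. \<Sum>k\<in>{-int M..int M}. \<Sum>l\<in>{-int M'..int M'}. (c k * d l) * ek (k + l) x)"
    by (intro tspan_sum tspan_cmult tspan_ek) auto
  ultimately show ?thesis by (simp cong: if_cong)
qed

lemma tspan_Re:
  assumes "tspan M F"
  shows "tspan M (\<lambda>x. complex_of_real (Re (F x)))"
proof -
  obtain c where F: "\<And>x. F x = tsum M c x"
    using assms by (auto simp: tspan_def)
  \<comment> \<open>Re F = (F + cnj F) / 2, and conjugation sends \<open>ek k\<close> to
    \<open>ek (- k)\<close>. The Boolean index puts both halves into one finite sum, the shape that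
    \<open>tspan_sum\<close> takes.\<close>
  have "complex_of_real (Re (F x)) = (\<Sum>k\<in>{-int M..int M}. \<Sum>b\<in>{True,False}.
      if b then (c k / 2) * ek k x else (cnj (c k) / 2) * ek (-k) x)" for x
  proof -
    have "complex_of_real (Re (F x)) = (F x + cnj (F x)) / 2"
      by (simp add: complex_add_cnj)
    then show ?thesis
      by (simp add: F tsum_def ek_minus sum_distrib_left sum.distrib add_divide_distrib sum_divide_distrib)
  qed
  moreover have "tspan M (\<lambda>x. \<Sum>k\<in>{-int M..int M}. \<Sum>b\<in>{True,False}.
      if b then (c k / 2) * ek k x else (cnj (c k) / 2) * ek (-k) x)"
  proof (intro tspan_sum)
    fix k b assume k: "k \<in> {-int M..int M}"
    show "tspan M (\<lambda>x. if b then (c k / 2) * ek k x else (cnj (c k) / 2) * ek (-k) x)"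
      using k tspan_cmult[OF tspan_ek[of k M], of "c k / 2"]
        tspan_cmult[OF tspan_ek[of "- k" M], of "cnj (c k) / 2"]
      by (cases b) (auto simp: abs_le_iff)
  qed auto
  ultimately show ?thesis by simp
qed

section \<open>The energy inequality for smooth periodic functions\<close>

text \<open>Replacing the smaller base by the larger one bounds the product by a pure power. All
  mixed terms of the energy inequality are reduced in this way, with
  \<open>n = k + 4\<close>.\<close>

lemma monomial_le:
  fixes a y :: real
  assumes "0 \<le> a" "0 \<le> y" and n: "i + j = n"
  shows "a ^ i * y ^ j \<le> a ^ n + y ^ n"
proof (cases "a \<le> y")
  case True
  then have "a ^ i * y ^ j \<le> y ^ i * y ^ j" using assms by (intro mult_right_mono power_mono) auto
  then show ?thesis using assms(1,2) by (simp add: n[symmetric] power_add add_increasing)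
next
  case False
  then have "a ^ i * y ^ j \<le> a ^ i * a ^ j" using assms by (intro mult_left_mono power_mono) auto
  then show ?thesis using assms(1,2) by (simp add: n[symmetric] power_add add_increasing2)
qed

lemma complete_square:
  fixes x s X :: real
  shows "- (x\<^sup>2 + s * x * X) \<le> s\<^sup>2 * X\<^sup>2 / 4"
proof -
  have "0 \<le> (x + s * X / 2)\<^sup>2" by simp
  then show ?thesis by (simp add: power2_eq_square algebra_simps)
qed

text \<open>The terms added in the second line form a total derivative. They cancel every derivative of \<open>v\<close>
  except in the dissipative square and in products with the rough part \<open>z\<^sub>2\<close> and the error \<open>e\<close>, which
  completing the square removes; the factor \<open>v\<^sup>p\<^sup>+\<^sup>1 r'\<close> then provides the damping \<open>- v\<^sup>p\<^sup>+\<^sup>2\<close>.\<close>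
lemma energy_pointwise:
  fixes v v' z1 z2 dz1 r r' m y b s \<epsilon> e :: real and k :: nat
  assumes k: "even k" and eps: "0 \<le> \<epsilon>" "\<epsilon> \<le> 1" and s: "0 \<le> s" and y: "0 \<le> y"
    and r: "\<bar>r\<bar> \<le> 3 * y" and r': "r' = - (v + z1 + z2 - m)"
    and z: "\<bar>z1\<bar> \<le> \<epsilon> * y" "\<bar>z1 + z2\<bar> \<le> \<epsilon> * y" "\<bar>z1 + z2 - m\<bar> \<le> \<epsilon> * y"
    and dz1: "\<bar>dz1\<bar> \<le> \<epsilon> * y"
    and z2: "\<bar>z2\<bar> \<le> b" and b: "real (k + 2) * s * b\<^sup>2 \<le> \<epsilon>\<^sup>2"
  defines "P \<equiv> real (k + 2)"
  shows "- (P - 1) * v ^ k * v' * (v' + s * ((v + z1 + z2)\<^sup>2 * r + e))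
     + s * ((P - 1) / (P + 1) * ((P + 1) * v ^ (k + 2) * v' * r + v ^ (k + 3) * r')
            + 2 * (P - 1) / P * (P * v ^ (k + 1) * v' * (z1 * r) + v ^ (k + 2) * (dz1 * r + z1 * r'))
            + ((P - 1) * v ^ k * v' * (z1\<^sup>2 * r) + v ^ (k + 1) * (2 * z1 * dz1 * r + z1\<^sup>2 * r')))
     \<le> s * (- (1/3) * v ^ (k + 4) + 91 * \<epsilon> * (v ^ (k + 4) + y ^ (k + 4))) + P / 2 * s\<^sup>2 * v ^ k * e\<^sup>2"
proof -
  define a where "a = \<bar>v\<bar>"
  define S where "S = a ^ (k + 4) + y ^ (k + 4)"
  \<comment> \<open>The part of the flux that the total derivative does not cancel: (v + z1 + z2)^2
    - (v + z1)^2 = z2 (2v + 2 z1 + z2), times \<open>r\<close>, plus the error \<open>e\<close>. It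
    is grouped so that the given bounds on \<open>z1 + z2\<close> and \<open>z1\<close>
    apply.\<close>
  define X where "X = z2 * (2 * v + (z1 + z2) + z1) * r + e"
  have a: "0 \<le> a" by (simp add: a_def)
  have P: "P \<ge> 2" by (simp add: P_def)
  have b0: "0 \<le> b" using z2 by linarith
  have ev: "v ^ k = a ^ k" "v ^ (k + 2) = a ^ (k + 2)" "v ^ (k + 4) = a ^ (k + 4)"
    using k by (simp_all add: a_def power_even_abs)
  have S: "a ^ k * y ^ 4 \<le> S" "a ^ (k + 1) * y ^ 3 \<le> S" "a ^ (k + 2) * y ^ 2 \<le> S" "a ^ (k + 3) * y \<le> S"
    unfolding S_def using monomial_le[OF a y, of "k + 3" 1 "k + 4"]
    by (auto intro!: monomial_le a y simp del: power_Suc power_add_numeral2)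
  have S0: "0 \<le> S" using a y by (simp add: S_def)
  have ee: "\<epsilon>\<^sup>2 \<le> \<epsilon>" using eps by (simp add: power2_eq_square mult_left_le)
  have rr: "\<bar>r'\<bar> \<le> a + \<epsilon> * y" unfolding r' a_def using z(3) by linarith
  have ey: "\<epsilon> * y \<le> y" using eps y by (simp add: mult_left_le_one_le)
  have ey0: "0 \<le> \<epsilon> * y" using eps y by simp
  have eq: "- (P - 1) * v ^ k * v' * (v' + s * ((v + z1 + z2)\<^sup>2 * r + e))
     + s * ((P - 1) / (P + 1) * ((P + 1) * v ^ (k + 2) * v' * r + v ^ (k + 3) * r')
            + 2 * (P - 1) / P * (P * v ^ (k + 1) * v' * (z1 * r) + v ^ (k + 2) * (dz1 * r + z1 * r'))
            + ((P - 1) * v ^ k * v' * (z1\<^sup>2 * r) + v ^ (k + 1) * (2 * z1 * dz1 * r + z1\<^sup>2 * r')))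
     = (P - 1) * v ^ k * (- (v'\<^sup>2 + s * v' * X))
       + s * ((P - 1) / (P + 1) * (v ^ (k + 3) * r'))
       + s * (2 * (P - 1) / P * (v ^ (k + 2) * (dz1 * r + z1 * r')))
       + s * (v ^ (k + 1) * (2 * z1 * dz1 * r + z1\<^sup>2 * r'))"
  proof -
    have p1: "(P - 1) / (P + 1) * ((P + 1) * v ^ (k + 2) * v' * r + v ^ (k + 3) * r') =
       (P - 1) * v ^ k * v' * (v\<^sup>2 * r) + (P - 1) / (P + 1) * (v ^ (k + 3) * r')"
      using P by (simp add: field_simps power_add power2_eq_square)
    have p2: "2 * (P - 1) / P * (P * v ^ (k + 1) * v' * (z1 * r) + v ^ (k + 2) * (dz1 * r + z1 * r')) =
       (P - 1) * v ^ k * v' * (2 * v * z1 * r) + 2 * (P - 1) / P * (v ^ (k + 2) * (dz1 * r + z1 * r'))"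
      using P by (simp add: field_simps power_add power2_eq_square)
    show ?thesis unfolding p1 p2 X_def
      by (simp add: algebra_simps power2_eq_square)
  qed
  have T1: "(P - 1) * v ^ k * (- (v'\<^sup>2 + s * v' * X)) \<le> s * (72 * \<epsilon> * S) + P / 2 * s\<^sup>2 * v ^ k * e\<^sup>2"
  proof -
    have "\<bar>2 * v + (z1 + z2) + z1\<bar> \<le> 2 * (a + y)"
      using abs_triangle_ineq[of "2 * v + (z1 + z2)" z1] abs_triangle_ineq[of "2 * v" "z1 + z2"] z(1,2) ey
      by (simp add: a_def abs_mult)
    then have "\<bar>z2\<bar> * \<bar>2 * v + (z1 + z2) + z1\<bar> * \<bar>r\<bar> \<le> b * (2 * (a + y)) * (3 * y)"
      using r z2 a y b0 by (intro mult_mono) auto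
    moreover have "X - e = z2 * (2 * v + (z1 + z2) + z1) * r" by (simp add: X_def)
    moreover have "b * (2 * (a + y)) * (3 * y) = 6 * b * y * (a + y)" by simp
    ultimately have "\<bar>X - e\<bar> \<le> 6 * b * y * (a + y)" by (simp only: abs_mult)
    then have "(X - e)\<^sup>2 \<le> (6 * b * y * (a + y))\<^sup>2"
      by (metis abs_ge_zero power2_abs power_mono)
    also have "\<dots> = 36 * b\<^sup>2 * y\<^sup>2 * (a + y)\<^sup>2" by (simp add: power2_eq_square)
    also have "\<dots> \<le> 36 * b\<^sup>2 * y\<^sup>2 * (2 * (a\<^sup>2 + y\<^sup>2))"
      using sum_squares_bound[of a y] by (intro mult_left_mono) (auto simp: power2_sum)
    finally have "(X - e)\<^sup>2 \<le> 72 * b\<^sup>2 * y\<^sup>2 * (a\<^sup>2 + y\<^sup>2)" by (simp add: mult.assoc mult.left_commute)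
    moreover have "X\<^sup>2 \<le> 2 * (X - e)\<^sup>2 + 2 * e\<^sup>2"
      using sum_squares_bound[of "X - e" e] by (simp add: power2_eq_square algebra_simps)
    ultimately have X2: "X\<^sup>2 \<le> 144 * b\<^sup>2 * y\<^sup>2 * (a\<^sup>2 + y\<^sup>2) + 2 * e\<^sup>2" by simp
    have "(P - 1) * v ^ k * (- (v'\<^sup>2 + s * v' * X)) \<le> (P - 1) * v ^ k * (s\<^sup>2 * X\<^sup>2 / 4)"
      using P a unfolding ev by (intro mult_left_mono complete_square) auto
    also have "\<dots> \<le> P * a ^ k * (s\<^sup>2 * X\<^sup>2 / 4)"
      using P a unfolding ev by (intro mult_right_mono) auto
    also have "\<dots> \<le> P * a ^ k * (s\<^sup>2 * (144 * b\<^sup>2 * y\<^sup>2 * (a\<^sup>2 + y\<^sup>2) + 2 * e\<^sup>2) / 4)"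
      using P a X2 by (intro mult_left_mono divide_right_mono) auto
    also have "\<dots> = (36 * s * (a ^ (k+2) * y\<^sup>2 + a ^ k * y ^ 4)) * (P * s * b\<^sup>2) + P / 2 * s\<^sup>2 * a ^ k * e\<^sup>2"
      by (simp add: field_simps power_add power2_eq_square power4_eq_xxxx)
    also have "\<dots> \<le> (36 * s * (a ^ (k+2) * y\<^sup>2 + a ^ k * y ^ 4)) * \<epsilon> + P / 2 * s\<^sup>2 * a ^ k * e\<^sup>2"
      using b ee s a y unfolding P_def by (intro add_right_mono mult_left_mono) auto
    also have "\<dots> \<le> (36 * s * (S + S)) * \<epsilon> + P / 2 * s\<^sup>2 * a ^ k * e\<^sup>2"
      using S s eps by (intro add_right_mono mult_right_mono mult_left_mono add_mono) auto
    finally show ?thesis unfolding ev by (simp add: algebra_simps)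
  qed
  have T2: "(P - 1) / (P + 1) * (v ^ (k + 3) * r') \<le> - (1/3) * v ^ (k + 4) + \<epsilon> * S"
  proof -
    let ?c = "(P - 1) / (P + 1)"
    \<comment> \<open>Origin of the 1/3: the damping coefficient increases with \<open>P\<close> and
      equals 1/3 at \<open>P = 2\<close>.\<close>
    have c: "1/3 \<le> ?c" "?c \<le> 1" using P by (simp_all add: field_simps)
    have "\<bar>v ^ (k + 3) * (z1 + z2 - m)\<bar> \<le> a ^ (k + 3) * (\<epsilon> * y)"
      unfolding abs_mult power_abs a_def using z by (intro mult_left_mono) auto
    also have "\<dots> \<le> \<epsilon> * S" using S(4) eps by (simp add: mult.left_commute mult_left_mono)
    finally have 1: "\<bar>v ^ (k + 3) * (z1 + z2 - m)\<bar> \<le> \<epsilon> * S" .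
    have "?c * (v ^ (k + 3) * r') = - ?c * v ^ (k + 4) - ?c * (v ^ (k + 3) * (z1 + z2 - m))"
      unfolding r' by (simp add: algebra_simps power_add eval_nat_numeral)
    also have "\<dots> \<le> - (1/3) * v ^ (k + 4) + 1 * (\<epsilon> * S)"
    proof -
      have "1/3 * v ^ (k + 4) \<le> ?c * v ^ (k + 4)" unfolding ev using c a by (intro mult_right_mono) auto
      moreover have "\<bar>?c * (v ^ (k + 3) * (z1 + z2 - m))\<bar> \<le> 1 * (\<epsilon> * S)"
      proof -
        have "\<bar>?c\<bar> \<le> 1" using c by linarith
        then show ?thesis unfolding abs_mult[of ?c] using 1 by (intro mult_mono) auto
      qed
      ultimately show ?thesis by linarith
    qed
    finally show ?thesis by simp
  qed
  have zr': "\<bar>z1\<bar> * \<bar>r'\<bar> \<le> (\<epsilon> * y) * (a + y)"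
    using z rr ey ey0 by (intro mult_mono) auto
  have T3: "2 * (P - 1) / P * (v ^ (k + 2) * (dz1 * r + z1 * r')) \<le> 10 * \<epsilon> * S"
  proof -
    have "\<bar>dz1 * r\<bar> \<le> (\<epsilon> * y) * (3 * y)"
      unfolding abs_mult using dz1 r ey0 by (intro mult_mono) auto
    with zr' have "\<bar>dz1 * r + z1 * r'\<bar> \<le> \<epsilon> * (4 * y\<^sup>2 + a * y)"
      unfolding abs_mult[symmetric] by (simp add: power2_eq_square algebra_simps)
    then have "a ^ (k + 2) * \<bar>dz1 * r + z1 * r'\<bar> \<le> a ^ (k + 2) * (\<epsilon> * (4 * y\<^sup>2 + a * y))"
      using a by (intro mult_left_mono) auto
    also have "\<dots> = \<epsilon> * (4 * (a ^ (k + 2) * y\<^sup>2) + a ^ (k + 3) * y)"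
      by (simp add: algebra_simps power_add eval_nat_numeral)
    also have "\<dots> \<le> \<epsilon> * (5 * S)" using S eps by (intro mult_left_mono) auto
    finally have 1: "a ^ (k + 2) * \<bar>dz1 * r + z1 * r'\<bar> \<le> 5 * \<epsilon> * S" by simp
    have "2 * (P - 1) / P * (v ^ (k + 2) * (dz1 * r + z1 * r')) \<le> 2 * (P - 1) / P * (a ^ (k + 2) * \<bar>dz1 * r + z1 * r'\<bar>)"
      unfolding ev using P a by (intro mult_left_mono) auto
    also have "\<dots> \<le> 2 * (a ^ (k + 2) * \<bar>dz1 * r + z1 * r'\<bar>)"
      using P a by (intro mult_right_mono) (auto simp: field_simps)
    finally show ?thesis using 1 by linarith
  qed
  have T4: "v ^ (k + 1) * (2 * z1 * dz1 * r + z1\<^sup>2 * r') \<le> 8 * \<epsilon> * S"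
  proof -
    have "\<bar>z1\<bar> * \<bar>dz1\<bar> * \<bar>r\<bar> \<le> (\<epsilon> * y) * (\<epsilon> * y) * (3 * y)"
      using z dz1 r ey0 by (intro mult_mono) auto
    moreover have "\<bar>z1\<bar> * (\<bar>z1\<bar> * \<bar>r'\<bar>) \<le> (\<epsilon> * y) * ((\<epsilon> * y) * (a + y))"
      by (rule mult_mono[OF z(1) zr' ey0]) simp
    moreover have "\<bar>2 * z1 * dz1 * r + z1\<^sup>2 * r'\<bar> \<le> 2 * (\<bar>z1\<bar> * \<bar>dz1\<bar> * \<bar>r\<bar>) + \<bar>z1\<bar> * (\<bar>z1\<bar> * \<bar>r'\<bar>)"
      using abs_triangle_ineq[of "2 * z1 * dz1 * r" "z1\<^sup>2 * r'"] by (simp add: abs_mult power2_eq_square mult_ac)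
    ultimately have "\<bar>2 * z1 * dz1 * r + z1\<^sup>2 * r'\<bar> \<le> 2 * ((\<epsilon> * y) * (\<epsilon> * y) * (3 * y)) + (\<epsilon> * y) * ((\<epsilon> * y) * (a + y))"
      by linarith
    also have "\<dots> = \<epsilon>\<^sup>2 * (7 * y ^ 3 + a * y\<^sup>2)"
      by (simp add: algebra_simps power2_eq_square power3_eq_cube)
    also have "\<dots> \<le> \<epsilon> * (7 * y ^ 3 + a * y\<^sup>2)"
      using ee a y by (intro mult_right_mono) auto
    finally have "a ^ (k + 1) * \<bar>2 * z1 * dz1 * r + z1\<^sup>2 * r'\<bar> \<le> a ^ (k + 1) * (\<epsilon> * (7 * y ^ 3 + a * y\<^sup>2))"
      using a by (intro mult_left_mono) auto
    also have "\<dots> = \<epsilon> * (7 * (a ^ (k + 1) * y ^ 3) + a ^ (k + 2) * y\<^sup>2)"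
      by (simp add: algebra_simps power_add eval_nat_numeral)
    also have "\<dots> \<le> \<epsilon> * (8 * S)" using S eps by (intro mult_left_mono) auto
    finally have "\<bar>v ^ (k + 1) * (2 * z1 * dz1 * r + z1\<^sup>2 * r')\<bar> \<le> 8 * \<epsilon> * S"
      by (simp only: abs_mult power_abs a_def)
    then show ?thesis by linarith
  qed
  \<comment> \<open>91 = 1 + 10 + 8 + 72, from \<open>T2\<close>, \<open>T3\<close>,
    \<open>T4\<close> and \<open>T1\<close>. The 72 is 36 for each of two monomials, after using P s
    b^2 \<le> \<epsilon>^2 \<le> \<epsilon>.\<close>
  have "s * (- (1/3) * v ^ (k + 4) + \<epsilon> * S) + s * (10 * \<epsilon> * S) + s * (8 * \<epsilon> * S) + s * (72 * \<epsilon> * S)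
      = s * (- (1/3) * v ^ (k + 4) + 91 * \<epsilon> * S)"
    by (simp only: distrib_left[symmetric]) simp
  then show ?thesis
    unfolding eq
    using T1 mult_left_mono[OF T2 s] mult_left_mono[OF T3 s] mult_left_mono[OF T4 s]
    unfolding S_def ev(3) by linarith
qed

text \<open>Young's inequality for the product of \<open>t ^ (k + 2)\<close> and 1, with conjugate
  exponents (k+4)/(k+2) and (k+4)/2, cleared of denominators. It is tight at \<open>t = 1\<close>,
  so integrating it for \<open>t = \<bar>v\<bar> / y\<close> loses nothing.\<close>

lemma power_le_Young:
  fixes t :: real
  assumes "0 \<le> t"
  shows "(real k + 4) * t ^ (k + 2) \<le> (real k + 2) * t ^ (k + 4) + 2"
proof (cases "t = 0")
  case False
  let ?p = "(real k + 4) / (real k + 2)" and ?q = "(real k + 4) / 2"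
  have "t ^ (k + 2) * 1 \<le> (t ^ (k + 2)) powr ?p / ?p + 1 powr ?q / ?q"
  proof (intro Youngs_inequality)
    show "1 / ?p + 1 / ?q = 1" by (simp add: add_divide_distrib[symmetric])
  qed (use assms in auto)
  also have "(t ^ (k + 2)) powr ?p = t powr (real (k + 2) * ?p)"
  proof -
    have "t ^ (k + 2) = t powr real (k + 2)" using False assms by (intro powr_realpow[symmetric]) auto
    then show ?thesis by (simp only: powr_powr)
  qed
  also have "real (k + 2) * ?p = real (k + 4)" by (simp add: field_simps)
  also have "t powr real (k + 4) = t ^ (k + 4)" using False assms by (intro powr_realpow) auto
  finally have 1: "t ^ (k + 2) * 1 \<le> t ^ (k + 4) / ?p + 1 powr ?q / ?q" .
  have "t ^ (k + 2) \<le> ((real k + 2) * t ^ (k + 4) + 2) / (real k + 4)"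
  proof -
    have 2: "t ^ (k + 4) / ?p = (real k + 2) * t ^ (k + 4) / (real k + 4)" "1 powr ?q / ?q = 2 / (real k + 4)"
      by simp_all
    have "((real k + 2) * t ^ (k + 4) + 2) / (real k + 4) = (real k + 2) * t ^ (k + 4) / (real k + 4) + 2 / (real k + 4)"
      by (rule add_divide_distrib)
    then show ?thesis using 1 unfolding 2 by linarith
  qed
  then show ?thesis by (subst (asm) pos_le_divide_eq) (auto simp: mult.commute)
qed auto

text \<open>The inclusions of L^(p+2) in L^p and of L^p in L^1 on the unit interval, for
  \<open>p = k + 2\<close>. Each integrates a pointwise inequality in
  \<open>\<bar>v\<bar> / y\<close> that is an equality at 1: Young's for the first, Bernoulli's for
  the second.\<close>

lemma Lp_power_mono:
  fixes v :: "real \<Rightarrow> real"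
  assumes k: "even k" and v: "continuous_on {0..1} v" and y: "y > 0"
    and yk: "y ^ (k + 2) = integral {0..1} (\<lambda>x. v x ^ (k + 2))"
  shows "y ^ (k + 4) \<le> integral {0..1} (\<lambda>x. v x ^ (k + 4))"
    and "integral {0..1} (\<lambda>x. \<bar>v x\<bar>) \<le> y"
proof -
  let ?Y = "integral {0..1} (\<lambda>x. v x ^ (k + 4))"
  have ev: "v x ^ (k + 2) = \<bar>v x\<bar> ^ (k + 2)" "v x ^ (k + 4) = \<bar>v x\<bar> ^ (k + 4)" for x
    using k by (simp_all add: power_even_abs)
  have "integral {0..1} (\<lambda>x. (real k + 4) * y\<^sup>2 * v x ^ (k + 2)) \<le>
      integral {0..1} (\<lambda>x. (real k + 2) * v x ^ (k + 4) + 2 * y ^ (k + 4))"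
  proof (rule integral_le)
    fix x
    from power_le_Young[of "\<bar>v x\<bar> / y" k] y
    have "(real k + 4) * (v x ^ (k + 2) / y ^ (k + 2)) \<le> (real k + 2) * (v x ^ (k + 4) / y ^ (k + 4)) + 2"
      by (simp only: ev power_divide) simp
    from mult_right_mono[OF this, of "y ^ (k + 4)"] y
    have 1: "(real k + 4) * (v x ^ (k + 2) / y ^ (k + 2)) * y ^ (k + 4) \<le>
        ((real k + 2) * (v x ^ (k + 4) / y ^ (k + 4)) + 2) * y ^ (k + 4)" by simp
    have 2: "y ^ (k + 4) = y ^ (k + 2) * y\<^sup>2"
    proof -
      have "k + 4 = (k + 2) + 2" by simp
      then show ?thesis by (simp only: power_add)
    qed
    have 3: "A * (w / Y) * (Y * q) = A * q * w" if "Y \<noteq> 0" for A w Y q :: real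
      using that by simp
    have 4: "(A * (w / Y) + 2) * Y = A * w + 2 * Y" if "Y \<noteq> 0" for A w Y :: real
      using that by (simp add: field_simps)
    have "(real k + 4) * (v x ^ (k + 2) / y ^ (k + 2)) * y ^ (k + 4) = (real k + 4) * y\<^sup>2 * v x ^ (k + 2)"
      unfolding 2 using y by (intro 3) simp
    with 1 show "(real k + 4) * y\<^sup>2 * v x ^ (k + 2) \<le> (real k + 2) * v x ^ (k + 4) + 2 * y ^ (k + 4)"
      using 4[of "y ^ (k + 4)" "real k + 2" "v x ^ (k + 4)"] y by simp
  qed (auto intro!: integrable_continuous_interval continuous_intros v)
  also have "\<dots> = (real k + 2) * ?Y + 2 * y ^ (k + 4)"
    by (subst integral_add) (auto intro!: integrable_continuous_interval continuous_intros v)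
  finally have "(real k + 4) * y\<^sup>2 * y ^ (k + 2) \<le> (real k + 2) * ?Y + 2 * y ^ (k + 4)"
    unfolding yk by simp
  moreover have "y\<^sup>2 * y ^ (k + 2) = y ^ (k + 4)" by (simp add: power_add eval_nat_numeral)
  ultimately have "(real k + 4) * y ^ (k + 4) \<le> (real k + 2) * ?Y + 2 * y ^ (k + 4)"
    by (simp only: mult.assoc)
  moreover have "(real k + 4) * w = (real k + 2) * w + 2 * w" for w by (simp add: distrib_right)
  ultimately have "(real k + 2) * y ^ (k + 4) \<le> (real k + 2) * ?Y" by simp
  then show "y ^ (k + 4) \<le> ?Y" by simp
  have "integral {0..1} (\<lambda>x. real (k + 2) * y ^ (k + 1) * \<bar>v x\<bar>) \<le>
      integral {0..1} (\<lambda>x. v x ^ (k + 2) + real (k + 1) * y ^ (k + 2))"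
  proof (rule integral_le)
    fix x
    have "1 + real (k + 2) * (\<bar>v x\<bar> / y - 1) \<le> (1 + (\<bar>v x\<bar> / y - 1)) ^ (k + 2)"
      using y by (intro Bernoulli_inequality) auto
    moreover have "(1 + (\<bar>v x\<bar> / y - 1)) ^ (k + 2) = v x ^ (k + 2) / y ^ (k + 2)"
      unfolding ev power_divide[symmetric] by simp
    ultimately have "(1 + real (k + 2) * (\<bar>v x\<bar> / y - 1)) * y ^ (k + 2) \<le> v x ^ (k + 2) / y ^ (k + 2) * y ^ (k + 2)"
      using y by (intro mult_right_mono) auto
    moreover have "v x ^ (k + 2) / y ^ (k + 2) * y ^ (k + 2) = v x ^ (k + 2)" using y by simp
    moreover have "(1 + K * (A / y - 1)) * (W * y) = K * W * A - (K - 1) * (W * y)" for K A W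
      using y by (simp add: field_simps)
    from this[of "real (k + 2)" "\<bar>v x\<bar>" "y ^ (k + 1)"]
    have "(1 + real (k + 2) * (\<bar>v x\<bar> / y - 1)) * y ^ (k + 2) =
        real (k + 2) * y ^ (k + 1) * \<bar>v x\<bar> - real (k + 1) * y ^ (k + 2)"
      by (simp add: mult_ac)
    ultimately show "real (k + 2) * y ^ (k + 1) * \<bar>v x\<bar> \<le> v x ^ (k + 2) + real (k + 1) * y ^ (k + 2)"
      by linarith
  qed (auto intro!: integrable_continuous_interval continuous_intros v)
  also have "\<dots> = integral {0..1} (\<lambda>x. v x ^ (k + 2)) + real (k + 1) * y ^ (k + 2)"
    by (subst integral_add) (auto intro!: integrable_continuous_interval continuous_intros v)
  also have "\<dots> = real (k + 2) * y ^ (k + 2)"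
    unfolding yk[symmetric] by (simp add: distrib_right del: power_add_numeral2)
  also have "\<dots> = real (k + 2) * y ^ (k + 1) * y" by simp
  finally have "real (k + 2) * y ^ (k + 1) * integral {0..1} (\<lambda>x. \<bar>v x\<bar>) \<le> real (k + 2) * y ^ (k + 1) * y"
    by simp
  then show "integral {0..1} (\<lambda>x. \<bar>v x\<bar>) \<le> y" using y by (subst (asm) mult_le_cancel_left_pos) auto
qed

lemma integral_derivative_periodic:
  fixes f :: "real \<Rightarrow> real"
  assumes "\<And>x. x \<in> {0..1} \<Longrightarrow> (f has_real_derivative f' x) (at x within {0..1})" "f 1 = f 0"
  shows "(f' has_integral 0) {0..1}"
  using fundamental_theorem_of_calculus[of 0 1 f f'] assms
  by (simp add: has_real_derivative_iff_has_vector_derivative)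

text \<open>Since \<open>r\<close> has mean zero, \<open>r x\<close> is the average over
  \<open>y\<close> of \<open>r x - r y\<close>, and each difference is an integral of
  \<open>r'\<close>.\<close>

lemma abs_le_integral_abs_derivative:
  fixes r :: "real \<Rightarrow> real"
  assumes dr: "\<And>x. x \<in> {0..1} \<Longrightarrow> (r has_real_derivative r' x) (at x within {0..1})"
    and cr': "continuous_on {0..1} r'" and mean: "(r has_integral 0) {0..1}" and x: "x \<in> {0..1}"
  shows "\<bar>r x\<bar> \<le> integral {0..1} (\<lambda>x. \<bar>r' x\<bar>)"
proof -
  let ?L = "integral {0..1} (\<lambda>x. \<bar>r' x\<bar>)"
  have *: "\<bar>r b - r a\<bar> \<le> ?L" if ab: "0 \<le> a" "a \<le> b" "b \<le> 1" for a b
  proof -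
    have cont: "continuous_on {a..b} r'" using cr' by (rule continuous_on_subset) (use ab in auto)
    have "(r' has_integral (r b - r a)) {a..b}"
    proof (rule fundamental_theorem_of_calculus[OF ab(2)])
      fix x assume "x \<in> {a..b}"
      with ab have "(r has_real_derivative r' x) (at x within {0..1})" by (intro dr) auto
      then have "(r has_real_derivative r' x) (at x within {a..b})"
        by (rule DERIV_subset) (use ab in auto)
      then show "(r has_vector_derivative r' x) (at x within {a..b})"
        by (simp add: has_real_derivative_iff_has_vector_derivative)
    qed
    then have "\<bar>r b - r a\<bar> = norm (integral {a..b} r')" by (simp add: integral_unique)
    also have "\<dots> \<le> integral {a..b} (\<lambda>x. \<bar>r' x\<bar>)"
      by (rule integral_norm_bound_integral)
         (auto intro!: integrable_continuous_interval continuous_intros cont)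
    also have "\<dots> \<le> ?L"
      by (rule integral_subset_le)
         (use ab in \<open>auto intro!: integrable_continuous_interval continuous_intros cont cr'\<close>)
    finally show ?thesis .
  qed
  have **: "\<bar>r x - r y\<bar> \<le> ?L" if "y \<in> {0..1}" for y
    using *[of x y] *[of y x] x that by (cases "x \<le> y") auto
  have "((\<lambda>y. r x - r y) has_integral (r x - 0)) {0..1}"
    using has_integral_diff[OF has_integral_const_real[of "r x" 0 1] mean] by simp
  then have "\<bar>r x\<bar> = norm (integral {0..1} (\<lambda>y. r x - r y))" by (simp add: integral_unique)
  also have "\<dots> \<le> integral {0..1} (\<lambda>y::real. ?L)"
    by (rule integral_norm_bound_integral)
       (use ** \<open>((\<lambda>y. r x - r y) has_integral (r x - 0)) {0..1}\<close> in auto)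
  finally show ?thesis by simp
qed

text \<open>Here \<open>1/3 - 182\<epsilon> > 3/20\<close>. A coefficient \<open>1/8\<close> would suffice for the constant \<open>1/4\<close> of the theorem;
  the difference absorbs the error \<open>e\<close>.\<close>
lemma energy_estimate:
  fixes v v' z1 z2 dz1 r r' e :: "real \<Rightarrow> real" and m y b s :: real and k :: nat
  defines "P \<equiv> real (k + 2)" and "\<epsilon> \<equiv> 1 / 1000"
  assumes k: "even k" and s: "0 \<le> s" and y: "0 < y"
    and yk: "y ^ (k + 2) = integral {0..1} (\<lambda>x. v x ^ (k + 2))"
    and dv: "\<And>x. x \<in> {0..1} \<Longrightarrow> (v has_real_derivative v' x) (at x within {0..1})"
    and dz: "\<And>x. x \<in> {0..1} \<Longrightarrow> (z1 has_real_derivative dz1 x) (at x within {0..1})"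
    and dr: "\<And>x. x \<in> {0..1} \<Longrightarrow> (r has_real_derivative r' x) (at x within {0..1})"
    and per: "v 1 = v 0" "z1 1 = z1 0" "r 1 = r 0" and rmean: "(r has_integral 0) {0..1}"
    and cont: "continuous_on {0..1} v'" "continuous_on {0..1} dz1" "continuous_on {0..1} z2" "continuous_on {0..1} e"
    and r': "\<And>x. x \<in> {0..1} \<Longrightarrow> r' x = - (v x + z1 x + z2 x - m)"
    and z: "\<And>x. x \<in> {0..1} \<Longrightarrow> \<bar>z1 x\<bar> \<le> \<epsilon> * y" "\<And>x. x \<in> {0..1} \<Longrightarrow> \<bar>z1 x + z2 x\<bar> \<le> \<epsilon> * y"
      "\<And>x. x \<in> {0..1} \<Longrightarrow> \<bar>z1 x + z2 x - m\<bar> \<le> \<epsilon> * y"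
    and dz1: "\<And>x. x \<in> {0..1} \<Longrightarrow> \<bar>dz1 x\<bar> \<le> \<epsilon> * y"
    and z2: "\<And>x. x \<in> {0..1} \<Longrightarrow> \<bar>z2 x\<bar> \<le> b" and b: "P * s * b\<^sup>2 \<le> \<epsilon>\<^sup>2"
  shows "integral {0..1} (\<lambda>x. - (P - 1) * v x ^ k * v' x * (v' x + s * ((v x + z1 x + z2 x)\<^sup>2 * r x + e x)))
     \<le> - (3/20) * s * y ^ (k + 4) + P / 2 * s\<^sup>2 * integral {0..1} (\<lambda>x. v x ^ k * (e x)\<^sup>2)"
proof -
  have cv: "continuous_on {0..1} v" "continuous_on {0..1} z1" "continuous_on {0..1} r"
    by (rule DERIV_continuous_on, erule dv, rule DERIV_continuous_on, erule dz,
        rule DERIV_continuous_on, erule dr)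
  have "continuous_on {0..1} (\<lambda>x. - (v x + z1 x + z2 x - m))"
    by (intro continuous_intros cv cont)
  then have cr': "continuous_on {0..1} r'" by (rule continuous_on_eq) (simp add: r')
  have P: "P \<ge> 2" by (simp add: P_def)
  have rb: "\<bar>r x\<bar> \<le> 3 * y" if x: "x \<in> {0..1}" for x
  proof -
    have "\<bar>r x\<bar> \<le> integral {0..1} (\<lambda>x. \<bar>r' x\<bar>)"
      by (rule abs_le_integral_abs_derivative[OF dr cr' rmean x])
    also have "\<dots> \<le> integral {0..1} (\<lambda>x. \<bar>v x\<bar> + \<epsilon> * y)"
    proof (rule integral_le)
      fix x :: real assume "x \<in> {0..1}"
      then show "\<bar>r' x\<bar> \<le> \<bar>v x\<bar> + \<epsilon> * y" using z(3)[of x] r'[of x] by linarith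
    qed (auto intro!: integrable_continuous_interval continuous_intros cv cr')
    also have "\<dots> = integral {0..1} (\<lambda>x. \<bar>v x\<bar>) + \<epsilon> * y"
      by (subst integral_add) (auto intro!: integrable_continuous_interval continuous_intros cv)
    also have "\<dots> \<le> y + \<epsilon> * y" using Lp_power_mono(2)[OF k cv(1) y yk] by simp
    finally show ?thesis using y by (simp add: \<epsilon>_def)
  qed
  let ?E = "\<lambda>x. - (P - 1) * v x ^ k * v' x * (v' x + s * ((v x + z1 x + z2 x)\<^sup>2 * r x + e x))"
  let ?G = "\<lambda>x. (P - 1) / (P + 1) * ((P + 1) * v x ^ (k + 2) * v' x * r x + v x ^ (k + 3) * r' x)
            + 2 * (P - 1) / P * (P * v x ^ (k + 1) * v' x * (z1 x * r x) + v x ^ (k + 2) * (dz1 x * r x + z1 x * r' x))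
            + ((P - 1) * v x ^ k * v' x * ((z1 x)\<^sup>2 * r x) + v x ^ (k + 1) * (2 * z1 x * dz1 x * r x + (z1 x)\<^sup>2 * r' x))"
  let ?H = "\<lambda>x. s * (- (1/3) * v x ^ (k + 4) + 91 * \<epsilon> * (v x ^ (k + 4) + y ^ (k + 4))) + P / 2 * s\<^sup>2 * v x ^ k * (e x)\<^sup>2"
  have G0: "(?G has_integral 0) {0..1}"
  proof (rule integral_derivative_periodic)
    \<comment> \<open>The antiderivative in \<open>v\<close> of (P - 1) v^k (v + z1)^2, with
      \<open>z1\<close> held fixed, multiplied by \<open>r\<close>. This explains the three
      coefficients (P-1)/(P+1), 2(P-1)/P and 1.\<close>
    let ?F = "\<lambda>x. (P - 1) / (P + 1) * (v x ^ (k + 3) * r x) + 2 * (P - 1) / P * (v x ^ (k + 2) * (z1 x * r x))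
       + v x ^ (k + 1) * ((z1 x)\<^sup>2 * r x)"
    show "?F 1 = ?F 0" by (simp add: per)
    fix x :: real assume x: "x \<in> {0..1}"
    have pw: "((\<lambda>x. v x ^ Suc n) has_real_derivative (real n + 1) * v x ^ n * v' x) (at x within {0..1})" for n
      using DERIV_power_Suc[OF dv[OF x], of n] by (simp add: mult_ac add.commute)
    have pw1: "((\<lambda>x. v x ^ (k + 3)) has_real_derivative (P + 1) * v x ^ (k + 2) * v' x) (at x within {0..1})"
    proof -
      have "real (k + 2) + 1 = P + 1" "Suc (k + 2) = k + 3" by (simp_all add: P_def)
      then show ?thesis using pw[of "k + 2"] by (simp only:)
    qed
    have pw2: "((\<lambda>x. v x ^ (k + 2)) has_real_derivative P * v x ^ (k + 1) * v' x) (at x within {0..1})"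
    proof -
      have "real (k + 1) + 1 = P" "Suc (k + 1) = k + 2" by (simp_all add: P_def)
      then show ?thesis using pw[of "k + 1"] by (simp only:)
    qed
    have pw3: "((\<lambda>x. v x ^ (k + 1)) has_real_derivative (P - 1) * v x ^ k * v' x) (at x within {0..1})"
    proof -
      have "real k + 1 = P - 1" "Suc k = k + 1" by (simp_all add: P_def)
      then show ?thesis using pw[of k] by (simp only:)
    qed
    have zr: "((\<lambda>x. z1 x * r x) has_real_derivative (dz1 x * r x + z1 x * r' x)) (at x within {0..1})"
      by (rule DERIV_cong[OF DERIV_mult'[OF dz[OF x] dr[OF x]] add.commute])
    have zzr: "((\<lambda>x. (z1 x)\<^sup>2 * r x) has_real_derivative (2 * z1 x * dz1 x * r x + (z1 x)\<^sup>2 * r' x)) (at x within {0..1})"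
      using DERIV_mult'[OF DERIV_power[OF dz[OF x], of 2] dr[OF x]] by (simp add: algebra_simps)
    show "(?F has_real_derivative ?G x) (at x within {0..1})"
      by (intro DERIV_add DERIV_cmult DERIV_cong[OF DERIV_mult'[OF pw1 dr[OF x]] add.commute]
          DERIV_cong[OF DERIV_mult'[OF pw2 zr] add.commute] DERIV_cong[OF DERIV_mult'[OF pw3 zzr] add.commute])
  qed
  have cE: "continuous_on {0..1} ?E" and cG: "continuous_on {0..1} ?G" and cH: "continuous_on {0..1} ?H"
    by (intro continuous_intros cv cr' cont)+
  have "integral {0..1} ?E = integral {0..1} (\<lambda>x. ?E x + s * ?G x)"
  proof -
    have "((\<lambda>x. ?E x + s * ?G x) has_integral (integral {0..1} ?E + s * 0)) {0..1}"
      by (intro has_integral_add has_integral_mult_right G0 integrable_integral integrable_continuous_interval cE)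
    then show ?thesis by (simp add: integral_unique)
  qed
  also have "\<dots> \<le> integral {0..1} ?H"
  proof (rule integral_le)
    show "(\<lambda>x. ?E x + s * ?G x) integrable_on {0..1}"
      by (rule integrable_continuous_interval[OF continuous_on_add[OF cE continuous_on_mult[OF continuous_on_const cG]]])
    show "?H integrable_on {0..1}" by (rule integrable_continuous_interval[OF cH])
    fix x :: real assume x: "x \<in> {0..1}"
    show "?E x + s * ?G x \<le> ?H x"
      by (rule energy_pointwise[OF k _ _ s _ rb[OF x] r'[OF x] z(1)[OF x] z(2)[OF x] z(3)[OF x]
            dz1[OF x] z2[OF x] b[unfolded P_def], folded P_def])
         (use y in \<open>simp_all add: \<epsilon>_def\<close>)
  qed
  also have "\<dots> = (91 * \<epsilon> - 1/3) * s * integral {0..1} (\<lambda>x. v x ^ (k + 4)) + 91 * \<epsilon> * s * y ^ (k + 4)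
      + P / 2 * s\<^sup>2 * integral {0..1} (\<lambda>x. v x ^ k * (e x)\<^sup>2)"
  proof -
    have "((\<lambda>x. (91 * \<epsilon> - 1/3) * s * v x ^ (k + 4) + 91 * \<epsilon> * s * y ^ (k + 4)
        + P / 2 * s\<^sup>2 * (v x ^ k * (e x)\<^sup>2)) has_integral
      ((91 * \<epsilon> - 1/3) * s * integral {0..1} (\<lambda>x. v x ^ (k + 4)) + 91 * \<epsilon> * s * y ^ (k + 4)
      + P / 2 * s\<^sup>2 * integral {0..1} (\<lambda>x. v x ^ k * (e x)\<^sup>2))) {0..1}"
    proof -
      have c: "((\<lambda>x::real. 91 * \<epsilon> * s * y ^ (k + 4)) has_integral 91 * \<epsilon> * s * y ^ (k + 4)) {0..1}"
        using has_integral_const_real[of "91 * \<epsilon> * s * y ^ (k + 4)" 0 1] by simp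
      have i: "(\<lambda>x. v x ^ (k + 4)) integrable_on {0..1}" "(\<lambda>x. v x ^ k * (e x)\<^sup>2) integrable_on {0..1}"
        by (intro integrable_continuous_interval continuous_intros cv cont)+
      show ?thesis
        by (rule has_integral_add[OF has_integral_add[OF has_integral_mult_right[OF integrable_integral[OF i(1)]] c]
              has_integral_mult_right[OF integrable_integral[OF i(2)]]])
    qed
    moreover have "?H = (\<lambda>x. (91 * \<epsilon> - 1/3) * s * v x ^ (k + 4) + 91 * \<epsilon> * s * y ^ (k + 4)
        + P / 2 * s\<^sup>2 * (v x ^ k * (e x)\<^sup>2))"
    proof -
      have "s * (- (1/3) * V + 91 * \<epsilon> * (V + W)) + P / 2 * s\<^sup>2 * U * E =
         (91 * \<epsilon> - 1/3) * s * V + 91 * \<epsilon> * s * W + P / 2 * s\<^sup>2 * (U * E)" for V W U E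
        by (simp add: algebra_simps)
      then show ?thesis by (intro ext)
    qed
    ultimately show ?thesis by (simp only: integral_unique)
  qed
  \<comment> \<open>The coefficient is negative, so a lower bound on the integral is what is needed.
    Together with the other 91 \<epsilon> it produces the 182 \<epsilon>.\<close>
  also have "(91 * \<epsilon> - 1/3) * s * integral {0..1} (\<lambda>x. v x ^ (k + 4)) \<le> (91 * \<epsilon> - 1/3) * s * y ^ (k + 4)"
    using Lp_power_mono(1)[OF k cv(1) y yk] s
    by (intro mult_left_mono_neg) (auto simp: \<epsilon>_def mult_nonpos_nonneg)
  finally have "integral {0..1} ?E \<le> (182 * \<epsilon> - 1/3) * (s * y ^ (k + 4))
      + P / 2 * s\<^sup>2 * integral {0..1} (\<lambda>x. v x ^ k * (e x)\<^sup>2)"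
    by (simp add: algebra_simps)
  also have "(182 * \<epsilon> - 1/3) * (s * y ^ (k + 4)) \<le> (- (3/20)) * (s * y ^ (k + 4))"
    using s y by (intro mult_right_mono) (auto simp: \<epsilon>_def)
  finally show ?thesis by simp
qed

section \<open>Bernstein's inequality\<close>

text \<open>Max modulus for the reversed polynomial controls \<open>P\<close> on the slightly larger
  disc of radius \<open>1 + 1/N\<close>, where Cauchy's estimate applies.\<close>
lemma polynomial_bernstein:
  fixes a :: "nat \<Rightarrow> complex" and N :: nat and B :: real
  assumes M: "0 < N" and B: "\<And>z. cmod z = 1 \<Longrightarrow> cmod (\<Sum>k\<le>N. a k * z ^ k) \<le> B" and z: "cmod z = 1"
  shows "cmod (deriv (\<lambda>z. \<Sum>k\<le>N. a k * z ^ k) z) \<le> 3 * N * B"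
proof -
  let ?P = "\<lambda>z. \<Sum>k\<le>N. a k * z ^ k" and ?R = "\<lambda>z. \<Sum>k\<le>N. a (N - k) * z ^ k"
  have B0: "0 \<le> B" using B[OF z] norm_ge_zero order_trans by blast
  have hol: "?P holomorphic_on S" "?R holomorphic_on S" for S by (intro holomorphic_intros)+
  have cont: "continuous_on S ?P" "continuous_on S ?R" for S by (intro continuous_intros)+
  have rev: "?P w = w ^ N * ?R (1 / w)" if "w \<noteq> 0" for w
  proof -
    have "?P w = (\<Sum>k\<le>N. a (N - k) * w ^ (N - k))"
      by (rule sum.reindex_bij_witness[of _ "\<lambda>k. N - k" "\<lambda>k. N - k"]) auto
    also have "\<dots> = (\<Sum>k\<le>N. a (N - k) * (w ^ N * (1 / w) ^ k))"
      using that by (intro sum.cong) (auto simp: power_diff power_one_over)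
    finally show ?thesis by (simp add: sum_distrib_left mult_ac)
  qed
  have ball: "cmod (Q w) \<le> B" if "cmod w \<le> 1" "\<And>z. cmod z = 1 \<Longrightarrow> cmod (Q z) \<le> B"
    "Q holomorphic_on interior (cball 0 1)" "continuous_on (closure (cball 0 1)) Q" for Q w
    using maximum_modulus_frontier[of Q "cball 0 1" B w] that by (auto simp: frontier_cball)
  have Rb: "cmod (?R w) \<le> B" if "cmod w \<le> 1" for w
  proof (rule ball[OF that])
    fix z :: complex assume z: "cmod z = 1"
    then have "cmod (1 / z) = 1" "1 / z \<noteq> 0" by (auto simp: norm_divide)
    then have "cmod (?P (1 / z)) \<le> B" "?P (1 / z) = (1 / z) ^ N * ?R (1 / (1 / z))" using B rev by blast+
    then show "cmod (?R z) \<le> B" using z by (simp add: norm_mult norm_power norm_divide)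
  qed (rule hol cont)+
  have Pb: "cmod (?P w) \<le> 3 * B" if w: "cmod w \<le> 1 + 1 / N" for w
  proof (cases "cmod w \<le> 1")
    case True
    have "cmod (?P w) \<le> B" by (rule ball[OF True]) (use B hol cont in auto)
    then show ?thesis using B0 by simp
  next
    case False
    then have w0: "w \<noteq> 0" "1 \<le> cmod w" by auto
    have "cmod (?P w) = cmod w ^ N * cmod (?R (1 / w))"
      unfolding rev[OF w0(1)] by (simp add: norm_mult norm_power)
    also have "\<dots> \<le> (1 + 1 / N) ^ N * B"
      using w w0 by (intro mult_mono power_mono Rb) (auto simp: norm_divide)
    also have "(1 + 1 / N) ^ N \<le> exp (1::real)"
      using exp_ge_one_plus_x_over_n_power_n[of N 1] M by simp
    also have "exp (1::real) \<le> 3" using e_less_272 by simp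
    finally show ?thesis using B0 by (simp add: mult_right_mono)
  qed
  have "cmod ((deriv ^^ 1) ?P z) \<le> (fact 1 :: real) * (3 * B) / (1 / N) ^ 1"
  proof (rule Cauchy_inequality)
    show "0 < 1 / real N" using M by simp
    fix w assume "cmod (z - w) = 1 / real N"
    then have "cmod w \<le> 1 + 1 / N" using norm_triangle_ineq2[of w z] z by (simp add: norm_minus_commute)
    then show "cmod (?P w) \<le> 3 * B" by (rule Pb)
  qed (rule hol cont)+
  then show ?thesis by (simp add: mult_ac)
qed

text \<open>Multiplication by \<open>ek M\<close> turns the trigonometric polynomial into an
  algebraic one of degree \<open>2 * M\<close> on the unit circle. Solving the product rule for the
  derivative adds 2 pi M to 2 pi (6 M), and 14 pi < 50.\<close>

lemma bernstein:
  fixes M :: nat and B :: real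
  assumes M: "0 < M" and B: "\<And>x. cmod (tsum M c x) \<le> B"
  shows "cmod (tsum M (dx c) x) \<le> 50 * M * B"
proof -
  define a where "a k = c (int k - int M)" for k :: nat
  define P where "P z = (\<Sum>k\<le>2 * M. a k * z ^ k)" for z
  have B0: "0 \<le> B" using B[of 0] norm_ge_zero order_trans by blast
  have PF: "P (ek 1 x) = ek (int M) x * tsum M c x" for x
  proof -
    have "ek (int M) x * tsum M c x = (\<Sum>k\<in>{-int M..int M}. c k * ek (k + int M) x)"
      by (simp add: tsum_def sum_distrib_left ek_add mult_ac)
    also have "\<dots> = (\<Sum>k\<le>2 * M. c (int k - int M) * ek (int k) x)"
      by (rule sum.reindex_bij_witness[of _ "\<lambda>k. int k - int M" "\<lambda>k. nat (k + int M)"]) auto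
    finally show ?thesis by (simp add: P_def a_def ek_eq_cis_power)
  qed
  have PB: "cmod (P z) \<le> B" if "cmod z = 1" for z
  proof -
    define \<theta> where "\<theta> = Arg z"
    have "z \<noteq> 0" using that by auto
    then have "z = cis \<theta>" using that by (simp add: \<theta>_def cis_Arg sgn_div_norm)
    then have "z = ek 1 (\<theta> / (2 * pi))" by (simp add: ek_def)
    then show ?thesis using PF[of "\<theta> / (2 * pi)"] B[of "\<theta> / (2 * pi)"] by (simp add: norm_mult)
  qed
  have hd: "(P has_field_derivative deriv P z) (at z)" for z
    unfolding P_def[abs_def]
    by (intro holomorphic_derivI[of _ UNIV] holomorphic_intros) auto
  have dP: "cmod (deriv P (ek 1 x)) \<le> 6 * M * B"
    using polynomial_bernstein[where N = "2 * M" and a = a and B = B and z = "ek 1 x"] PB M by (simp add: P_def[abs_def])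
  have "((\<lambda>x. P (ek 1 x)) has_vector_derivative (\<i> * complex_of_real (2 * pi) * ek 1 x) * deriv P (ek 1 x)) (at x)"
    using field_vector_diff_chain_at[OF has_vector_derivative_ek[of 1 x UNIV] hd] by (simp add: o_def)
  moreover have "((\<lambda>x. ek (int M) x * tsum M c x) has_vector_derivative
     (ek (int M) x * tsum M (dx c) x + (\<i> * complex_of_real (2 * pi * real M) * ek (int M) x) * tsum M c x)) (at x)"
    using has_vector_derivative_mult[OF has_vector_derivative_ek[of "int M" x UNIV] has_vector_derivative_tsum[of M c x UNIV]]
    by (simp add: mult_ac)
  ultimately have "(\<i> * complex_of_real (2 * pi) * ek 1 x) * deriv P (ek 1 x) =
     ek (int M) x * tsum M (dx c) x + (\<i> * complex_of_real (2 * pi * real M) * ek (int M) x) * tsum M c x"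
    unfolding PF by (rule vector_derivative_unique_at)
  then have "ek (int M) x * tsum M (dx c) x = (\<i> * complex_of_real (2 * pi) * ek 1 x) * deriv P (ek 1 x)
     - (\<i> * complex_of_real (2 * pi * real M) * ek (int M) x) * tsum M c x" by simp
  then have "cmod (ek (int M) x * tsum M (dx c) x) \<le> cmod ((\<i> * complex_of_real (2 * pi) * ek 1 x) * deriv P (ek 1 x))
     + cmod ((\<i> * complex_of_real (2 * pi * real M) * ek (int M) x) * tsum M c x)"
    by (metis norm_triangle_ineq4)
  then have "cmod (tsum M (dx c) x) \<le> 2 * pi * cmod (deriv P (ek 1 x)) + 2 * pi * M * cmod (tsum M c x)"
    by (simp add: norm_mult)
  also have "\<dots> \<le> 2 * pi * (6 * M * B) + 2 * pi * M * B"
    using dP B by (intro add_mono mult_left_mono) auto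
  also have "\<dots> = 14 * pi * (M * B)" by simp
  also have "\<dots> \<le> 50 * (M * B)" using pi_approx B0 by (intro mult_right_mono) auto
  finally show ?thesis by simp
qed

section \<open>Littlewood--Paley cutoffs\<close>

lemma geometric_tail:
  fixes q :: real
  assumes "0 \<le> q" "q < 1" "N \<le> n"
  shows "(\<Sum>j=N..<n. q ^ j) \<le> q ^ N / (1 - q)"
proof -
  have "(\<Sum>j=N..<n. q ^ j) * (1 - q) = q ^ N - q ^ n"
    using \<open>N \<le> n\<close> by (induction n rule: dec_induct) (simp_all add: distrib_right right_diff_distrib)
  also have "\<dots> \<le> q ^ N" using assms by simp
  finally show ?thesis using assms by (simp add: field_simps)
qed

text \<open>For q = 2^(-\<alpha>): q < 1 makes the tails of the block series geometric, while 2q >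
  1, which is \<alpha> < 1, makes a sum of block derivatives comparable with its last term.\<close>

lemma two_powr_minus_bounds:
  fixes \<alpha> :: real
  assumes "0 < \<alpha>" "\<alpha> < 1"
  shows "0 < 2 powr - \<alpha>" "2 powr - \<alpha> < 1" "1 < 2 * 2 powr - \<alpha>"
proof -
  show "0 < 2 powr - \<alpha>" by simp
  have "2 powr - \<alpha> < 2 powr 0" using assms by (intro powr_less_mono) auto
  then show "2 powr - \<alpha> < 1" by simp
  have "2 powr - 1 < 2 powr - \<alpha>" using assms by (intro powr_less_mono) auto
  moreover have "2 powr - 1 = (1/2 :: real)" by (simp only: powr_minus_divide powr_one)
  ultimately show "1 < 2 * 2 powr - \<alpha>" by simp
qed

text \<open>Block \<open>j\<close> lives at frequency 2^(j-1), so its Besov weight is q^(1-j) rather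
  than q^(-j). The factors \<open>2 powr \<alpha>\<close> in later bounds undo this shift.\<close>

lemma powr_block_index: "2 powr ((real j - 1) * \<alpha>) = 2 powr - \<alpha> * (1 / (2 powr - \<alpha>) ^ j)"
proof -
  have "(2 powr - \<alpha>) ^ j = 2 powr - (\<alpha> * real j)" by (simp add: powr_power mult.commute)
  then have "1 / (2 powr - \<alpha>) ^ j = 2 powr (\<alpha> * real j)" by (simp only: powr_minus_divide) simp
  moreover have "(real j - 1) * \<alpha> = - \<alpha> + \<alpha> * real j" by (simp add: algebra_simps)
  ultimately show ?thesis by (simp only: powr_add)
qed

lemma cf_le:
  assumes "\<And>x. x \<in> {0..1} \<Longrightarrow> cmod (F x) \<le> B" "continuous_on {0..1} F"
  shows "cmod (cf F k) \<le> B"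
proof -
  have "cmod (cf F k) \<le> integral {0..1} (\<lambda>x::real. B)"
    unfolding cf_def
  proof (rule integral_norm_bound_integral)
    show "(\<lambda>x. F x * ek (- k) x) integrable_on {0..1}"
      by (intro integrable_continuous_interval continuous_intros assms(2))
  qed (use assms(1) in \<open>auto simp: norm_mult\<close>)
  then show ?thesis by simp
qed

text \<open>Averaging the difference of the values at \<open>x\<close> and \<open>y\<close> over
  \<open>y\<close> leaves the value at \<open>x\<close>, since the mean vanishes. The mean value
  inequality bounds each difference, and periodicity extends the bound to all
  \<open>x\<close>.\<close>

lemma mean_zero_tsum_le:
  assumes "c 0 = 0" and D: "\<And>x. cmod (tsum M (dx c) x) \<le> D"
  shows "cmod (tsum M c x) \<le> D"
proof -
  have D0: "0 \<le> D" using D[of 0] norm_ge_zero order_trans by blast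
  have unit: "cmod (tsum M c x) \<le> D" if x: "x \<in> {0..1}" for x
  proof -
    have lip: "cmod (tsum M c x - tsum M c y) \<le> D" if y: "y \<in> {0..1}" for y
    proof -
      have "norm (tsum M c x - tsum M c y) \<le> D * norm (x - y)"
      proof (rule differentiable_bound[where S = "{0..1}" and f' = "\<lambda>x h. h *\<^sub>R tsum M (dx c) x"])
        fix z :: real
        show "(tsum M c has_derivative (\<lambda>h. h *\<^sub>R tsum M (dx c) z)) (at z within {0..1})"
          using has_vector_derivative_tsum by (simp add: has_vector_derivative_def)
        show "onorm (\<lambda>h. h *\<^sub>R tsum M (dx c) z) \<le> D"
          by (intro onorm_le) (simp add: mult.commute[of D] mult_left_mono D)
      qed (use x y in auto)
      also have "\<dots> \<le> D * 1" using D0 x y by (intro mult_left_mono) auto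
      finally show ?thesis by simp
    qed
    have int: "((\<lambda>y. tsum M c x - tsum M c y) has_integral (tsum M c x - 0)) {0..1}"
      using has_integral_diff[OF has_integral_const_real[of "tsum M c x" 0 1] integral_tsum[of M c]] assms(1)
      by simp
    then have "cmod (tsum M c x) = norm (integral {0..1} (\<lambda>y. tsum M c x - tsum M c y))"
      by (simp add: integral_unique)
    also have "\<dots> \<le> integral {0..1} (\<lambda>y::real. D)"
      by (rule integral_norm_bound_integral) (use int lip in auto)
    finally show ?thesis by simp
  qed
  have "tsum M c x = tsum M c (frac x)"
    using tsum_add_int[of M c "frac x" "\<lfloor>x\<rfloor>"] by (simp add: frac_def)
  then show ?thesis using unit[of "frac x"] by (simp add: frac_lt_1 less_imp_le)
qed

lemma dx_multiplier: "dx (\<lambda>k. complex_of_real (a k) * f k) = (\<lambda>k. complex_of_real (a k) * dx f k)"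
  by (simp add: dx_def fun_eq_iff)

lemma dx_dx_rho: "dx (dx (rho u)) = (\<lambda>k. (if k = 0 then u 0 else 0) - u k)"
proof
  fix k
  show "dx (dx (rho u)) k = (if k = 0 then u 0 else 0) - u k"
    by (simp add: dx_def rho_def field_simps power2_eq_square)
qed

locale littlewood_paley =
  fixes chi0 phi :: "real \<Rightarrow> real"
  assumes partition: "dyadic_partition chi0 phi"
begin

definition lpm :: "nat \<Rightarrow> int \<Rightarrow> real" where
  "lpm j k = (if j = 0 then chi0 (real_of_int k) else phi (real_of_int k / 2 ^ (j - 1)))"

definition low :: "nat \<Rightarrow> int \<Rightarrow> real" where
  "low n k = (\<Sum>j<n. lpm j k)"

text \<open>The sum of the first \<open>n\<close> blocks, hence a partial sum of the series behind
  \<open>tfun\<close>, written as one trigonometric polynomial. Being a sum of blocks, it is bounded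
  by geometric sums uniformly in \<open>n\<close>. At \<open>n = 0\<close> it is zero; from
  \<open>n = 1\<close> on it keeps the mean.\<close>

definition cutoff :: "nat \<Rightarrow> tdistr \<Rightarrow> real \<Rightarrow> real" where
  "cutoff n f x = Re (tsum (2 ^ (n + 2)) (\<lambda>k. complex_of_real (low n k) * f k) x)"

abbreviation block :: "nat \<Rightarrow> tdistr \<Rightarrow> real \<Rightarrow> complex" where
  "block \<equiv> lp_block chi0 phi"

section \<open>Supports of the multipliers and the partition of unity\<close>

lemma chi0_eq_0: "4/3 \<le> \<bar>x\<bar> \<Longrightarrow> chi0 x = 0"
  and phi_eq_0: "\<bar>x\<bar> \<le> 3/4 \<Longrightarrow> phi x = 0" and phi_eq_0': "8/3 \<le> \<bar>x\<bar> \<Longrightarrow> phi x = 0"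
proof -
  have "chi0 x \<noteq> 0 \<longrightarrow> \<bar>x\<bar> < 4/3" "phi x \<noteq> 0 \<longrightarrow> 3/4 < \<bar>x\<bar> \<and> \<bar>x\<bar> < 8/3"
    using partition unfolding dyadic_partition_def by blast+
  then show "4/3 \<le> \<bar>x\<bar> \<Longrightarrow> chi0 x = 0" "\<bar>x\<bar> \<le> 3/4 \<Longrightarrow> phi x = 0" "8/3 \<le> \<bar>x\<bar> \<Longrightarrow> phi x = 0"
    by linarith+
qed

lemma lpm_nonneg: "0 \<le> lpm j k"
proof -
  have "0 \<le> chi0 x" "0 \<le> phi x" for x
    using partition unfolding dyadic_partition_def by blast+
  then show ?thesis by (simp add: lpm_def)
qed

lemma lpm_eq_0:
  assumes "int (2 ^ (j + 2)) < \<bar>k\<bar>"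
  shows "lpm j k = 0"
proof -
  have k: "2 ^ (j + 2) < \<bar>real_of_int k\<bar>"
  proof -
    have "real_of_int (int (2 ^ (j + 2))) < real_of_int \<bar>k\<bar>" using assms by (simp only: of_int_less_iff)
    then show ?thesis by simp
  qed
  show ?thesis
  proof (cases j)
    case 0
    then show ?thesis using k by (auto simp: lpm_def intro!: chi0_eq_0)
  next
    case (Suc i)
    then have "8 < \<bar>real_of_int k / 2 ^ i\<bar>" using k by (simp add: field_simps abs_divide)
    then have "8 / 3 \<le> \<bar>real_of_int k / 2 ^ i\<bar>" by linarith
    then show ?thesis using Suc by (simp add: lpm_def phi_eq_0')
  qed
qed

lemma lpm_Suc_eq_0:
  assumes "\<bar>real_of_int k\<bar> \<le> 3/4 * 2 ^ n" "n \<le> j"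
  shows "lpm (Suc j) k = 0"
proof -
  have "\<bar>real_of_int k\<bar> \<le> 3/4 * 2 ^ j"
  proof -
    have "(2::real) ^ n \<le> 2 ^ j" using assms(2) by (intro power_increasing) auto
    then show ?thesis using assms(1) by linarith
  qed
  then have "\<bar>real_of_int k / 2 ^ j\<bar> \<le> 3/4" by (simp add: field_simps abs_divide)
  then show ?thesis by (simp add: lpm_def phi_eq_0)
qed

text \<open>The annuli of all later blocks lie beyond these frequencies, so the partition of unity
  is already complete after \<open>Suc n\<close> blocks.\<close>

lemma low_Suc_eq_1:
  assumes "\<bar>real_of_int k\<bar> \<le> 3/4 * 2 ^ n"
  shows "low (Suc n) k = 1"
proof -
  have "(\<Sum>j. phi (real_of_int k / 2 ^ j)) = (\<Sum>j<n. phi (real_of_int k / 2 ^ j))"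
    using lpm_Suc_eq_0[OF assms] by (intro suminf_finite) (auto simp: lpm_def)
  moreover have "chi0 (real_of_int k) + (\<Sum>j. phi (real_of_int k / 2 ^ j)) = 1"
    using partition by (simp add: dyadic_partition_def)
  ultimately show ?thesis by (simp add: low_def sum.lessThan_Suc_shift lpm_def del: sum.lessThan_Suc)
qed

lemma low_nonneg: "0 \<le> low n k"
  by (simp add: low_def sum_nonneg lpm_nonneg)

lemma low_le_1: "low n k \<le> 1"
proof -
  obtain m where m: "\<bar>real_of_int k\<bar> * (4/3) < 2 ^ m"
    using real_arch_pow[of 2 "\<bar>real_of_int k\<bar> * (4/3)"] by auto
  have "2 ^ m \<le> (2::real) ^ (m + n)" by (intro power_increasing) auto
  with m have "low (Suc (m + n)) k = 1" by (intro low_Suc_eq_1) linarith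
  moreover have "low n k \<le> low (Suc (m + n)) k"
    unfolding low_def by (intro sum_mono2) (auto simp: lpm_nonneg)
  ultimately show ?thesis by simp
qed

lemma low_at_0: "0 < n \<Longrightarrow> low n 0 = 1"
  by (cases n) (auto intro: low_Suc_eq_1)

lemma block_eq_tsum:
  assumes "2 ^ (j + 2) \<le> M"
  shows "block j f x = tsum M (\<lambda>k. complex_of_real (lpm j k) * f k) x"
proof -
  have "tsum M (\<lambda>k. complex_of_real (lpm j k) * f k) x = tsum (2 ^ (j + 2)) (\<lambda>k. complex_of_real (lpm j k) * f k) x"
    using assms by (intro tsum_extend) (auto simp: lpm_eq_0)
  also have "\<dots> = block j f x"
  proof (cases j)
    case 0
    have "lpm 0 k = 0" if "2 < \<bar>k\<bar>" for k
    proof -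
      have "2 < \<bar>real_of_int k\<bar>" using that by linarith
      then show ?thesis by (auto simp: lpm_def intro!: chi0_eq_0)
    qed
    then show ?thesis using 0
      by (auto simp: tsum_def lp_block_def lpm_def intro!: sum.mono_neutral_right)
  qed (simp add: tsum_def lp_block_def lpm_def)
  finally show ?thesis by simp
qed

lemma cutoff_eq_sum: "cutoff n f x = Re (\<Sum>j<n. block j f x)"
proof -
  have "(\<Sum>j<n. block j f x) = (\<Sum>j<n. tsum (2 ^ (n + 2)) (\<lambda>k. complex_of_real (lpm j k) * f k) x)"
    by (intro sum.cong block_eq_tsum) auto
  also have "\<dots> = tsum (2 ^ (n + 2)) (\<lambda>k. complex_of_real (low n k) * f k) x"
    unfolding tsum_def low_def of_real_sum sum_distrib_right by (rule sum.swap)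
  finally show ?thesis by (simp add: cutoff_def)
qed

lemma cutoff_has_derivative:
  "((cutoff n f) has_real_derivative cutoff n (dx f) x) (at x within A)"
proof -
  show ?thesis
    unfolding cutoff_def[abs_def] dx_multiplier[of "low n" f, symmetric] by (rule has_real_derivative_Re_tsum)
qed

lemma continuous_on_cutoff [continuous_intros]: "continuous_on A g \<Longrightarrow> continuous_on A (\<lambda>x. cutoff n f (g x))"
  unfolding cutoff_def by (intro continuous_intros)

lemma cutoff_at_1: "cutoff n f 1 = cutoff n f 0"
  by (simp add: cutoff_def tsum_at_1)

lemma cutoff_add: "cutoff n (\<lambda>k. f k + g k) x = cutoff n f x + cutoff n g x"
  by (simp add: cutoff_def distrib_left tsum_add)

lemma cutoff_diff: "cutoff n (\<lambda>k. f k - g k) x = cutoff n f x - cutoff n g x"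
  by (simp add: cutoff_def right_diff_distrib tsum_diff)

lemma integral_cutoff: "0 < n \<Longrightarrow> (cutoff n f has_integral Re (f 0)) {0..1}"
  using has_integral_Re[OF integral_tsum[of "2 ^ (n + 2)" "\<lambda>k. complex_of_real (low n k) * f k"]]
  by (simp add: cutoff_def[abs_def] low_at_0)

lemma cutoff_dx_dx_rho:
  assumes "0 < n"
  shows "cutoff n (dx (dx (rho u))) x = - (cutoff n u x - Re (u 0))"
proof -
  have "cutoff n (\<lambda>k. if k = 0 then u 0 else 0) x = Re (u 0)"
  proof -
    have "tsum (2 ^ (n + 2)) (\<lambda>k. complex_of_real (low n k) * (if k = 0 then u 0 else 0)) x =
       (\<Sum>k\<in>{-int (2 ^ (n + 2))..int (2 ^ (n + 2))}. if k = 0 then u 0 else 0)"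
      unfolding tsum_def by (rule sum.cong) (auto simp: low_at_0 assms)
    then show ?thesis by (simp add: cutoff_def)
  qed
  then show ?thesis by (simp add: dx_dx_rho cutoff_diff)
qed

text \<open>Membership in \<open>C\<^sup>\<alpha>\<close> is used only through this geometric decay, with \<open>q = 2\<^sup>-\<^sup>\<alpha>\<close>.\<close>
definition decays :: "real \<Rightarrow> real \<Rightarrow> tdistr \<Rightarrow> bool" where
  "decays q B f \<longleftrightarrow> (\<forall>j x. cmod (block j f x) \<le> B * q ^ j)"

section \<open>Consequences of the geometric decay of the blocks\<close>

lemma block_add: "block j (\<lambda>k. f k + g k) x = block j f x + block j g x"
  by (simp add: block_eq_tsum[OF order_refl] distrib_left tsum_add)

lemma block_diff: "block j (\<lambda>k. f k - g k) x = block j f x - block j g x"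
  by (simp add: block_eq_tsum[OF order_refl] right_diff_distrib tsum_diff)

lemma decays_add: "decays q B f \<Longrightarrow> decays q C g \<Longrightarrow> decays q (B + C) (\<lambda>k. f k + g k)"
  unfolding decays_def block_add distrib_right by (blast intro: order_trans[OF norm_triangle_ineq] add_mono)

lemma decays_diff: "decays q B f \<Longrightarrow> decays q C g \<Longrightarrow> decays q (B + C) (\<lambda>k. f k - g k)"
  unfolding decays_def block_diff distrib_right by (blast intro: order_trans[OF norm_triangle_ineq4] add_mono)

lemma decays_mono: "decays q B f \<Longrightarrow> B \<le> C \<Longrightarrow> 0 \<le> q \<Longrightarrow> decays q C f"
  unfolding decays_def by (blast intro: order_trans mult_right_mono zero_le_power)

lemma decays_nonneg: "decays q B f \<Longrightarrow> 0 \<le> B"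
  using norm_ge_zero[of "block 0 f 0"] order_trans[of 0 "cmod (block 0 f 0)" B]
  by (auto simp: decays_def dest!: spec[of _ 0])

lemma cutoff_diff_le:
  assumes f: "decays q B f" and q: "0 \<le> q" "q < 1" and "N \<le> n"
  shows "\<bar>cutoff n f x - cutoff N f x\<bar> \<le> B * (q ^ N / (1 - q))"
proof -
  have "cutoff n f x - cutoff N f x = Re (\<Sum>j=N..<n. block j f x)"
    unfolding cutoff_eq_sum minus_complex.sel(1)[symmetric] lessThan_atLeast0
    using \<open>N \<le> n\<close> by (subst sum_diff_nat_ivl) auto
  also have "\<bar>\<dots>\<bar> \<le> (\<Sum>j=N..<n. cmod (block j f x))"
    by (rule order_trans[OF abs_Re_le_cmod norm_sum])
  also have "\<dots> \<le> (\<Sum>j=N..<n. B * q ^ j)"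
    using f by (intro sum_mono) (auto simp: decays_def)
  also have "\<dots> \<le> B * (q ^ N / (1 - q))"
    unfolding sum_distrib_left[symmetric]
    using geometric_tail[OF q \<open>N \<le> n\<close>] decays_nonneg[OF f] by (intro mult_left_mono) auto
  finally show ?thesis .
qed

lemma tfun_diff_cutoff_le:
  assumes f: "decays q B f" and q: "0 \<le> q" "q < 1"
  shows "\<bar>tfun chi0 phi f x - cutoff n f x\<bar> \<le> B * (q ^ n / (1 - q))"
proof -
  have "summable (\<lambda>j. B * q ^ j)" using q by (intro summable_mult summable_geometric) auto
  then have "summable (\<lambda>j. block j f x)"
    by (rule summable_comparison_test') (use f in \<open>auto simp: decays_def\<close>)
  then have "(\<lambda>n. \<Sum>j<n. block j f x) \<longlonglongrightarrow> (\<Sum>j. block j f x)"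
    by (simp add: summable_LIMSEQ)
  then have "(\<lambda>n. cutoff n f x) \<longlonglongrightarrow> tfun chi0 phi f x"
    unfolding tfun_def cutoff_eq_sum by (rule tendsto_Re)
  then have "(\<lambda>m. \<bar>cutoff m f x - cutoff n f x\<bar>) \<longlonglongrightarrow> \<bar>tfun chi0 phi f x - cutoff n f x\<bar>"
    by (intro tendsto_intros)
  then show ?thesis
    by (rule LIMSEQ_le_const2) (use cutoff_diff_le[OF f q] in blast)
qed

lemma cutoff_le: "decays q B f \<Longrightarrow> 0 \<le> q \<Longrightarrow> q < 1 \<Longrightarrow> \<bar>cutoff n f x\<bar> \<le> B / (1 - q)"
  using cutoff_diff_le[of q B f 0 n x] by (simp add: cutoff_eq_sum)

lemma tfun_le: "decays q B f \<Longrightarrow> 0 \<le> q \<Longrightarrow> q < 1 \<Longrightarrow> \<bar>tfun chi0 phi f x\<bar> \<le> B / (1 - q)"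
  using tfun_diff_cutoff_le[of q B f x 0] by (simp add: cutoff_eq_sum)

text \<open>Block \<open>j\<close> has degree at most \<open>2 ^ (j + 2)\<close>, so Bernstein's
  inequality costs 50 * 4 * 2^j, whence the 200.\<close>

lemma block_dx_le:
  assumes f: "decays q B f"
  shows "cmod (block j (dx f) x) \<le> 200 * B * (2 * q) ^ j"
proof -
  have "cmod (tsum (2 ^ (j + 2)) (dx (\<lambda>k. complex_of_real (lpm j k) * f k)) x) \<le> 50 * (2 ^ (j + 2)) * (B * q ^ j)"
    using bernstein[of "2 ^ (j + 2)" "\<lambda>k. complex_of_real (lpm j k) * f k" "B * q ^ j" x] f
    unfolding decays_def block_eq_tsum[OF order_refl] by auto
  then have "cmod (block j (dx f) x) \<le> 50 * (2 ^ (j + 2)) * (B * q ^ j)"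
    by (simp only: block_eq_tsum[OF order_refl] dx_multiplier)
  also have "\<dots> = 200 * B * (2 * q) ^ j" by (simp add: power_mult_distrib)
  finally show ?thesis .
qed

lemma cutoff_dx_le:
  assumes f: "decays q B f" and q: "1 < 2 * q"
  shows "\<bar>cutoff n (dx f) x\<bar> \<le> 200 * B * ((2 * q) ^ n / (2 * q - 1))"
proof -
  have "\<bar>cutoff n (dx f) x\<bar> \<le> (\<Sum>j<n. cmod (block j (dx f) x))"
    unfolding cutoff_eq_sum by (rule order_trans[OF abs_Re_le_cmod norm_sum])
  also have "\<dots> \<le> (\<Sum>j<n. 200 * B * (2 * q) ^ j)"
    by (intro sum_mono block_dx_le f)
  also have "\<dots> = 200 * B * (\<Sum>j<n. (2 * q) ^ j)" by (rule sum_distrib_left[symmetric])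
  also have "\<dots> = 200 * B * (((2 * q) ^ n - 1) / (2 * q - 1))"
    using q by (subst geometric_sum) auto
  also have "\<dots> \<le> 200 * B * ((2 * q) ^ n / (2 * q - 1))"
    using decays_nonneg[OF f] q by (intro mult_left_mono divide_right_mono) auto
  finally show ?thesis .
qed

text \<open>Carries continuity in the Besov norm over to single Fourier modes. At frequency
  \<open>k\<close> finitely many multipliers sum to 1, and each product \<open>lpm j k * f k\<close>
  is a Fourier coefficient of a block, hence bounded by its supremum.\<close>

lemma coefficient_le:
  assumes f: "decays q B f" and q: "0 \<le> q" "q < 1"
  shows "cmod (f k) \<le> B / (1 - q)"
proof -
  obtain m where m: "\<bar>real_of_int k\<bar> * (4/3) < 2 ^ m"
    using real_arch_pow[of 2 "\<bar>real_of_int k\<bar> * (4/3)"] by auto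
  then have low: "low (Suc m) k = 1" by (intro low_Suc_eq_1) simp
  have "f k = (\<Sum>j<Suc m. complex_of_real (lpm j k) * f k)"
    unfolding sum_distrib_right[symmetric] of_real_sum[symmetric] low_def[symmetric] low by simp
  also have "cmod \<dots> \<le> (\<Sum>j<Suc m. B * q ^ j)"
  proof (intro sum_norm_le)
    fix j
    \<comment> \<open>The padding by \<bar>k\<bar> puts \<open>k\<close> in the range of
      \<open>cf_tsum\<close>; the multiplier vanishes at the added frequencies outside the
      block.\<close>
    let ?M = "2 ^ (j + 2) + nat \<bar>k\<bar>"
    have "complex_of_real (lpm j k) * f k = cf (tsum ?M (\<lambda>k. complex_of_real (lpm j k) * f k)) k"
      by (subst cf_tsum) auto
    also have "cmod \<dots> \<le> B * q ^ j"
    proof (rule cf_le)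
      fix x :: real
      show "cmod (tsum ?M (\<lambda>k. complex_of_real (lpm j k) * f k) x) \<le> B * q ^ j"
        using f by (subst block_eq_tsum[symmetric]) (auto simp: decays_def)
    qed (intro continuous_intros)
    finally show "cmod (complex_of_real (lpm j k) * f k) \<le> B * q ^ j" .
  qed
  also have "\<dots> = B * (\<Sum>j=0..<Suc m. q ^ j)" by (simp only: sum_distrib_left lessThan_atLeast0)
  also have "\<dots> \<le> B * (q ^ 0 / (1 - q))"
    using geometric_tail[OF q, of 0 "Suc m"] decays_nonneg[OF f] by (intro mult_left_mono) auto
  finally show ?thesis by simp
qed

text \<open>One derivative is gained, so no Bernstein inequality is needed; the factor \<open>2\<close> comes from
  the mean, which the lowest block of \<open>u\<close> contains.\<close>
lemma decays_dx_rho: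
  assumes u: "decays q B u"
  shows "decays q (2 * B) (dx (rho u))"
  unfolding decays_def
proof (intro allI)
  fix j x
  have B: "0 \<le> B" by (rule decays_nonneg[OF u])
  have u0: "cmod (complex_of_real (lpm j 0) * u 0) \<le> B * q ^ j"
  proof -
    let ?M = "2 ^ (j + 2) :: nat"
    have "complex_of_real (lpm j 0) * u 0 = cf (tsum ?M (\<lambda>k. complex_of_real (lpm j k) * u k)) 0"
      by (subst cf_tsum) auto
    also have "cmod \<dots> \<le> B * q ^ j"
    proof (rule cf_le)
      fix x :: real
      show "cmod (tsum ?M (\<lambda>k. complex_of_real (lpm j k) * u k) x) \<le> B * q ^ j"
        using u by (subst block_eq_tsum[symmetric]) (auto simp: decays_def)
    qed (intro continuous_intros)
    finally show ?thesis .
  qed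
  let ?c = "\<lambda>k. complex_of_real (lpm j k) * dx (rho u) k"
  have dxc: "dx ?c = (\<lambda>k. (if k = 0 then complex_of_real (lpm j 0) * u 0 else 0) - complex_of_real (lpm j k) * u k)"
    unfolding dx_multiplier dx_dx_rho by (simp add: fun_eq_iff right_diff_distrib)
  have *: "cmod (tsum (2 ^ (j + 2)) (dx ?c) y) \<le> 2 * B * q ^ j" for y
  proof -
    have "tsum (2 ^ (j + 2)) (\<lambda>k. if k = 0 then complex_of_real (lpm j 0) * u 0 else 0) y =
       (\<Sum>k\<in>{-int (2 ^ (j + 2))..int (2 ^ (j + 2))}. if k = 0 then complex_of_real (lpm j 0) * u 0 else 0)"
      unfolding tsum_def by (rule sum.cong) auto
    then have "tsum (2 ^ (j + 2)) (\<lambda>k. if k = 0 then complex_of_real (lpm j 0) * u 0 else 0) y =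
        complex_of_real (lpm j 0) * u 0" by simp
    then have "tsum (2 ^ (j + 2)) (dx ?c) y = complex_of_real (lpm j 0) * u 0 - block j u y"
      unfolding dxc tsum_diff by (simp only: block_eq_tsum[OF order_refl])
    also have "cmod \<dots> \<le> B * q ^ j + B * q ^ j"
      using u0 u by (intro order_trans[OF norm_triangle_ineq4] add_mono) (auto simp: decays_def)
    finally show ?thesis by simp
  qed
  have "?c 0 = 0" by (simp add: dx_def)
  from mean_zero_tsum_le[of ?c, OF this *]
  show "cmod (block j (dx (rho u)) x) \<le> 2 * B * q ^ j"
    unfolding block_eq_tsum[OF order_refl] .
qed

section \<open>Geometric decay of the blocks against the Besov norm\<close>

lemma block_periodic: "block j f x = block j f (frac x)"
proof -
  have "x = frac x + of_int \<lfloor>x\<rfloor>" by (simp add: frac_def)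
  then show ?thesis unfolding block_eq_tsum[OF order_refl] by (metis tsum_add_int)
qed

lemma bdd_above_block: "bdd_above ((\<lambda>x. cmod (block j f x)) ` {0..1})"
proof -
  have "compact ((\<lambda>x. cmod (block j f x)) ` {0..1})"
    unfolding block_eq_tsum[OF order_refl] by (intro compact_continuous_image continuous_intros) simp
  then show ?thesis by (rule bounded_imp_bdd_above[OF compact_imp_bounded])
qed

text \<open>\<open>besov_norm\<close> is a real supremum and bounds the single terms only when the
  family is bounded above. Assuming just that, instead of \<open>besov\<close>, makes the lemma
  applicable to differences.\<close>

lemma decays_if_bdd:
  assumes "bdd_above (range (\<lambda>j. 2 powr ((real j - 1) * \<alpha>) * (SUP x\<in>{0..1}. cmod (block j f x))))"
  shows "decays (2 powr - \<alpha>) (2 powr \<alpha> * besov_norm chi0 phi \<alpha> f) f"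
  unfolding decays_def
proof (intro allI)
  fix j x
  let ?q = "2 powr - \<alpha>" and ?s = "SUP x\<in>{0..1}. cmod (block j f x)"
  have q: "0 < ?q" by simp
  have "?q * (1 / ?q ^ j) * ?s \<le> besov_norm chi0 phi \<alpha> f"
    unfolding besov_norm_def powr_block_index[symmetric] by (rule cSUP_upper[OF _ assms]) simp
  from mult_right_mono[OF this, of "?q ^ j / ?q"] have 1: "?q * (1 / ?q ^ j) * ?s * (?q ^ j / ?q) \<le> besov_norm chi0 phi \<alpha> f * (?q ^ j / ?q)"
    using q by simp
  have 2: "p * (1 / p ^ j) * s * (p ^ j / p) = s" if "p > 0" for p s :: real using that by simp
  have "1 / ?q = 2 powr \<alpha>" by (simp only: powr_minus_divide) simp
  then have 3: "besov_norm chi0 phi \<alpha> f * (?q ^ j / ?q) = 2 powr \<alpha> * besov_norm chi0 phi \<alpha> f * ?q ^ j"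
    by (simp only: mult_ac times_divide_eq_right[symmetric] divide_inverse) simp
  have "cmod (block j f x) \<le> ?s"
    unfolding block_periodic[of j f x]
    by (rule cSUP_upper[OF _ bdd_above_block]) (simp add: frac_lt_1 less_imp_le)
  also have "?s \<le> 2 powr \<alpha> * besov_norm chi0 phi \<alpha> f * ?q ^ j"
    using 1 unfolding 2[OF q] 3 .
  finally show "cmod (block j f x) \<le> 2 powr \<alpha> * besov_norm chi0 phi \<alpha> f * ?q ^ j" .
qed

lemma bdd_if_decays:
  assumes "decays (2 powr - \<alpha>) B f"
  shows "bdd_above (range (\<lambda>j. 2 powr ((real j - 1) * \<alpha>) * (SUP x\<in>{0..1}. cmod (block j f x))))"
    and "besov_norm chi0 phi \<alpha> f \<le> 2 powr - \<alpha> * B"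
proof -
  have le: "2 powr ((real j - 1) * \<alpha>) * (SUP x\<in>{0..1}. cmod (block j f x)) \<le> 2 powr - \<alpha> * B" for j
  proof -
    let ?q = "2 powr - \<alpha>"
    have "(SUP x\<in>{0..1}. cmod (block j f x)) \<le> B * ?q ^ j"
      by (rule cSUP_least) (use assms in \<open>auto simp: decays_def\<close>)
    then have "?q * (1 / ?q ^ j) * (SUP x\<in>{0..1}. cmod (block j f x)) \<le> ?q * (1 / ?q ^ j) * (B * ?q ^ j)"
      by (intro mult_left_mono) auto
    then show ?thesis unfolding powr_block_index by simp
  qed
  then show "bdd_above (range (\<lambda>j. 2 powr ((real j - 1) * \<alpha>) * (SUP x\<in>{0..1}. cmod (block j f x))))"
    by (intro bdd_aboveI2)
  show "besov_norm chi0 phi \<alpha> f \<le> 2 powr - \<alpha> * B"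
    unfolding besov_norm_def by (rule cSUP_least) (use le in auto)
qed

lemma decays_besov: "besov chi0 phi \<alpha> f \<Longrightarrow> decays (2 powr - \<alpha>) (2 powr \<alpha> * besov_norm chi0 phi \<alpha> f) f"
  unfolding besov_def by (erule conjE) (rule decays_if_bdd)

text \<open>The decay of both functions first shows that the supremum for the difference is finite.
  Only then does the norm of the difference itself serve as the constant, which is what convergence
  in norm requires.\<close>

lemma decays_besov_diff:
  assumes "besov chi0 phi \<alpha> f" "besov chi0 phi \<alpha> g"
  shows "decays (2 powr - \<alpha>) (2 powr \<alpha> * besov_norm chi0 phi \<alpha> (\<lambda>k. f k - g k)) (\<lambda>k. f k - g k)"
  by (rule decays_if_bdd) (rule bdd_if_decays(1)[OF decays_diff[OF assms[THEN decays_besov]]])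

lemma besov_norm_nonneg: "besov chi0 phi \<alpha> f \<Longrightarrow> 0 \<le> besov_norm chi0 phi \<alpha> f"
  using decays_nonneg[OF decays_besov, of \<alpha> f] by (simp add: zero_le_mult_iff)

end

section \<open>Mild solutions\<close>

locale mild = littlewood_paley +
  fixes \<alpha> \<eta> T chi m :: real and \<zeta> :: tdistr and Z w :: "real \<Rightarrow> tdistr"
  assumes alpha: "0 < \<alpha>" "\<alpha> < 1" and eta_pos: "0 < \<eta>" and chi_pos: "0 < chi"
    and Z: "CT_besov0 chi0 phi T \<alpha> Z"
    and mean: "tmean \<zeta> = complex_of_real m"
    and mild: "mild_solution chi0 phi \<eta> \<alpha> T chi \<zeta> Z w"
begin

definition q :: real where "q = 2 powr - \<alpha>"

definition u :: "real \<Rightarrow> tdistr" where "u s = (\<lambda>k. w s k + Z s k)"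

definition flux :: "real \<Rightarrow> tdistr" where "flux s = fcoeff (nonlin chi0 phi (u s))"

lemma q: "0 < q" "q < 1" "1 < 2 * q"
  unfolding q_def by (rule two_powr_minus_bounds[OF alpha])+

lemma C_eta_w: "C_eta_besov chi0 phi \<eta> T \<alpha> w"
  using mild unfolding mild_solution_def by (rule conjunct1)

lemma
  assumes "t \<in> {0<..T}"
  shows besov_w: "besov chi0 phi \<alpha> (w t)"
    and w_tendsto: "((\<lambda>s. besov_norm chi0 phi \<alpha> (\<lambda>k. w s k - w t k)) \<longlongrightarrow> 0) (at t within {0<..T})"
  using bspec[OF conjunct1[OF C_eta_w[unfolded C_eta_besov_def]] assms] by (rule conjunct1, rule conjunct2)

lemma
  assumes "t \<in> {0..T}"
  shows besov_Z: "besov chi0 phi \<alpha> (Z t)" and mean_Z: "Z t 0 = 0"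
    and Z_tendsto: "((\<lambda>s. besov_norm chi0 phi \<alpha> (\<lambda>k. Z s k - Z t k)) \<longlongrightarrow> 0) (at t within {0..T})"
proof -
  note * = bspec[OF Z[unfolded CT_besov0_def] assms]
  show "besov chi0 phi \<alpha> (Z t)" by (rule conjunct1[OF *])
  show "Z t 0 = 0" using conjunct1[OF conjunct2[OF *]] by (simp add: tmean_def)
  show "((\<lambda>s. besov_norm chi0 phi \<alpha> (\<lambda>k. Z s k - Z t k)) \<longlongrightarrow> 0) (at t within {0..T})"
    by (rule conjunct2[OF conjunct2[OF *]])
qed

lemma continuous_coefficient:
  assumes f: "\<And>s. s \<in> A \<Longrightarrow> besov chi0 phi \<alpha> (f s)"
    and lim: "\<And>t. t \<in> A \<Longrightarrow> ((\<lambda>s. besov_norm chi0 phi \<alpha> (\<lambda>k. f s k - f t k)) \<longlongrightarrow> 0) (at t within A)"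
  shows "continuous_on A (\<lambda>s. f s k)"
  unfolding continuous_on_def
proof
  fix t assume t: "t \<in> A"
  have "((\<lambda>s. f s k - f t k) \<longlongrightarrow> 0) (at t within A)"
  proof (rule Lim_null_comparison)
    show "\<forall>\<^sub>F s in at t within A. norm (f s k - f t k) \<le> 2 powr \<alpha> * besov_norm chi0 phi \<alpha> (\<lambda>k. f s k - f t k) / (1 - q)"
      unfolding eventually_at_topological
      using coefficient_le[OF decays_besov_diff[OF f f[OF t]], folded q_def] q by (intro exI[of _ UNIV]) auto
    show "((\<lambda>s. 2 powr \<alpha> * besov_norm chi0 phi \<alpha> (\<lambda>k. f s k - f t k) / (1 - q)) \<longlongrightarrow> 0) (at t within A)"
      using q by (auto intro!: tendsto_eq_intros lim[OF t])
  qed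
  then show "((\<lambda>s. f s k) \<longlongrightarrow> f t k) (at t within A)" by (simp add: LIM_zero_iff)
qed

lemma continuous_w: "continuous_on {0<..T} (\<lambda>s. w s k)"
  by (rule continuous_coefficient[OF besov_w w_tendsto])

lemma continuous_Z: "continuous_on {0..T} (\<lambda>s. Z s k)"
  by (rule continuous_coefficient[OF besov_Z Z_tendsto])

text \<open>The detour through \<open>decays\<close> loses nothing: the factors
  \<open>2 powr \<alpha>\<close> and \<open>2 powr - \<alpha>\<close> cancel, so the triangle
  inequality holds with constant 1, as continuity of the norm demands.\<close>

lemma besov_norm_triangle:
  assumes "besov chi0 phi \<alpha> f" "besov chi0 phi \<alpha> g"
  shows "besov_norm chi0 phi \<alpha> f \<le> besov_norm chi0 phi \<alpha> g + besov_norm chi0 phi \<alpha> (\<lambda>k. f k - g k)"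
proof -
  have "decays (2 powr - \<alpha>) (2 powr \<alpha> * besov_norm chi0 phi \<alpha> g + 2 powr \<alpha> * besov_norm chi0 phi \<alpha> (\<lambda>k. f k - g k)) f"
    using decays_add[OF decays_besov[OF assms(2)] decays_besov_diff[OF assms]] by simp
  from bdd_if_decays(2)[OF this] show ?thesis
    unfolding distrib_left mult.assoc[symmetric] powr_add[symmetric] by simp
qed

lemma besov_norm_commute: "besov_norm chi0 phi \<alpha> (\<lambda>k. f k - g k) = besov_norm chi0 phi \<alpha> (\<lambda>k. g k - f k)"
  by (simp add: besov_norm_def block_diff norm_minus_commute)

text \<open>Makes \<open>sup_norm_CT\<close> a genuine supremum: the reverse triangle inequality
  gives continuity of the norm in time, and the interval is compact.\<close>

lemma bdd_above_besov_norm_Z: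
  assumes "t \<le> T"
  shows "bdd_above ((\<lambda>s. besov_norm chi0 phi \<alpha> (Z s)) ` {0..t})"
proof -
  have "continuous_on {0..T} (\<lambda>s. besov_norm chi0 phi \<alpha> (Z s))"
    unfolding continuous_on_def
  proof
    fix t assume t: "t \<in> {0..T}"
    have "((\<lambda>s. besov_norm chi0 phi \<alpha> (Z s) - besov_norm chi0 phi \<alpha> (Z t)) \<longlongrightarrow> 0) (at t within {0..T})"
    proof (rule Lim_null_comparison[OF _ Z_tendsto[OF t]])
      have "norm (besov_norm chi0 phi \<alpha> (Z s) - besov_norm chi0 phi \<alpha> (Z t)) \<le> besov_norm chi0 phi \<alpha> (\<lambda>k. Z s k - Z t k)"
        if "s \<in> {0..T}" for s
        using besov_norm_triangle[OF besov_Z[OF that] besov_Z[OF t]]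
          besov_norm_triangle[OF besov_Z[OF t] besov_Z[OF that]]
        unfolding besov_norm_commute[of "Z t" "Z s"] real_norm_def abs_le_iff by linarith
      then show "\<forall>\<^sub>F s in at t within {0..T}. norm (besov_norm chi0 phi \<alpha> (Z s) - besov_norm chi0 phi \<alpha> (Z t)) \<le> besov_norm chi0 phi \<alpha> (\<lambda>k. Z s k - Z t k)"
        unfolding eventually_at_topological by (intro exI[of _ UNIV]) auto
    qed
    then show "((\<lambda>s. besov_norm chi0 phi \<alpha> (Z s)) \<longlongrightarrow> besov_norm chi0 phi \<alpha> (Z t)) (at t within {0..T})"
      by (simp add: LIM_zero_iff)
  qed
  then have "continuous_on {0..t} (\<lambda>s. besov_norm chi0 phi \<alpha> (Z s))"
    by (rule continuous_on_subset) (use assms in auto)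
  then have "compact ((\<lambda>s. besov_norm chi0 phi \<alpha> (Z s)) ` {0..t})"
    by (rule compact_continuous_image) simp
  then show ?thesis by (rule bounded_imp_bdd_above[OF compact_imp_bounded])
qed

lemma decays_Z:
  assumes "0 \<le> s" "s \<le> t" "t \<le> T"
  shows "decays q (2 powr \<alpha> * sup_norm_CT chi0 phi t \<alpha> Z) (Z s)"
proof -
  have "besov_norm chi0 phi \<alpha> (Z s) \<le> sup_norm_CT chi0 phi t \<alpha> Z"
    unfolding sup_norm_CT_def using bdd_above_besov_norm_Z[OF assms(3)] assms by (intro cSUP_upper) auto
  then show ?thesis
    unfolding q_def using assms
    by (intro decays_mono[OF decays_besov[OF besov_Z]]) auto
qed

text \<open>On \<open>{a..T}\<close> the weight is at least its value at \<open>a\<close>. The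
  constant \<open>B\<close> is not controlled as \<open>a\<close> tends to 0; it is used only for
  fixed \<open>a\<close>.\<close>

lemma decays_w:
  assumes a: "0 < a"
  shows "\<exists>B. \<forall>s\<in>{a..T}. decays q B (w s)"
proof -
  have "bdd_above ((\<lambda>t. min (t powr \<eta>) 1 * besov_norm chi0 phi \<alpha> (w t)) ` {0<..T})"
    by (rule conjunct2[OF C_eta_w[unfolded C_eta_besov_def]])
  then obtain K where K: "\<And>t. t \<in> {0<..T} \<Longrightarrow> min (t powr \<eta>) 1 * besov_norm chi0 phi \<alpha> (w t) \<le> K"
    unfolding bdd_above_def by blast
  define c where "c = min (a powr \<eta>) 1"
  have c: "0 < c" using a by (simp add: c_def)
  have "decays q (2 powr \<alpha> * (K / c)) (w s)" if s: "s \<in> {a..T}" for s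
  proof -
    have s': "s \<in> {0<..T}" using s a by auto
    have "a powr \<eta> \<le> s powr \<eta>" using s a eta_pos by (intro powr_mono2) auto
    then have "c \<le> min (s powr \<eta>) 1" by (auto simp: c_def min_def)
    then have "c * besov_norm chi0 phi \<alpha> (w s) \<le> min (s powr \<eta>) 1 * besov_norm chi0 phi \<alpha> (w s)"
      by (rule mult_right_mono) (rule besov_norm_nonneg[OF besov_w[OF s']])
    also have "\<dots> \<le> K" by (rule K[OF s'])
    finally have "besov_norm chi0 phi \<alpha> (w s) \<le> K / c" using c by (simp add: field_simps)
    then show ?thesis
      unfolding q_def by (intro decays_mono[OF decays_besov[OF besov_w[OF s']]] mult_left_mono) auto
  qed
  then show ?thesis by blast
qed

lemma decays_uniform:
  assumes a: "0 < a"
  shows "\<exists>B>0. \<forall>s\<in>{a..T}. decays q B (w s) \<and> decays q B (u s) \<and> decays q B (dx (rho (u s)))"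
proof -
  obtain B1 where B1: "\<And>s. s \<in> {a..T} \<Longrightarrow> decays q B1 (w s)" using decays_w[OF a] by blast
  define B2 where "B2 = 2 powr \<alpha> * sup_norm_CT chi0 phi T \<alpha> Z"
  have B2: "decays q B2 (Z s)" if "s \<in> {a..T}" for s
    unfolding B2_def using that a by (intro decays_Z) auto
  \<comment> \<open>The factor 2 is the loss in \<open>decays_dx_rho\<close>, and the summand 1
    makes \<open>B\<close> positive.\<close>
  define B where "B = 2 * (\<bar>B1\<bar> + \<bar>B2\<bar>) + 1"
  have u: "decays q (\<bar>B1\<bar> + \<bar>B2\<bar>) (u s)" if "s \<in> {a..T}" for s
    using decays_mono[OF decays_add[OF B1[OF that] B2[OF that]], of "\<bar>B1\<bar> + \<bar>B2\<bar>"] q unfolding u_def by simp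
  show ?thesis
  proof (intro exI[of _ B] conjI ballI)
    show "0 < B" by (simp add: B_def)
    fix s assume s: "s \<in> {a..T}"
    show "decays q B (w s)" using q by (intro decays_mono[OF B1[OF s]]) (auto simp: B_def)
    show "decays q B (u s)" using q by (intro decays_mono[OF u[OF s]]) (auto simp: B_def)
    show "decays q B (dx (rho (u s)))" using q by (intro decays_mono[OF decays_dx_rho[OF u[OF s]]]) (auto simp: B_def)
  qed
qed

section \<open>Joint continuity in time and space\<close>

lemma continuous_on_cutoff_family:
  assumes "\<And>k. continuous_on A (\<lambda>s. f s k)"
  shows "continuous_on (A \<times> X) (\<lambda>p. cutoff n (f (fst p)) (snd p))"
  unfolding cutoff_def tsum_def
  by (intro continuous_intros continuous_on_compose2[OF assms continuous_on_fst]) auto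

text \<open>Cutoffs are finite sums of continuous modes and converge at the rate q^n, uniformly in
  time and space because \<open>B\<close> is common to all times.\<close>

lemma continuous_on_tfun_family:
  assumes f: "\<And>k. continuous_on A (\<lambda>s. f s k)" and B: "\<And>s. s \<in> A \<Longrightarrow> decays q B (f s)"
  shows "continuous_on (A \<times> X) (\<lambda>p. tfun chi0 phi (f (fst p)) (snd p))"
proof (rule uniform_limit_theorem[where F = sequentially and f = "\<lambda>n p. cutoff n (f (fst p)) (snd p)"])
  show "\<forall>\<^sub>F n in sequentially. continuous_on (A \<times> X) (\<lambda>p. cutoff n (f (fst p)) (snd p))"
    by (intro always_eventually allI continuous_on_cutoff_family f)
  show "uniform_limit (A \<times> X) (\<lambda>n p. cutoff n (f (fst p)) (snd p)) (\<lambda>p. tfun chi0 phi (f (fst p)) (snd p)) sequentially"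
  proof (rule uniform_limitI)
    fix e :: real assume e: "e > 0"
    have "(\<lambda>n. B * (q ^ n / (1 - q))) \<longlonglongrightarrow> B * (0 / (1 - q))"
      using q by (intro tendsto_intros LIMSEQ_realpow_zero) auto
    then have "\<forall>\<^sub>F n in sequentially. B * (q ^ n / (1 - q)) < e"
      using e by (intro order_tendstoD) auto
    then show "\<forall>\<^sub>F n in sequentially. \<forall>p\<in>A \<times> X. dist (cutoff n (f (fst p)) (snd p)) (tfun chi0 phi (f (fst p)) (snd p)) < e"
    proof eventually_elim
      case (elim n)
      show ?case
      proof
        fix p assume "p \<in> A \<times> X"
        then have "decays q B (f (fst p))" using B by auto
        from tfun_diff_cutoff_le[OF this, of "snd p" n] q elim
        show "dist (cutoff n (f (fst p)) (snd p)) (tfun chi0 phi (f (fst p)) (snd p)) < e"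
          by (simp add: dist_real_def abs_minus_commute)
      qed
    qed
  qed
qed simp

lemma continuous_u: "0 < a \<Longrightarrow> continuous_on {a..T} (\<lambda>s. u s k)"
  unfolding u_def
  by (intro continuous_intros continuous_on_subset[OF continuous_w] continuous_on_subset[OF continuous_Z]) auto

lemma continuous_dx_rho_u: "0 < a \<Longrightarrow> continuous_on {a..T} (\<lambda>s. dx (rho (u s)) k)"
proof -
  assume "0 < a"
  define c where "c = (if k = 0 then 0 else \<i> * complex_of_real (2 * pi * real_of_int k)
      / complex_of_real (4 * pi\<^sup>2 * (real_of_int k)\<^sup>2))"
  have *: "dx (rho (u s)) k = c * u s k" for s
    unfolding dx_def rho_def c_def by simp
  show ?thesis
    unfolding * by (rule continuous_on_mult[OF continuous_on_const continuous_u[OF \<open>0 < a\<close>]])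
qed

lemma continuous_nonlin:
  assumes "0 < a"
  shows "continuous_on ({a..T} \<times> X) (\<lambda>p. nonlin chi0 phi (u (fst p)) (snd p))"
proof -
  obtain B where *: "\<forall>s\<in>{a..T}. decays q B (w s) \<and> decays q B (u s) \<and> decays q B (dx (rho (u s)))"
    using decays_uniform[OF assms] by (elim exE conjE)
  have B: "decays q B (u s)" "decays q B (dx (rho (u s)))" if "s \<in> {a..T}" for s
    using bspec[OF * that] by simp_all
  have 1: "continuous_on ({a..T} \<times> X) (\<lambda>p. tfun chi0 phi (u (fst p)) (snd p))"
    by (rule continuous_on_tfun_family[where f = u, OF continuous_u[OF assms] B(1)])
  have 2: "continuous_on ({a..T} \<times> X) (\<lambda>p. tfun chi0 phi (dx (rho (u (fst p)))) (snd p))"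
    by (rule continuous_on_tfun_family[where f = "\<lambda>s. dx (rho (u s))", OF continuous_dx_rho_u[OF assms] B(2)])
  show ?thesis unfolding nonlin_def by (rule continuous_on_mult[OF continuous_on_power[OF 1] 2])
qed

lemma continuous_flux:
  assumes "0 < a"
  shows "continuous_on {a..T} (\<lambda>s. flux s k)"
proof -
  have "continuous_on ({a..T} \<times> cbox 0 1) (\<lambda>(s, x). complex_of_real (nonlin chi0 phi (u s) x) * ek (- k) x)"
    unfolding split_beta by (intro continuous_intros continuous_nonlin[OF assms])
  from integral_continuous_on_param[OF this]
  show ?thesis by (simp add: flux_def fcoeff_eq_cf cf_def)
qed

lemma mild_formula:
  assumes "t \<in> {0<..T}"
  shows "(\<lambda>s. heat (t - s) (dx (flux s)) k) integrable_on {0..t}"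
    and "w t k = heat t \<zeta> k + complex_of_real chi * integral {0..t} (\<lambda>s. heat (t - s) (dx (flux s)) k)"
  using spec[OF bspec[OF conjunct2[OF mild[unfolded mild_solution_def]] assms], of k]
  unfolding flux_def u_def by (rule conjunct1, rule conjunct2)

text \<open>Mass conservation: at frequency 0 the heat factor is 1 and the drift, being a
  derivative, vanishes.\<close>

lemma mean_w: "t \<in> {0<..T} \<Longrightarrow> w t 0 = complex_of_real m"
  using mild_formula(2)[of t 0] mean by (simp add: heat_def dx_def tmean_def)

text \<open>In Duhamel's formula the factor \<open>exp (- l * t)\<close> comes out of the integral
  and leaves a variable upper limit. Continuity of the integrand \<open>g\<close> is available only
  away from time 0, hence the split at \<open>a\<close>, after which the fundamental theorem
  applies. The right-hand side is kept in divergence form for the later integration by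
  parts.\<close>

lemma w_has_vector_derivative:
  assumes a: "0 < a" and t: "t \<in> {a..T}"
  shows "((\<lambda>t. w t k) has_vector_derivative dx (\<lambda>k. dx (w t) k + complex_of_real chi * flux t k) k) (at t within {a..T})"
proof -
  define l where "l = 4 * pi\<^sup>2 * (real_of_int k)\<^sup>2"
  define g where "g s = complex_of_real (exp (l * s)) * dx (flux s) k" for s
  have aT: "a \<in> {0<..T}" "T \<in> {0<..T}" using a t by auto
  have heat: "heat (t - s) (dx (flux s)) k = complex_of_real (exp (- l * t)) * g s" for t s
  proof -
    have "exp (- 4 * pi\<^sup>2 * (real_of_int k)\<^sup>2 * (t - s)) = exp (- l * t) * exp (l * s)"
      by (simp add: l_def exp_add[symmetric] right_diff_distrib)
    then show ?thesis unfolding heat_def g_def by simp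
  qed
  have cancel: "complex_of_real (exp x) * (complex_of_real (exp (- x)) * z) = z" for x z
    by (simp add: exp_minus)
  \<comment> \<open>Integrability down to time 0 is part of the notion of mild solution; at time
    \<open>T\<close> only the exponential prefactor has to be undone.\<close>
  have g_int: "g integrable_on {0..T}"
  proof -
    have "(\<lambda>s. complex_of_real (exp (l * T)) * (complex_of_real (exp (- l * T)) * g s)) integrable_on {0..T}"
      using mild_formula(1)[OF aT(2), of k] unfolding heat by (rule integrable_on_mult_right)
    then show ?thesis using cancel[of "l * T"] by simp
  qed
  define W where "W t = complex_of_real (exp (- l * t)) * (\<zeta> k + complex_of_real chi * (integral {0..a} g + integral {a..t} g))" for t
  have wW: "w r k = W r" if r: "r \<in> {a..T}" for r
  proof -
    have "integral {0..a} g + integral {a..r} g = integral {0..r} g"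
      using r a by (intro Henstock_Kurzweil_Integration.integral_combine integrable_on_subinterval[OF g_int]) auto
    moreover have "integral {0..r} (\<lambda>s. heat (r - s) (dx (flux s)) k) = complex_of_real (exp (- l * r)) * integral {0..r} g"
      unfolding heat by (rule integral_mult_right)
    ultimately show ?thesis
      using mild_formula(2)[of r k] r a by (simp add: W_def heat_def l_def distrib_left mult.left_commute)
  qed
  have "continuous_on {a..T} g"
    unfolding g_def dx_def by (intro continuous_intros continuous_flux a)
  from integral_has_vector_derivative[OF this t]
  have 1: "((\<lambda>t. integral {a..t} g) has_vector_derivative g t) (at t within {a..T})" .
  have 2: "((\<lambda>t. complex_of_real (exp (- l * t))) has_vector_derivative complex_of_real (- l * exp (- l * t))) (at t within {a..T})"
    by (rule has_vector_derivative_of_real) (auto intro!: derivative_eq_intros simp flip: has_real_derivative_iff_has_vector_derivative)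
  have "(W has_vector_derivative complex_of_real (exp (- l * t)) * (0 + complex_of_real chi * (0 + g t))
       + complex_of_real (- l * exp (- l * t)) * (\<zeta> k + complex_of_real chi * (integral {0..a} g + integral {a..t} g))) (at t within {a..T})"
    unfolding W_def
    by (intro has_vector_derivative_mult has_vector_derivative_add has_vector_derivative_mult_right
        has_vector_derivative_const 1 2)
  moreover have "complex_of_real (exp (- l * t)) * (0 + complex_of_real chi * (0 + g t))
       + complex_of_real (- l * exp (- l * t)) * (\<zeta> k + complex_of_real chi * (integral {0..a} g + integral {a..t} g))
     = dx (\<lambda>k. dx (w t) k + complex_of_real chi * flux t k) k"
  proof -
    have e: "complex_of_real (exp (- l * t)) * g t = dx (flux t) k"
      using cancel[of "- (l * t)"] by (simp add: g_def)
    have A1: "complex_of_real (exp (- l * t)) * (0 + complex_of_real chi * (0 + g t)) = complex_of_real chi * dx (flux t) k"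
      unfolding e[symmetric] by simp
    have A2: "complex_of_real (- l * exp (- l * t)) * (\<zeta> k + complex_of_real chi * (integral {0..a} g + integral {a..t} g))
        = - complex_of_real l * w t k" unfolding wW[OF t] W_def by simp
    have A3: "dx (dx (w t)) k = - complex_of_real l * w t k"
      by (simp add: dx_def l_def power2_eq_square)
    have A4: "dx (\<lambda>k. dx (w t) k + complex_of_real chi * flux t k) k = dx (dx (w t)) k + complex_of_real chi * dx (flux t) k"
      by (simp add: dx_def distrib_left mult.left_commute)
    show ?thesis unfolding A1 A2 A3 A4 by simp
  qed
  ultimately have "(W has_vector_derivative dx (\<lambda>k. dx (w t) k + complex_of_real chi * flux t k) k) (at t within {a..T})"
    by simp
  then show ?thesis
    by (rule has_vector_derivative_transform[OF t, rotated]) (simp add: wW)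
qed

end

section \<open>The commutator and the energy identity\<close>

lemma cf_tsum_eq: "cf (tsum M c) k = (if \<bar>k\<bar> \<le> int M then c k else 0)"
proof -
  let ?c = "\<lambda>k. if \<bar>k\<bar> \<le> int M then c k else 0" and ?N = "M + nat \<bar>k\<bar>"
  have "tsum M c x = tsum M ?c x" for x by (rule tsum_cong) simp
  also have "\<dots>x = tsum ?N ?c x" for x by (rule tsum_extend[symmetric]) auto
  finally have "tsum M c = tsum ?N ?c" by (rule ext)
  then show ?thesis using cf_tsum[of k ?N ?c] by simp
qed

lemma cf_diff:
  assumes "continuous_on {0..1} F" "continuous_on {0..1} G"
  shows "cf (\<lambda>x. F x - G x) k = cf F k - cf G k"
  unfolding cf_def left_diff_distrib
  by (intro integral_diff integrable_continuous_interval continuous_on_mult continuous_on_ek continuous_on_id assms)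

lemma cubic_difference_le:
  fixes a b c d A \<delta> :: real
  assumes "\<bar>a\<bar> \<le> A" "\<bar>b\<bar> \<le> A" "\<bar>c\<bar> \<le> A" "\<bar>a - c\<bar> \<le> \<delta>" "\<bar>b - d\<bar> \<le> \<delta>"
  shows "\<bar>a\<^sup>2 * b - c\<^sup>2 * d\<bar> \<le> 3 * A\<^sup>2 * \<delta>"
proof -
  have A: "0 \<le> A" "0 \<le> \<delta>" using assms by linarith+
  have eq: "a\<^sup>2 * b - c\<^sup>2 * d = (a - c) * (a + c) * b + c\<^sup>2 * (b - d)"
    by (simp add: power2_eq_square algebra_simps)
  have "\<bar>(a - c) * (a + c) * b\<bar> \<le> \<delta> * (2 * A) * A"
    unfolding abs_mult using assms A by (intro mult_mono) auto
  moreover have "\<bar>c\<^sup>2 * (b - d)\<bar> \<le> A\<^sup>2 * \<delta>"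
    unfolding abs_mult using assms A by (intro mult_mono) (auto simp: abs_le_square_iff[symmetric])
  moreover have "\<delta> * (2 * A) * A + A\<^sup>2 * \<delta> = 3 * A\<^sup>2 * \<delta>" by (simp add: power2_eq_square)
  ultimately show ?thesis unfolding eq by linarith
qed

context littlewood_paley
begin

lemma cutoff_cmult: "cutoff n (\<lambda>k. complex_of_real a * f k) x = a * cutoff n f x"
proof -
  have "(\<lambda>k. complex_of_real (low n k) * (complex_of_real a * f k)) = (\<lambda>k. complex_of_real a * (complex_of_real (low n k) * f k))"
    by (simp add: fun_eq_iff)
  then show ?thesis by (simp add: cutoff_def tsum_cmult)
qed

lemma cutoff_fcoeff_L2:
  assumes g: "continuous_on {0..1} g"
  shows "integral {0..1} (\<lambda>x. (cutoff n (fcoeff g) x)\<^sup>2) \<le> integral {0..1} (\<lambda>x. (g x)\<^sup>2)"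
proof -
  let ?T = "tsum (2 ^ (n + 2)) (\<lambda>k. complex_of_real (low n k) * fcoeff g k)"
  have "integral {0..1} (\<lambda>x. (cutoff n (fcoeff g) x)\<^sup>2) \<le> integral {0..1} (\<lambda>x. (cmod (?T x))\<^sup>2)"
  proof (rule integral_le)
    show "(\<lambda>x. (cutoff n (fcoeff g) x)\<^sup>2) integrable_on {0..1}" "(\<lambda>x. (cmod (?T x))\<^sup>2) integrable_on {0..1}"
      by (intro integrable_continuous_interval continuous_intros)+
    fix x :: real
    show "(cutoff n (fcoeff g) x)\<^sup>2 \<le> (cmod (?T x))\<^sup>2"
      unfolding cutoff_def abs_le_square_iff[symmetric] using abs_Re_le_cmod by simp
  qed
  also have "\<dots> \<le> integral {0..1} (\<lambda>x. (cmod (complex_of_real (g x)))\<^sup>2)"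
    unfolding fcoeff_eq_cf
    by (rule multiplier_L2_contraction) (auto intro!: continuous_intros g low_nonneg low_le_1)
  finally show ?thesis by simp
qed

text \<open>\<open>low (j + 5)\<close> is 1 up to frequency 3/4 * 2^(j+4) = 3 * 2^(j+2), the degree
  of a product of three cutoffs at level \<open>j\<close>. This equality fixes the shift by
  5.\<close>

lemma cutoff_fcoeff_trig_polynomial:
  assumes Q: "tspan (3 * 2 ^ (j + 2)) (\<lambda>x. complex_of_real (Q x))"
  shows "cutoff (j + 5) (fcoeff Q) x = Q x"
proof -
  let ?M = "3 * 2 ^ (j + 2) :: nat"
  obtain c where c: "\<And>x. complex_of_real (Q x) = tsum ?M c x" using Q by (auto simp: tspan_def)
  let ?c = "\<lambda>k. if \<bar>k\<bar> \<le> int ?M then c k else 0"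
  have "complex_of_real (low (j + 5) k) * fcoeff Q k = ?c k" for k
  proof -
    have "fcoeff Q k = ?c k" unfolding fcoeff_eq_cf c by (rule cf_tsum_eq)
    moreover have "low (j + 5) k = 1" if k: "\<bar>k\<bar> \<le> int ?M"
    proof -
      have "real_of_int \<bar>k\<bar> \<le> real_of_int (int ?M)" using k by (simp only: of_int_le_iff)
      then have "\<bar>real_of_int k\<bar> \<le> 3/4 * 2 ^ (j + 4)" by (simp add: power_add)
      from low_Suc_eq_1[OF this] show ?thesis by (simp add: eval_nat_numeral)
    qed
    ultimately show ?thesis by simp
  qed
  then have "cutoff (j + 5) (fcoeff Q) x = Re (tsum (2 ^ (j + 5 + 2)) ?c x)" by (simp add: cutoff_def)
  also have "tsum (2 ^ (j + 5 + 2)) ?c x = tsum ?M ?c x"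
    by (rule tsum_extend) (auto simp: power_add)
  also have "tsum ?M ?c x = tsum ?M c x" by (rule tsum_cong) simp
  also have "tsum ?M c x = complex_of_real (Q x)" by (rule c[symmetric])
  finally show ?thesis by simp
qed

text \<open>The product \<open>Q\<close> of cutoffs at level \<open>j\<close> is a trigonometric polynomial that the cutoff at level
  \<open>j + 5\<close> leaves unchanged, so only the contraction of the cutoff in \<open>L\<^sup>2\<close> is used.\<close>
lemma commutator_L2:
  fixes f g :: tdistr
  assumes f: "decays q B f" and g: "decays q B g" and q: "0 \<le> q" "q < 1"
    and cont: "continuous_on {0..1} (tfun chi0 phi f)" "continuous_on {0..1} (tfun chi0 phi g)"
  shows "integral {0..1} (\<lambda>x. (cutoff (j + 5) (fcoeff (\<lambda>x. (tfun chi0 phi f x)\<^sup>2 * tfun chi0 phi g x)) x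
      - (cutoff (j + 5) f x)\<^sup>2 * cutoff (j + 5) g x)\<^sup>2) \<le> (6 * (B / (1 - q))\<^sup>2 * (B * (q ^ j / (1 - q))))\<^sup>2"
proof -
  define A where "A = B / (1 - q)"
  define \<delta> where "\<delta> = B * (q ^ j / (1 - q))"
  define N where "N x = (tfun chi0 phi f x)\<^sup>2 * tfun chi0 phi g x" for x
  define Q where "Q x = (cutoff j f x)\<^sup>2 * cutoff j g x" for x
  \<comment> \<open>The commutator is \<open>D\<close> plus the difference of \<open>Q\<close> and
    the same product at level \<open>j + 5\<close>. The contraction bounds \<open>D\<close> in L^2
    and the second part is bounded pointwise, both by 3 A^2 \<delta>; squaring the sum gives (6 A^2
    \<delta>)^2.\<close>
  define D where "D x = cutoff (j + 5) (fcoeff (\<lambda>x. N x - Q x)) x" for x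
  have cN: "continuous_on {0..1} N" and cQ: "continuous_on {0..1} Q" and cD: "continuous_on {0..1} D"
    unfolding N_def[abs_def] Q_def[abs_def] D_def[abs_def] by (intro continuous_intros cont)+
  have NQ: "\<bar>N x - Q x\<bar> \<le> 3 * A\<^sup>2 * \<delta>" for x
    unfolding N_def Q_def A_def \<delta>_def
    by (intro cubic_difference_le tfun_le cutoff_le tfun_diff_cutoff_le f g q)
  have span: "tspan (3 * 2 ^ (j + 2)) (\<lambda>x. complex_of_real (Q x))"
  proof -
    have c: "tspan (2 ^ (j + 2)) (\<lambda>x. complex_of_real (cutoff j h x))" for h
      unfolding cutoff_def by (intro tspan_Re tspan_tsum)
    have "tspan (2 ^ (j + 2) + 2 ^ (j + 2) + 2 ^ (j + 2))
       (\<lambda>x. complex_of_real (cutoff j f x) * complex_of_real (cutoff j f x) * complex_of_real (cutoff j g x))"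
      by (intro tspan_mult c)
    then show ?thesis by (simp add: Q_def power2_eq_square)
  qed
  have D: "cutoff (j + 5) (fcoeff N) x = D x + Q x" for x
  proof -
    have "fcoeff (\<lambda>x. N x - Q x) = (\<lambda>k. fcoeff N k - fcoeff Q k)"
      unfolding fcoeff_eq_cf of_real_diff by (intro ext cf_diff continuous_on_of_real cN cQ)
    then show ?thesis by (simp add: D_def cutoff_diff cutoff_fcoeff_trig_polynomial[OF span])
  qed
  let ?e = "\<lambda>x. cutoff (j + 5) (fcoeff N) x - (cutoff (j + 5) f x)\<^sup>2 * cutoff (j + 5) g x"
  have e: "(?e x)\<^sup>2 \<le> 2 * (D x)\<^sup>2 + 2 * (3 * A\<^sup>2 * \<delta>)\<^sup>2" for x
  proof -
    have "\<bar>cutoff j f x - cutoff (j + 5) f x\<bar> \<le> \<delta>" "\<bar>cutoff j g x - cutoff (j + 5) g x\<bar> \<le> \<delta>"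
      using cutoff_diff_le[OF f q, of j "j + 5" x] cutoff_diff_le[OF g q, of j "j + 5" x]
      unfolding \<delta>_def by linarith+
    then have "\<bar>Q x - (cutoff (j + 5) f x)\<^sup>2 * cutoff (j + 5) g x\<bar> \<le> 3 * A\<^sup>2 * \<delta>"
      unfolding Q_def A_def by (intro cubic_difference_le cutoff_le f g q)
    then have 1: "(Q x - (cutoff (j + 5) f x)\<^sup>2 * cutoff (j + 5) g x)\<^sup>2 \<le> (3 * A\<^sup>2 * \<delta>)\<^sup>2"
      by (intro power2_le_iff_abs_le[THEN iffD2]) (use order_trans[OF abs_ge_zero] in blast)+
    have "?e x = D x + (Q x - (cutoff (j + 5) f x)\<^sup>2 * cutoff (j + 5) g x)" by (simp add: D)
    also have "(D x + E)\<^sup>2 \<le> 2 * (D x)\<^sup>2 + 2 * E\<^sup>2" for E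
      using sum_squares_bound[of "D x" E] by (simp add: power2_sum)
    finally show ?thesis using 1 by linarith
  qed
  have "integral {0..1} (\<lambda>x. (?e x)\<^sup>2) \<le> integral {0..1} (\<lambda>x. 2 * (D x)\<^sup>2 + 2 * (3 * A\<^sup>2 * \<delta>)\<^sup>2)"
  proof (rule integral_le)
    show "(\<lambda>x. (?e x)\<^sup>2) integrable_on {0..1}" by (intro integrable_continuous_interval continuous_intros)
    show "(\<lambda>x. 2 * (D x)\<^sup>2 + 2 * (3 * A\<^sup>2 * \<delta>)\<^sup>2) integrable_on {0..1}"
      by (intro integrable_continuous_interval continuous_on_add continuous_on_mult continuous_on_const continuous_on_power cD)
  qed (rule e)
  also have "\<dots> = 2 * integral {0..1} (\<lambda>x. (D x)\<^sup>2) + 2 * (3 * A\<^sup>2 * \<delta>)\<^sup>2"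
  proof -
    have "(\<lambda>x. 2 * (D x)\<^sup>2) integrable_on {0..1}"
      by (intro integrable_continuous_interval continuous_on_mult continuous_on_const continuous_on_power cD)
    then show ?thesis by (subst integral_add) auto
  qed
  also have "integral {0..1} (\<lambda>x. (D x)\<^sup>2) \<le> integral {0..1} (\<lambda>x. (N x - Q x)\<^sup>2)"
    unfolding D_def by (rule cutoff_fcoeff_L2) (intro continuous_on_diff cN cQ)
  also have "integral {0..1} (\<lambda>x. (N x - Q x)\<^sup>2) \<le> integral {0..1} (\<lambda>x::real. (3 * A\<^sup>2 * \<delta>)\<^sup>2)"
  proof (rule integral_le)
    show "(\<lambda>x. (N x - Q x)\<^sup>2) integrable_on {0..1}"
      by (intro integrable_continuous_interval continuous_on_power continuous_on_diff cN cQ)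
    fix x :: real
    show "(N x - Q x)\<^sup>2 \<le> (3 * A\<^sup>2 * \<delta>)\<^sup>2"
      using NQ[of x] by (intro power2_le_iff_abs_le[THEN iffD2]) (use order_trans[OF abs_ge_zero] in blast)+
  qed auto
  finally have "integral {0..1} (\<lambda>x. (?e x)\<^sup>2) \<le> 4 * (3 * A\<^sup>2 * \<delta>)\<^sup>2" by simp
  also have "\<dots> = (6 * A\<^sup>2 * \<delta>)\<^sup>2" by (simp add: power_mult_distrib)
  finally show ?thesis unfolding N_def[abs_def] A_def \<delta>_def .
qed

end

context mild
begin

definition err :: "nat \<Rightarrow> real \<Rightarrow> real \<Rightarrow> real" where
  "err n t x = cutoff n (flux t) x - (cutoff n (u t) x)\<^sup>2 * cutoff n (dx (rho (u t))) x"

lemma err_L2: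
  assumes "0 < a"
  shows "\<exists>K. \<forall>t\<in>{a..T}. \<forall>j. integral {0..1} (\<lambda>x. (err (j + 5) t x)\<^sup>2) \<le> (K * q ^ j)\<^sup>2"
proof -
  obtain B where *: "\<forall>s\<in>{a..T}. decays q B (w s) \<and> decays q B (u s) \<and> decays q B (dx (rho (u s)))"
    using decays_uniform[OF assms] by (elim exE conjE)
  have "integral {0..1} (\<lambda>x. (err (j + 5) t x)\<^sup>2) \<le> (6 * (B / (1 - q))\<^sup>2 * (B / (1 - q)) * q ^ j)\<^sup>2"
    if t: "t \<in> {a..T}" for t j
  proof -
    have B: "decays q B (u t)" "decays q B (dx (rho (u t)))" using bspec[OF * t] by simp_all
    have c: "continuous_on {0..1} (tfun chi0 phi h)" if h: "decays q B h" for h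
    proof -
      have "continuous_on ({0::real} \<times> {0..1}) (\<lambda>p. tfun chi0 phi h (snd p))"
        using continuous_on_tfun_family[where f = "\<lambda>_. h" and A = "{0::real}" and X = "{0..1}" and B = B] h by simp
      then have "continuous_on {0..1} (\<lambda>x. tfun chi0 phi h (snd (0::real, x)))"
        by (rule continuous_on_compose2) (auto intro!: continuous_intros)
      then show ?thesis by simp
    qed
    show ?thesis
      using commutator_L2[OF B less_imp_le[OF q(1)] q(2) c[OF B(1)] c[OF B(2)], of j]
      unfolding err_def flux_def nonlin_def[abs_def] by (simp add: mult.assoc)
  qed
  then show ?thesis by blast
qed

lemma cutoff_w_time_derivative:
  assumes a: "0 < a" and t: "t \<in> {a..T}"
  shows "((\<lambda>t. cutoff n (w t) x) has_real_derivative
     cutoff n (dx (\<lambda>k. dx (w t) k + complex_of_real chi * flux t k)) x) (at t within {a..T})"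
proof -
  have "((\<lambda>t. tsum (2 ^ (n + 2)) (\<lambda>k. complex_of_real (low n k) * w t k) x) has_vector_derivative
     tsum (2 ^ (n + 2)) (\<lambda>k. complex_of_real (low n k) * dx (\<lambda>k. dx (w t) k + complex_of_real chi * flux t k) k) x) (at t within {a..T})"
    unfolding tsum_def
    by (intro has_vector_derivative_sum has_vector_derivative_mult_left has_vector_derivative_mult_right
        w_has_vector_derivative[OF a t])
  from bounded_linear.has_vector_derivative[OF bounded_linear_Re this]
  show ?thesis unfolding cutoff_def has_real_derivative_iff_has_vector_derivative .
qed

text \<open>Differentiation under the integral, then one integration by parts in space that treats
  diffusion and drift together. Writing the exponent as \<open>k + 2\<close> keeps the weight
  \<open>k\<close> a natural number.\<close>

lemma energy_derivative:
  assumes a: "0 < a" and t: "t \<in> {a..T}"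
  shows "((\<lambda>t. integral {0..1} (\<lambda>x. cutoff n (w t) x ^ (k + 2))) has_real_derivative
    real (k + 2) * integral {0..1} (\<lambda>x. - (real (k + 2) - 1) * cutoff n (w t) x ^ k * cutoff n (dx (w t)) x *
      (cutoff n (dx (w t)) x + chi * cutoff n (flux t) x))) (at t within {a..T})"
proof -
  define G where "G t = (\<lambda>k. dx (w t) k + complex_of_real chi * flux t k)" for t
  let ?v = "\<lambda>t x. cutoff n (w t) x"
  let ?f' = "\<lambda>t x. real (k + 2) * ?v t x ^ (k + 1) * cutoff n (dx (G t)) x"
  have cw: "continuous_on {a..T} (\<lambda>s. w s k)" for k
    by (rule continuous_on_subset[OF continuous_w]) (use a in auto)
  have cG: "continuous_on {a..T} (\<lambda>s. dx (G s) k)" for k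
    unfolding G_def dx_def by (intro continuous_intros cw continuous_flux[OF a])
  have "((\<lambda>t. integral (cbox 0 1) (\<lambda>x. ?v t x ^ (k + 2))) has_real_derivative integral (cbox 0 1) (?f' t)) (at t within {a..T})"
  proof (rule leibniz_rule_field_derivative[OF _ _ _ t])
    fix s x :: real assume s: "s \<in> {a..T}"
    have "((\<lambda>t. ?v t x ^ Suc (k + 1)) has_real_derivative (1 + real (k + 1)) * (cutoff n (dx (G s)) x * ?v s x ^ (k + 1))) (at s within {a..T})"
      unfolding G_def by (rule DERIV_power_Suc[OF cutoff_w_time_derivative[OF a s]])
    moreover have "(1 + real (k + 1)) * (cutoff n (dx (G s)) x * ?v s x ^ (k + 1)) = ?f' s x" by simp
    moreover have "Suc (k + 1) = k + 2" by simp
    ultimately show "((\<lambda>t. ?v t x ^ (k + 2)) has_real_derivative ?f' s x) (at s within {a..T})" by (simp only:)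
  next
    fix s :: real
    show "(\<lambda>x. ?v s x ^ (k + 2)) integrable_on cbox 0 1"
      unfolding cbox_interval by (intro integrable_continuous_interval continuous_intros)
  next
    show "continuous_on ({a..T} \<times> cbox 0 1) (\<lambda>(t, x). ?f' t x)"
      unfolding split_beta
      by (intro continuous_on_mult continuous_on_const continuous_on_power continuous_on_cutoff_family cw cG)
  qed simp
  moreover have "integral (cbox 0 1) (?f' t) = real (k + 2) * integral {0..1} (\<lambda>x. - (real (k + 2) - 1) * ?v t x ^ k * cutoff n (dx (w t)) x *
      (cutoff n (dx (w t)) x + chi * cutoff n (flux t) x))"
  proof -
    let ?g = "\<lambda>x. cutoff n (dx (w t)) x + chi * cutoff n (flux t) x"
    have g: "cutoff n (G t) x = ?g x" for x by (simp add: G_def cutoff_add cutoff_cmult)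
    let ?b = "\<lambda>x. - (real (k + 2) - 1) * ?v t x ^ k * cutoff n (dx (w t)) x * ?g x"
    let ?h = "\<lambda>x. ?v t x ^ (k + 1) * cutoff n (dx (G t)) x"
    have "((\<lambda>x. ?h x + - ?b x) has_integral 0) {0..1}"
    proof (rule integral_derivative_periodic)
      fix x :: real
      have "((\<lambda>x. ?v t x ^ Suc k * cutoff n (G t) x) has_real_derivative
         ?v t x ^ Suc k * cutoff n (dx (G t)) x + (1 + real k) * (cutoff n (dx (w t)) x * ?v t x ^ k) * cutoff n (G t) x) (at x within {0..1})"
        by (intro DERIV_mult' DERIV_power_Suc cutoff_has_derivative)
      moreover have "?v t x ^ Suc k * cutoff n (dx (G t)) x + (1 + real k) * (cutoff n (dx (w t)) x * ?v t x ^ k) * cutoff n (G t) x = ?h x + - ?b x"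
      proof -
        have "(1 + real k) * (W * V) * Y = - (- (real (k + 2) - 1) * V * W * Y)" for V W Y
          by (simp add: algebra_simps)
        then show ?thesis unfolding g by (simp only: Suc_eq_plus1)
      qed
      ultimately show "((\<lambda>x. ?v t x ^ Suc k * cutoff n (G t) x) has_real_derivative ?h x + - ?b x) (at x within {0..1})" by (simp only:)
    qed (simp only: cutoff_at_1)
    moreover have "(?h has_integral integral {0..1} ?h) {0..1}" "(?b has_integral integral {0..1} ?b) {0..1}"
      by (intro integrable_integral integrable_continuous_interval continuous_intros)+
    ultimately have "integral {0..1} ?h + - integral {0..1} ?b = 0"
      by (intro has_integral_unique[OF has_integral_add[OF _ has_integral_neg]])
    moreover have "integral (cbox 0 1) (?f' t) = real (k + 2) * integral {0..1} ?h"
      unfolding cbox_interval mult.assoc by (rule integral_mult_right)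
    ultimately show ?thesis by simp
  qed
  ultimately show ?thesis by (simp only: cbox_interval)
qed

end

section \<open>Decay of the mass\<close>

lemma abs_power_diff_le:
  fixes x y A :: real
  assumes "\<bar>x\<bar> \<le> A" "\<bar>y\<bar> \<le> A"
  shows "\<bar>x ^ Suc n - y ^ Suc n\<bar> \<le> real (Suc n) * A ^ n * \<bar>x - y\<bar>"
proof (induction n)
  case (Suc n)
  have A: "0 \<le> A" using assms by linarith
  have eq: "x ^ Suc (Suc n) - y ^ Suc (Suc n) = x * (x ^ Suc n - y ^ Suc n) + (x - y) * y ^ Suc n"
    by (simp add: algebra_simps)
  have "\<bar>x * (x ^ Suc n - y ^ Suc n)\<bar> \<le> A * (real (Suc n) * A ^ n * \<bar>x - y\<bar>)"
    unfolding abs_mult using assms A Suc.IH by (intro mult_mono) auto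
  moreover have "\<bar>(x - y) * y ^ Suc n\<bar> \<le> \<bar>x - y\<bar> * A ^ Suc n"
    unfolding abs_mult power_abs using assms by (intro mult_left_mono power_mono) auto
  moreover have "A * (real (Suc n) * A ^ n * \<bar>x - y\<bar>) + \<bar>x - y\<bar> * A ^ Suc n = real (Suc (Suc n)) * A ^ Suc n * \<bar>x - y\<bar>"
    by (simp add: algebra_simps)
  ultimately show ?case unfolding eq by linarith
qed simp

text \<open>For f = y^P the hypothesis reads y' \<le> -(c/8) y^3. The power -2/P makes the
  right-hand side constant: the derivative of \<open>f powr (- 2 / P)\<close> is at least (2/P)(P/8)
  c = c/4, and the mean value theorem integrates this.\<close>

lemma powr_growth:
  fixes f f' :: "real \<Rightarrow> real" and P c :: real
  assumes ab: "a < b" and P: "0 < P"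
    and df: "\<And>s. s \<in> {a..b} \<Longrightarrow> (f has_real_derivative f' s) (at s within {a..b})"
    and pos: "\<And>s. s \<in> {a..b} \<Longrightarrow> 0 < f s"
    and le: "\<And>s. s \<in> {a..b} \<Longrightarrow> f' s \<le> - (P / 8) * c * f s powr (1 + 2 / P)"
  shows "f a powr (- 2 / P) + c / 4 * (b - a) \<le> f b powr (- 2 / P)"
proof -
  let ?h = "\<lambda>s. f s powr (- 2 / P)" and ?h' = "\<lambda>s. (- 2 / P) * f s powr (- 2 / P - 1) * f' s"
  have dh: "(?h has_real_derivative ?h' s) (at s within {a..b})" if s: "s \<in> {a..b}" for s
    by (rule DERIV_chain'[OF df[OF s] has_real_derivative_powr[OF pos[OF s]]])
  have "\<exists>s\<in>{a<..<b}. ?h b - ?h a = ?h' s * (b - a)"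
    by (rule mvt_simple[OF ab, where f' = "\<lambda>s. (*) (?h' s)"])
       (rule dh[unfolded has_field_derivative_def], simp)
  then obtain s where "s \<in> {a<..<b}" and eq: "?h b - ?h a = ?h' s * (b - a)" by (elim bexE)
  then have s: "s \<in> {a..b}" by simp
  have "c / 4 \<le> ?h' s"
  proof -
    have "f s powr (- 2 / P - 1) * f s powr (1 + 2 / P) = 1"
      unfolding powr_add[symmetric] using pos[OF s] by simp
    then have "c / 4 = (- 2 / P) * f s powr (- 2 / P - 1) * (- (P / 8) * c * f s powr (1 + 2 / P))"
      using P by (simp add: field_simps)
    also have "\<dots> \<le> ?h' s"
      using le[OF s] P by (intro mult_left_mono_neg) (auto simp: divide_nonpos_pos mult_nonpos_nonneg)
    finally show ?thesis .
  qed
  then have "c / 4 * (b - a) \<le> ?h' s * (b - a)" using ab by (intro mult_right_mono) auto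
  then show ?thesis using eq by linarith
qed

context mild
begin

text \<open>\<open>energy_estimate\<close> with \<open>Z\<close> split at level \<open>N\<close> and
  everything regularised at level \<open>n\<close>. The conditions \<open>h1\<close>,
  \<open>h2\<close>, \<open>h3\<close> control the size of \<open>Z\<close> and the mean, the
  derivative of the smooth part, and the rough part. They refer to a fixed \<open>M \<le> y\<close>,
  so they need not be rechecked as \<open>y\<close> varies in time.\<close>

lemma energy_inequality:
  assumes a: "0 < a" and t: "t \<in> {a..T}" and k: "even k" and n: "0 < n" "N \<le> n"
    and BZ: "decays q B (Z t)" and M: "0 < M" "M \<le> y"
    and y: "y ^ (k + 2) = integral {0..1} (\<lambda>x. cutoff n (w t) x ^ (k + 2))"
    and h1: "B / (1 - q) + \<bar>m\<bar> \<le> 1 / 1000 * M"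
    and h2: "N = 0 \<or> 200 * B * ((2 * q) ^ N / (2 * q - 1)) \<le> 1 / 1000 * M"
    and h3: "real (k + 2) * chi * (B * (q ^ N / (1 - q)))\<^sup>2 \<le> (1 / 1000)\<^sup>2"
  shows "integral {0..1} (\<lambda>x. - (real (k + 2) - 1) * cutoff n (w t) x ^ k * cutoff n (dx (w t)) x *
      (cutoff n (dx (w t)) x + chi * cutoff n (flux t) x))
    \<le> - (3/20) * chi * y ^ (k + 4) + real (k + 2) / 2 * chi\<^sup>2 * integral {0..1} (\<lambda>x. cutoff n (w t) x ^ k * (err n t x)\<^sup>2)"
proof -
  let ?z1 = "cutoff N (Z t)" and ?z2 = "\<lambda>x. cutoff n (Z t) x - cutoff N (Z t) x"
  let ?r = "cutoff n (dx (rho (u t)))"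
  have y0: "0 < y" and yM: "1 / 1000 * M \<le> 1 / 1000 * y" using M by linarith+
  have tT: "t \<in> {0<..T}" "t \<in> {0..T}" using a t by auto
  have u0: "u t 0 = complex_of_real m" using mean_w[OF tT(1)] mean_Z[OF tT(2)] by (simp add: u_def)
  have cu: "cutoff n (u t) x = cutoff n (w t) x + ?z1 x + ?z2 x" for x
    unfolding u_def cutoff_add by simp
  have flux: "cutoff n (flux t) x = (cutoff n (w t) x + ?z1 x + ?z2 x)\<^sup>2 * ?r x + err n t x" for x
    unfolding err_def cu by simp
  have zb: "\<bar>cutoff l (Z t) x\<bar> \<le> B / (1 - q)" for l x
    by (rule cutoff_le[OF BZ less_imp_le[OF q(1)] q(2)])
  have dz: "\<bar>cutoff N (dx (Z t)) x\<bar> \<le> 1 / 1000 * M" for x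
  proof (cases "N = 0")
    \<comment> \<open>\<open>cutoff 0\<close> is an empty sum, so the smooth part and its derivative
      vanish. The disjunction in \<open>h2\<close> allows for this level, where no bound from
      minimality of \<open>N\<close> is available.\<close>
    case True
    then show ?thesis using M by (simp add: cutoff_eq_sum)
  next
    case False
    then show ?thesis using h2 cutoff_dx_le[OF BZ q(3), of N x] by linarith
  qed
  show ?thesis
    unfolding flux
  proof (rule energy_estimate[where m = m and b = "B * (q ^ N / (1 - q))" and ?dz1.0 = "cutoff N (dx (Z t))"
        and r' = "cutoff n (dx (dx (rho (u t))))" and v' = "cutoff n (dx (w t))" and v = "cutoff n (w t)"
        and ?z1.0 = ?z1 and ?z2.0 = ?z2 and r = ?r, OF k less_imp_le[OF chi_pos] y0 y])
    show "continuous_on {0..1} (err n t)" unfolding err_def[abs_def] by (intro continuous_intros)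
    have "dx (rho (u t)) 0 = 0" by (simp add: dx_def)
    then show "(?r has_integral 0) {0..1}" using integral_cutoff[OF n(1), of "dx (rho (u t))"] by simp
    show "real (k + 2) * chi * (B * (q ^ N / (1 - q)))\<^sup>2 \<le> (1 / 1000)\<^sup>2" by (rule h3)
    fix x :: real
    show "cutoff n (dx (dx (rho (u t)))) x = - (cutoff n (w t) x + ?z1 x + ?z2 x - m)"
      unfolding cutoff_dx_dx_rho[OF n(1)] u0 cu by simp
    show "\<bar>?z1 x\<bar> \<le> 1 / 1000 * y" "\<bar>?z1 x + ?z2 x\<bar> \<le> 1 / 1000 * y" "\<bar>?z1 x + ?z2 x - m\<bar> \<le> 1 / 1000 * y"
      "\<bar>cutoff N (dx (Z t)) x\<bar> \<le> 1 / 1000 * y"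
      using zb[of N x] zb[of n x] h1 yM dz[of x] by linarith+
    show "\<bar>?z2 x\<bar> \<le> B * (q ^ N / (1 - q))"
      by (rule cutoff_diff_le[OF BZ less_imp_le[OF q(1)] q(2) n(2)])
  qed (intro cutoff_has_derivative cutoff_at_1 continuous_intros)+
qed

text \<open>For even \<open>p\<close> this is the p-th power of the L^p norm, free of absolute
  values and roots.\<close>

definition mass :: "nat \<Rightarrow> real \<Rightarrow> real" where
  "mass p t = integral {0..1} (\<lambda>x. tfun chi0 phi (w t) x ^ p)"

lemma continuous_tfun_w:
  assumes "0 < a"
  shows "continuous_on ({a..T} \<times> X) (\<lambda>s. tfun chi0 phi (w (fst s)) (snd s))"
proof -
  obtain B where *: "\<forall>s\<in>{a..T}. decays q B (w s) \<and> decays q B (u s) \<and> decays q B (dx (rho (u s)))"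
    using decays_uniform[OF assms] by (elim exE conjE)
  show ?thesis
  proof (rule continuous_on_tfun_family[where f = w and B = B])
    show "continuous_on {a..T} (\<lambda>s. w s k)" for k
      by (rule continuous_on_subset[OF continuous_w]) (use assms in auto)
    show "decays q B (w s)" if "s \<in> {a..T}" for s using bspec[OF * that] by simp
  qed
qed

lemma continuous_tfun_w_space:
  assumes "t \<in> {0<..T}"
  shows "continuous_on {0..1} (tfun chi0 phi (w t))"
proof -
  have "continuous_on {0..1} (\<lambda>x. (t, x))" by (intro continuous_intros)
  moreover have "(\<lambda>x. (t, x)) ` {0..1} \<subseteq> {t..T} \<times> {0..1::real}" using assms by auto
  ultimately have "continuous_on {0..1} (\<lambda>x. tfun chi0 phi (w (fst (t, x))) (snd (t, x)))"
    using assms by (intro continuous_on_compose2[OF continuous_tfun_w[of t "{0..1}"]]) auto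
  then show ?thesis by simp
qed

lemma continuous_mass: "0 < a \<Longrightarrow> continuous_on {a..T} (mass p)"
proof -
  assume a: "0 < a"
  have "continuous_on ({a..T} \<times> cbox 0 1) (\<lambda>(t, x). tfun chi0 phi (w t) x ^ p)"
    unfolding split_beta by (rule continuous_on_power[OF continuous_tfun_w[OF a]])
  from integral_continuous_on_param[OF this] show ?thesis by (simp add: mass_def[abs_def])
qed

text \<open>The rate is uniform on \<open>{a..T}\<close>, which lets a single cutoff level keep the
  regularised mass above the threshold on a whole time interval.\<close>

lemma cutoff_mass_le:
  assumes a: "0 < a"
  shows "\<exists>K. \<forall>t\<in>{a..T}. \<forall>n. \<bar>integral {0..1} (\<lambda>x. cutoff n (w t) x ^ Suc p) - mass (Suc p) t\<bar> \<le> K * q ^ n"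
proof -
  obtain B where *: "\<forall>s\<in>{a..T}. decays q B (w s) \<and> decays q B (u s) \<and> decays q B (dx (rho (u s)))"
    using decays_uniform[OF a] by (elim exE conjE)
  define A where "A = B / (1 - q)"
  have "\<bar>integral {0..1} (\<lambda>x. cutoff n (w t) x ^ Suc p) - mass (Suc p) t\<bar> \<le> real (Suc p) * A ^ p * A * q ^ n"
    if t: "t \<in> {a..T}" for t n
  proof -
    have B: "decays q B (w t)" using bspec[OF * t] by simp
    have A: "0 \<le> A" using decays_nonneg[OF B] q by (simp add: A_def)
    have c: "continuous_on {0..1} (tfun chi0 phi (w t))" using t a by (intro continuous_tfun_w_space) auto
    have i: "(\<lambda>x. cutoff n (w t) x ^ Suc p) integrable_on {0..1}" "(\<lambda>x. tfun chi0 phi (w t) x ^ Suc p) integrable_on {0..1}"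
      by (intro integrable_continuous_interval continuous_on_power continuous_on_cutoff continuous_on_id c)+
    have "\<bar>integral {0..1} (\<lambda>x. cutoff n (w t) x ^ Suc p) - mass (Suc p) t\<bar>
        = norm (integral {0..1} (\<lambda>x. cutoff n (w t) x ^ Suc p - tfun chi0 phi (w t) x ^ Suc p))"
      unfolding mass_def by (simp only: integral_diff[OF i] real_norm_def)
    also have "\<dots> \<le> integral {0..1} (\<lambda>x::real. real (Suc p) * A ^ p * A * q ^ n)"
    proof (rule integral_norm_bound_integral)
      show "(\<lambda>x. cutoff n (w t) x ^ Suc p - tfun chi0 phi (w t) x ^ Suc p) integrable_on {0..1}"
        by (rule integrable_diff[OF i])
      fix x :: real
      have "\<bar>cutoff n (w t) x ^ Suc p - tfun chi0 phi (w t) x ^ Suc p\<bar> \<le> real (Suc p) * A ^ p * \<bar>cutoff n (w t) x - tfun chi0 phi (w t) x\<bar>"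
        unfolding A_def using q by (intro abs_power_diff_le cutoff_le[OF B] tfun_le[OF B]) auto
      also have "\<dots> \<le> real (Suc p) * A ^ p * (A * q ^ n)"
        using tfun_diff_cutoff_le[OF B less_imp_le[OF q(1)] q(2), of x n] A
        by (intro mult_left_mono) (auto simp: A_def abs_minus_commute)
      finally show "norm (cutoff n (w t) x ^ Suc p - tfun chi0 phi (w t) x ^ Suc p) \<le> real (Suc p) * A ^ p * A * q ^ n"
        by (simp only: real_norm_def mult.assoc)
    qed auto
    finally show ?thesis by simp
  qed
  then show ?thesis by blast
qed

lemma mass_decay:
  assumes a: "0 < a" "a < b" "b \<le> T" and k: "even k" and M: "0 < M"
    and BZ: "\<And>s. s \<in> {a..b} \<Longrightarrow> decays q B (Z s)"
    and mass: "\<And>s. s \<in> {a..b} \<Longrightarrow> M ^ (k + 2) < mass (k + 2) s"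
    and h1: "B / (1 - q) + \<bar>m\<bar> \<le> 1 / 1000 * M"
    and h2: "N = 0 \<or> 200 * B * ((2 * q) ^ N / (2 * q - 1)) \<le> 1 / 1000 * M"
    and h3: "real (k + 2) * chi * (B * (q ^ N / (1 - q)))\<^sup>2 \<le> (1 / 1000)\<^sup>2"
  shows "mass (k + 2) a powr (- 2 / real (k + 2)) + chi / 4 * (b - a) \<le> mass (k + 2) b powr (- 2 / real (k + 2))"
proof -
  define P where "P = real (k + 2)"
  define f where "f n t = integral {0..1} (\<lambda>x. cutoff n (w t) x ^ (k + 2))" for n t
  have P: "2 \<le> P" by (simp add: P_def)
  have "\<exists>K. \<forall>t\<in>{a..T}. \<forall>n. \<bar>f n t - mass (k + 2) t\<bar> \<le> K * q ^ n"
    using cutoff_mass_le[OF a(1), of "k + 1"]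
    unfolding f_def by (simp only: Suc_eq_plus1 add.assoc one_add_one)
  then obtain K1 where K1: "\<And>t n. t \<in> {a..T} \<Longrightarrow> \<bar>f n t - mass (k + 2) t\<bar> \<le> K1 * q ^ n"
    by blast
  obtain K2 where K2: "\<And>t j. t \<in> {a..T} \<Longrightarrow> integral {0..1} (\<lambda>x. (err (j + 5) t x)\<^sup>2) \<le> (K2 * q ^ j)\<^sup>2"
    using err_L2[OF a(1)] by blast
  obtain B1 where B1: "\<forall>s\<in>{a..T}. decays q B1 (w s) \<and> decays q B1 (u s) \<and> decays q B1 (dx (rho (u s)))"
    using decays_uniform[OF a(1)] by (elim exE conjE)
  define R where "R = \<bar>B1 / (1 - q)\<bar>"
  have q0: "(\<lambda>n. q ^ n) \<longlonglongrightarrow> 0" using q by (intro LIMSEQ_realpow_zero) auto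
  have sub: "s \<in> {a..T}" if "s \<in> {a..b}" for s using that a by auto
  have "continuous_on {a..b} (mass (k + 2))"
    by (rule continuous_on_subset[OF continuous_mass[OF a(1)]]) (use sub in auto)
  \<comment> \<open>The gap between the minimal mass and \<open>M ^ (k + 2)\<close> is strictly
    positive; it leaves room for the cutoff error at all times at once.\<close>
  then obtain s0 where s0: "s0 \<in> {a..b}" "\<And>s. s \<in> {a..b} \<Longrightarrow> mass (k + 2) s0 \<le> mass (k + 2) s"
    using continuous_attains_inf[of "{a..b}" "mass (k + 2)"] a by auto
  have "(\<lambda>j. K1 * q ^ (j + 5)) \<longlonglongrightarrow> 0"
    using tendsto_mult_right_zero[OF LIMSEQ_ignore_initial_segment[OF q0, of 5]] by simp
  then have ev1: "\<forall>\<^sub>F j in sequentially. K1 * q ^ (j + 5) < mass (k + 2) s0 - M ^ (k + 2)"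
    using mass[OF s0(1)] by (intro order_tendstoD(2)) auto
  have "(\<lambda>j. P / 2 * chi\<^sup>2 * (R ^ k * (K2 * q ^ j)\<^sup>2)) \<longlonglongrightarrow> P / 2 * chi\<^sup>2 * (R ^ k * (K2 * 0)\<^sup>2)"
    by (intro tendsto_intros q0)
  then have lim0: "(\<lambda>j. P / 2 * chi\<^sup>2 * (R ^ k * (K2 * q ^ j)\<^sup>2)) \<longlonglongrightarrow> 0" by simp
  \<comment> \<open>3/20 - 1/40 = 1/8 is the rate that \<open>powr_growth\<close> asks for, so 1/40
    is the share of the damping granted to the commutator.\<close>
  have ev2: "\<forall>\<^sub>F j in sequentially. P / 2 * chi\<^sup>2 * (R ^ k * (K2 * q ^ j)\<^sup>2) < 1/40 * chi * M ^ (k + 4)"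
    by (rule order_tendstoD(2)[OF lim0]) (simp add: chi_pos M)
  have growth: "\<forall>\<^sub>F j in sequentially. f (j + 5) a powr (- 2 / P) + chi / 4 * (b - a) \<le> f (j + 5) b powr (- 2 / P)"
    using ev1 ev2 eventually_ge_at_top[of N]
  proof eventually_elim
    case (elim j)
    let ?n = "j + 5"
    let ?D = "\<lambda>t. integral {0..1} (\<lambda>x. - (real (k + 2) - 1) * cutoff ?n (w t) x ^ k * cutoff ?n (dx (w t)) x *
      (cutoff ?n (dx (w t)) x + chi * cutoff ?n (flux t) x))"
    have fM: "M ^ (k + 2) \<le> f ?n s" if s: "s \<in> {a..b}" for s
      using K1[OF sub[OF s], of ?n] s0(2)[OF s] elim(1) by linarith
    show ?case
    proof (rule powr_growth[OF a(2)])
      fix s assume s: "s \<in> {a..b}"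
      note s' = sub[OF s]
      show "(f ?n has_real_derivative real (k + 2) * ?D s) (at s within {a..b})"
        unfolding f_def[abs_def] by (rule DERIV_subset[OF energy_derivative[OF a(1) s']]) (use sub in auto)
      have "0 < M ^ (k + 2)" using M by simp
      then show pos: "0 < f ?n s" using fM[OF s] by linarith
      define y where "y = f ?n s powr (1 / P)"
      have y0: "0 < y" using pos by (simp add: y_def)
      have yP: "y powr P = f ?n s" using pos P by (simp add: y_def powr_powr)
      then have yk: "y ^ (k + 2) = f ?n s" using powr_realpow[OF y0, of "k + 2"] by (simp add: P_def)
      have My: "M \<le> y"
      proof (rule ccontr)
        assume "\<not> M \<le> y"
        then have "y ^ (k + 2) < M ^ (k + 2)" using y0 by (intro power_strict_mono) auto
        then show False using fM[OF s] yk by linarith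
      qed
      have y4: "y ^ (k + 4) = f ?n s powr (1 + 2 / P)"
      proof -
        have "f ?n s powr (1 + 2 / P) = y powr (P * (1 + 2 / P))" unfolding yP[symmetric] by (rule powr_powr)
        also have "P * (1 + 2 / P) = real (k + 4)" using P by (simp add: P_def field_simps)
        also have "y powr real (k + 4) = y ^ (k + 4)" using y0 by (rule powr_realpow)
        finally show ?thesis by simp
      qed
      have err: "integral {0..1} (\<lambda>x. cutoff ?n (w s) x ^ k * (err ?n s x)\<^sup>2) \<le> R ^ k * (K2 * q ^ j)\<^sup>2"
      proof -
        have ce: "continuous_on {0..1} (err ?n s)" unfolding err_def[abs_def] by (intro continuous_intros)
        have "integral {0..1} (\<lambda>x. cutoff ?n (w s) x ^ k * (err ?n s x)\<^sup>2) \<le> integral {0..1} (\<lambda>x. R ^ k * (err ?n s x)\<^sup>2)"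
        proof (rule integral_le)
          show "(\<lambda>x. cutoff ?n (w s) x ^ k * (err ?n s x)\<^sup>2) integrable_on {0..1}"
            "(\<lambda>x. R ^ k * (err ?n s x)\<^sup>2) integrable_on {0..1}"
            by (intro integrable_continuous_interval continuous_on_mult continuous_on_power continuous_on_const
                continuous_on_cutoff continuous_on_id ce)+
          fix x :: real
          have "\<bar>cutoff ?n (w s) x\<bar> \<le> B1 / (1 - q)"
            using bspec[OF B1 s'] q by (intro cutoff_le) auto
          then have "\<bar>cutoff ?n (w s) x\<bar> \<le> R" unfolding R_def by linarith
          from power_mono[OF this abs_ge_zero] have "\<bar>cutoff ?n (w s) x\<bar> ^ k \<le> R ^ k" .
          then have "cutoff ?n (w s) x ^ k \<le> R ^ k" using k by (simp add: power_even_abs)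
          then show "cutoff ?n (w s) x ^ k * (err ?n s x)\<^sup>2 \<le> R ^ k * (err ?n s x)\<^sup>2" by (intro mult_right_mono) auto
        qed
        also have "\<dots> = R ^ k * integral {0..1} (\<lambda>x. (err ?n s x)\<^sup>2)" by (rule integral_mult_right)
        also have "\<dots> \<le> R ^ k * (K2 * q ^ j)\<^sup>2" using K2[OF s', of j] by (intro mult_left_mono) (auto simp: R_def)
        finally show ?thesis .
      qed
      have "?D s \<le> - (3/20) * chi * y ^ (k + 4) + P / 2 * chi\<^sup>2 * integral {0..1} (\<lambda>x. cutoff ?n (w s) x ^ k * (err ?n s x)\<^sup>2)"
        unfolding P_def
      proof (rule energy_inequality[OF a(1) s' k _ _ BZ[OF s] M My _ h1 h2 h3])
        show "y ^ (k + 2) = integral {0..1} (\<lambda>x. cutoff ?n (w s) x ^ (k + 2))" using yk by (simp only: f_def)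
      qed (use elim(3) in auto)
      also have "\<dots> \<le> - (3/20) * chi * y ^ (k + 4) + P / 2 * chi\<^sup>2 * (R ^ k * (K2 * q ^ j)\<^sup>2)"
        using err P by (intro add_left_mono mult_left_mono) auto
      also have "\<dots> \<le> - (3/20) * chi * y ^ (k + 4) + 1/40 * chi * y ^ (k + 4)"
      proof -
        have "1/40 * chi * M ^ (k + 4) \<le> 1/40 * chi * y ^ (k + 4)"
          using chi_pos M My by (intro mult_left_mono power_mono) auto
        then show ?thesis using elim(2) by linarith
      qed
      also have "\<dots> = - (1 / 8) * (chi * y ^ (k + 4))" by simp
      finally have "P * ?D s \<le> P * (- (1 / 8) * (chi * y ^ (k + 4)))" using P by (intro mult_left_mono) auto
      moreover have "P * (- (1 / 8) * (chi * F)) = - (P / 8) * chi * F" for F by simp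
      ultimately have "P * ?D s \<le> - (P / 8) * chi * f ?n s powr (1 + 2 / P)" by (simp only: y4)
      then show "real (k + 2) * ?D s \<le> - (P / 8) * chi * f ?n s powr (1 + 2 / P)"
        by (simp only: P_def)
    qed (use P in simp)
  qed
  have lim: "(\<lambda>j. f (j + 5) s powr (- 2 / P)) \<longlonglongrightarrow> mass (k + 2) s powr (- 2 / P)" if s: "s \<in> {a..b}" for s
  proof (rule tendsto_powr)
    have "(\<lambda>n. f n s - mass (k + 2) s) \<longlonglongrightarrow> 0"
    proof (rule Lim_null_comparison)
      show "\<forall>\<^sub>F n in sequentially. norm (f n s - mass (k + 2) s) \<le> K1 * q ^ n"
        using K1[OF sub[OF s]] by simp
      show "(\<lambda>n. K1 * q ^ n) \<longlonglongrightarrow> 0" using tendsto_mult_right_zero[OF q0] by simp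
    qed
    then have "(\<lambda>n. f n s) \<longlonglongrightarrow> mass (k + 2) s" by (simp add: LIM_zero_iff)
    then show "(\<lambda>j. f (j + 5) s) \<longlonglongrightarrow> mass (k + 2) s" by (rule LIMSEQ_ignore_initial_segment)
    have "0 < M ^ (k + 2)" using M by simp
    then show "mass (k + 2) s \<noteq> 0" using mass[OF s] by linarith
  qed (rule tendsto_const)
  have ab: "a \<in> {a..b}" "b \<in> {a..b}" using a by auto
  have "mass (k + 2) a powr (- 2 / P) + chi / 4 * (b - a) \<le> mass (k + 2) b powr (- 2 / P)"
    by (rule tendsto_le[OF sequentially_bot lim[OF ab(2)] tendsto_add[OF lim[OF ab(1)] tendsto_const] growth])
  then show ?thesis by (simp only: P_def)
qed

end

section \<open>Thresholds and the bound\<close>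

text \<open>The first two terms of the bound are both used: \<open>y = y\<^sup>\<alpha> y\<^sup>1\<^sup>-\<^sup>\<alpha>\<close> interpolates between them and
  controls quantities that are linear in \<open>\<parallel>Z\<parallel>\<close>.\<close>
lemma linear_threshold:
  fixes \<alpha> T :: real
  assumes \<alpha>: "0 < \<alpha>" "\<alpha> < 1" and T: "0 < T" and D: "0 \<le> D"
  shows "\<exists>C\<ge>0. \<forall>K chi z M \<gamma>. 1 \<le> K \<longrightarrow> 0 < chi \<longrightarrow> chi \<le> K \<longrightarrow> 0 \<le> z \<longrightarrow> 1 \<le> \<gamma> * \<alpha> \<longrightarrow>
    (chi * T / 4) powr (- 1 / 2) \<le> M \<longrightarrow> C * K powr \<gamma> * z powr (1 / \<alpha>) \<le> M \<longrightarrow> D * z \<le> M"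
proof -
  define c where "c = (T / 4) powr (- (1 - \<alpha>) / 2)"
  have c: "0 < c" using T by (simp add: c_def)
  \<comment> \<open>Chosen so that C^\<alpha> c = D, where \<open>c\<close> is the contribution of
    \<open>T\<close> to the first term of the bound raised to the power 1 - \<alpha>.\<close>
  define C where "C = (D / c) powr (1 / \<alpha>)"
  have C0: "0 \<le> C" by (simp add: C_def)
  have Ca: "C powr \<alpha> = D / c" using D c \<alpha> by (simp add: C_def powr_powr)
  have "D * z \<le> M"
    if K: "1 \<le> K" "0 < chi" "chi \<le> K" and z: "0 \<le> z" and g: "1 \<le> \<gamma> * \<alpha>"
      and M1: "(chi * T / 4) powr (- 1 / 2) \<le> M" and M2: "C * K powr \<gamma> * z powr (1 / \<alpha>) \<le> M" for K chi z M \<gamma>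
  proof -
    have "0 < (chi * T / 4) powr (- 1 / 2)" using K T by simp
    then have M: "0 < M" using M1 by linarith
    have "D * z = (D / c) * 1 * z * c" using c by simp
    \<comment> \<open>The inserted factor is at least 1, since K \<ge> 1 and \<gamma> \<alpha> -
      (1-\<alpha>)/2 is positive. It supplies the powers of \<open>K\<close> carried by the two
      interpolated terms.\<close>
    also have "\<dots> \<le> (D / c) * (K powr (\<gamma> * \<alpha>) * K powr (- (1 - \<alpha>) / 2)) * z * c"
    proof -
      have "0 \<le> \<gamma> * \<alpha> + - (1 - \<alpha>) / 2" using g \<alpha> by (simp add: field_simps)
      then have "K powr 0 \<le> K powr (\<gamma> * \<alpha> + - (1 - \<alpha>) / 2)" using K by (intro powr_mono) auto
      then have "1 \<le> K powr (\<gamma> * \<alpha>) * K powr (- (1 - \<alpha>) / 2)" using K by (simp add: powr_add)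
      then show ?thesis using D c z by (intro mult_right_mono mult_left_mono) auto
    qed
    also have "\<dots> = (D / c * K powr (\<gamma> * \<alpha>) * z) * (K powr (- (1 - \<alpha>) / 2) * c)" by simp
    also have "D / c * K powr (\<gamma> * \<alpha>) * z = (C * K powr \<gamma> * z powr (1 / \<alpha>)) powr \<alpha>"
      using \<alpha> z C0 by (simp add: powr_mult powr_powr Ca)
    also have "K powr (- (1 - \<alpha>) / 2) * c = (K * T / 4) powr (- (1 - \<alpha>) / 2)"
      using K T by (simp add: c_def powr_mult[symmetric])
    also have "\<dots> \<le> (chi * T / 4) powr (- (1 - \<alpha>) / 2)"
      using K T \<alpha> by (intro powr_mono2') (auto intro!: divide_right_mono mult_right_mono)
    also have "\<dots> = ((chi * T / 4) powr (- 1 / 2)) powr (1 - \<alpha>)"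
    proof -
      have "(- 1 / 2) * (1 - \<alpha>) = - (1 - \<alpha>) / 2" by (simp add: field_simps)
      then show ?thesis by (simp only: powr_powr)
    qed
    also have "(C * K powr \<gamma> * z powr (1 / \<alpha>)) powr \<alpha> * ((chi * T / 4) powr (- 1 / 2)) powr (1 - \<alpha>)
        \<le> M powr \<alpha> * M powr (1 - \<alpha>)"
      using M1 M2 \<alpha> C0 K z by (intro mult_mono powr_mono2) auto
    also have "\<dots> = M" using M by (simp add: powr_add[symmetric])
    finally show ?thesis by (simp add: mult_left_mono)
  qed
  then show ?thesis using C0 by blast
qed

text \<open>The least \<open>N\<close> with \<open>x q\<^sup>N \<le> 1\<close> works: minimality bounds \<open>2\<^sup>N\<close> by a power of \<open>x\<close>.\<close>
lemma cutoff_level: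
  fixes x \<alpha> q :: real
  assumes \<alpha>: "0 < \<alpha>" "\<alpha> < 1" and q: "q = 2 powr - \<alpha>" and x: "0 \<le> x"
  shows "\<exists>N. x * q ^ N \<le> 1 \<and> (N = 0 \<or> (2 * q) ^ N \<le> 2 * x powr ((1 - \<alpha>) / \<alpha>))"
proof -
  note q01 = two_powr_minus_bounds[OF \<alpha>, folded q]
  have "(\<lambda>N. q ^ N) \<longlonglongrightarrow> 0" using q01 by (intro LIMSEQ_realpow_zero) auto
  then have "(\<lambda>N. x * q ^ N) \<longlonglongrightarrow> 0" by (rule tendsto_mult_right_zero)
  then have "\<forall>\<^sub>F N in sequentially. x * q ^ N < 1" by (rule order_tendstoD(2)) simp
  then obtain N0 where "x * q ^ N0 < 1" unfolding eventually_sequentially by blast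
  then have ex: "x * q ^ N0 \<le> 1" by (rule less_imp_le)
  define N where "N = (LEAST N. x * q ^ N \<le> 1)"
  have N: "x * q ^ N \<le> 1" unfolding N_def using ex by (rule LeastI)
  have "(2 * q) ^ N \<le> 2 * x powr ((1 - \<alpha>) / \<alpha>)" if N0: "N \<noteq> 0"
  proof -
    obtain n where n: "N = Suc n" using N0 by (cases N) auto
    have "\<not> x * q ^ n \<le> 1" using not_less_Least[of n "\<lambda>N. x * q ^ N \<le> 1"] n by (simp add: N_def)
    then have xq: "1 / q ^ n < x" using q01 by (subst pos_divide_less_eq) auto
    have "q ^ n = 2 powr (- \<alpha> * real n)" unfolding q by (subst powr_power) (auto simp: mult.commute)
    then have qn: "q ^ n = 2 powr (- (\<alpha> * real n))" by (simp only: mult_minus_left)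
    have inv: "1 / q ^ n = 2 powr (\<alpha> * real n)" unfolding qn powr_minus_divide by simp
    have "(2 * q) ^ n = 2 powr ((1 - \<alpha>) * real n)"
    proof -
      have "(2::real) ^ n = 2 powr real n" by (simp add: powr_realpow)
      moreover have "real n + - (\<alpha> * real n) = (1 - \<alpha>) * real n" by (simp add: left_diff_distrib)
      ultimately show ?thesis unfolding power_mult_distrib qn by (simp only: powr_add[symmetric])
    qed
    \<comment> \<open>As 2q = 2^(1-\<alpha>) and 1/q = 2^\<alpha>, the power (2q)^n is q^(-n) raised
      to (1-\<alpha>)/\<alpha>, and minimality gives q^(-n) < x. Going from \<open>n\<close> to
      \<open>N = Suc n\<close> costs 2q < 2.\<close>
    also have "(1 - \<alpha>) * real n = (\<alpha> * real n) * ((1 - \<alpha>) / \<alpha>)" using \<alpha> by simp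
    also have "2 powr \<dots> = (1 / q ^ n) powr ((1 - \<alpha>) / \<alpha>)" unfolding inv powr_powr ..
    also have "\<dots> \<le> x powr ((1 - \<alpha>) / \<alpha>)" using xq q01 \<alpha> by (intro powr_mono2) auto
    finally have 1: "(2 * q) ^ n \<le> x powr ((1 - \<alpha>) / \<alpha>)" .
    have "(2 * q) ^ N = (2 * q) * (2 * q) ^ n" by (simp add: n)
    also have "\<dots> \<le> 2 * x powr ((1 - \<alpha>) / \<alpha>)" using 1 q01 by (intro mult_mono) auto
    finally show ?thesis .
  qed
  with N show ?thesis by (intro exI[of _ N]) (cases "N = 0", simp_all)
qed

text \<open>The first bound serves \<open>linear_threshold\<close>. The second dominates the power
  of \<open>K\<close> that comes from the derivative of the smooth part of \<open>Z\<close>; it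
  follows from the first because 1 - \<alpha> < 1.\<close>

lemma exponent_bounds:
  fixes \<alpha> p :: real
  assumes \<alpha>: "0 < \<alpha>" "\<alpha> < 1" and p: "2 \<le> p"
  defines "\<gamma> \<equiv> (p * (1 + \<alpha>) + 2 + \<alpha>) / (\<alpha> * (p + 2))"
  shows "1 \<le> \<gamma> * \<alpha>" "(1 - \<alpha>) / \<alpha> \<le> \<gamma>"
proof -
  have 1: "\<gamma> * \<alpha> = (p * (1 + \<alpha>) + 2 + \<alpha>) / (p + 2)" using \<alpha> p by (simp add: \<gamma>_def)
  show "1 \<le> \<gamma> * \<alpha>" unfolding 1 using \<alpha> p by (simp add: field_simps)
  then show "(1 - \<alpha>) / \<alpha> \<le> \<gamma>" using \<alpha> by (simp add: divide_le_eq)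
qed

text \<open>Translates the terms of the final maximum into the three conditions of the energy
  estimate, with B = 2^\<alpha> z. \<open>C\<close> is fixed before \<open>p\<close>,
  \<open>chi\<close>, \<open>z\<close>, \<open>m\<close> and \<open>M\<close>; the level
  \<open>N\<close> may depend on them.\<close>

lemma thresholds:
  fixes \<alpha> T q :: real
  assumes \<alpha>: "0 < \<alpha>" "\<alpha> < 1" and T: "0 < T" and q: "q = 2 powr - \<alpha>"
  shows "\<exists>C>0. \<forall>p chi z m M. 2 \<le> p \<longrightarrow> 0 < chi \<longrightarrow> 0 \<le> z \<longrightarrow> (m = 0 \<or> m = 1) \<longrightarrow>
    (chi * T / 4) powr (- 1 / 2) \<le> M \<longrightarrow>
    C * max p chi powr ((p * (1 + \<alpha>) + 2 + \<alpha>) / (\<alpha> * (p + 2))) * z powr (1 / \<alpha>) \<le> M \<longrightarrow>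
    C * max p chi powr ((p + 1) / (p + 2)) * m \<le> M \<longrightarrow>
    (\<exists>N. (2 powr \<alpha> * z) / (1 - q) + \<bar>m\<bar> \<le> 1 / 1000 * M \<and>
      (N = 0 \<or> 200 * (2 powr \<alpha> * z) * ((2 * q) ^ N / (2 * q - 1)) \<le> 1 / 1000 * M) \<and>
      p * chi * ((2 powr \<alpha> * z) * (q ^ N / (1 - q)))\<^sup>2 \<le> (1 / 1000)\<^sup>2)"
proof -
  note q01 = two_powr_minus_bounds[OF \<alpha>, folded q]
  define c0 where "c0 = 2 powr \<alpha> / (1 - q)"
  have c0: "0 < c0" using q01 by (simp add: c0_def)
  \<comment> \<open>2000 instead of 1000 gives the size of \<open>Z\<close> and the mean one half of
    M/1000 each.\<close>
  have "0 \<le> 2000 * c0" using c0 by simp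
  then obtain C1 where C1: "0 \<le> C1" "\<And>K chi z M \<gamma>. 1 \<le> K \<Longrightarrow> 0 < chi \<Longrightarrow> chi \<le> K \<Longrightarrow> 0 \<le> z \<Longrightarrow> 1 \<le> \<gamma> * \<alpha> \<Longrightarrow>
    (chi * T / 4) powr (- 1 / 2) \<le> M \<Longrightarrow> C1 * K powr \<gamma> * z powr (1 / \<alpha>) \<le> M \<Longrightarrow> 2000 * c0 * z \<le> M"
    using linear_threshold[OF \<alpha> T] by blast
  define a where "a = (1 - \<alpha>) / \<alpha>"
  have a: "0 < a" using \<alpha> by (simp add: a_def)
  \<comment> \<open>1000 is the inverse of \<epsilon>, 200 and 2q - 1 come from the bound on the
    cutoff derivative, 2 from \<open>cutoff_level\<close>, and the last factor from the constant in
    \<open>x\<close> below.\<close>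
  define C2 where "C2 = 1000 * (200 * 2 powr \<alpha> * 2 / (2 * q - 1)) * (1000 * c0) powr a"
  have C2: "0 \<le> C2" using q01 by (simp add: C2_def)
  define C where "C = 2000 + C1 + C2"
  have "\<exists>N. (2 powr \<alpha> * z) / (1 - q) + \<bar>m\<bar> \<le> 1 / 1000 * M \<and>
      (N = 0 \<or> 200 * (2 powr \<alpha> * z) * ((2 * q) ^ N / (2 * q - 1)) \<le> 1 / 1000 * M) \<and>
      p * chi * ((2 powr \<alpha> * z) * (q ^ N / (1 - q)))\<^sup>2 \<le> (1 / 1000)\<^sup>2"
    if p: "2 \<le> p" and chi: "0 < chi" and z: "0 \<le> z" and m: "m = 0 \<or> m = 1"
      and M1: "(chi * T / 4) powr (- 1 / 2) \<le> M"
      and M2: "C * max p chi powr ((p * (1 + \<alpha>) + 2 + \<alpha>) / (\<alpha> * (p + 2))) * z powr (1 / \<alpha>) \<le> M"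
      and M3: "C * max p chi powr ((p + 1) / (p + 2)) * m \<le> M" for p chi z m M
  proof -
    define K where "K = max p chi"
    define \<gamma> where "\<gamma> = (p * (1 + \<alpha>) + 2 + \<alpha>) / (\<alpha> * (p + 2))"
    have K: "2 \<le> K" "p \<le> K" "chi \<le> K" using p by (auto simp: K_def)
    note \<gamma> = exponent_bounds[OF \<alpha> p, folded \<gamma>_def]
    have small: "C' * K powr \<gamma> * z powr (1 / \<alpha>) \<le> M" if "C' \<le> C" for C'
    proof -
      have "C' * K powr \<gamma> * z powr (1 / \<alpha>) \<le> C * K powr \<gamma> * z powr (1 / \<alpha>)"
        using that by (intro mult_right_mono) auto
      then show ?thesis using M2 unfolding K_def \<gamma>_def by linarith
    qed
    have "2000 * c0 * z \<le> M"
      using K chi z \<gamma> M1 small[of C1] C2 by (intro C1(2)[of K chi]) (auto simp: C_def)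
    moreover have "2000 * m \<le> M"
    proof (cases "m = 0")
      case True
      have "0 < (chi * T / 4) powr (- 1 / 2)" using chi T by simp
      then have "0 \<le> M" using M1 by linarith
      then show ?thesis using True by simp
    next
      case False
      have "K powr 0 \<le> K powr ((p + 1) / (p + 2))" using K p by (intro powr_mono) auto
      then have "1 \<le> K powr ((p + 1) / (p + 2))" using K by simp
      then have "2000 * 1 \<le> C * K powr ((p + 1) / (p + 2))"
        using C1(1) C2 by (intro mult_mono) (auto simp: C_def)
      then show ?thesis using M3 m False by (simp add: K_def)
    qed
    moreover have "(2 powr \<alpha> * z) / (1 - q) = c0 * z" by (simp add: c0_def)
    moreover have "\<bar>m\<bar> = m" using m by auto
    ultimately have h1: "(2 powr \<alpha> * z) / (1 - q) + \<bar>m\<bar> \<le> 1 / 1000 * M" by linarith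
    \<comment> \<open>With this \<open>x\<close>, the condition \<open>x * q ^ N \<le> 1\<close> is
      the square root of the third requirement.\<close>
    define x where "x = sqrt (p * chi) * (1000 * c0) * z"
    have x0: "0 \<le> x" using p chi c0 z by (simp add: x_def)
    obtain N where N: "x * q ^ N \<le> 1" "N = 0 \<or> (2 * q) ^ N \<le> 2 * x powr a"
      using cutoff_level[OF \<alpha> q x0] unfolding a_def by blast
    have h3: "p * chi * ((2 powr \<alpha> * z) * (q ^ N / (1 - q)))\<^sup>2 \<le> (1 / 1000)\<^sup>2"
    proof -
      have "p * chi * ((2 powr \<alpha> * z) * (q ^ N / (1 - q)))\<^sup>2 = (sqrt (p * chi) * ((2 powr \<alpha> * z) * (q ^ N / (1 - q))))\<^sup>2"
      proof -
        have "(sqrt (p * chi))\<^sup>2 = p * chi" using p chi by simp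
        then show ?thesis unfolding power_mult_distrib[of "sqrt (p * chi)"] by simp
      qed
      also have "sqrt (p * chi) * ((2 powr \<alpha> * z) * (q ^ N / (1 - q))) = x * q ^ N / 1000"
      proof -
        have "(2 powr \<alpha> * z) * (q ^ N / (1 - q)) = c0 * z * q ^ N" by (simp add: c0_def)
        then show ?thesis by (simp add: x_def)
      qed
      also have "(x * q ^ N / 1000)\<^sup>2 \<le> (1 / 1000)\<^sup>2"
        using N(1) x0 q01 by (intro power_mono divide_right_mono) auto
      finally show ?thesis .
    qed
    have h2: "200 * (2 powr \<alpha> * z) * ((2 * q) ^ N / (2 * q - 1)) \<le> 1 / 1000 * M" if N2: "(2 * q) ^ N \<le> 2 * x powr a"
    proof -
      have "sqrt (p * chi) \<le> sqrt (K * K)" using K p chi by (intro real_sqrt_le_mono mult_mono) auto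
      then have sq: "sqrt (p * chi) \<le> K" using K by simp
      have "x powr a \<le> (K * (1000 * c0) * z) powr a"
        unfolding x_def using sq p chi c0 z a by (intro powr_mono2 mult_right_mono) auto
      also have "\<dots> = K powr a * (1000 * c0) powr a * z powr a" using K c0 z by (simp add: powr_mult)
      also have "\<dots> \<le> K powr \<gamma> * (1000 * c0) powr a * z powr a"
        using \<gamma>(2) K by (intro mult_right_mono powr_mono) (auto simp: a_def)
      finally have xa: "x powr a \<le> K powr \<gamma> * (1000 * c0) powr a * z powr a" .
      \<comment> \<open>One power of \<open>z\<close> comes from the linear derivative bound and
        (1-\<alpha>)/\<alpha> from the choice of \<open>N\<close>; they add up to
        1/\<alpha>.\<close>
      have zz: "z * z powr a = z powr (1 / \<alpha>)"
      proof (cases "z = 0")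
        case False
        have "z * z powr a = z powr (1 + a)" using False z by (simp add: powr_add)
        also have "1 + a = 1 / \<alpha>" using \<alpha> by (simp add: a_def field_simps)
        finally show ?thesis .
      qed simp
      have "200 * (2 powr \<alpha> * z) * ((2 * q) ^ N / (2 * q - 1)) \<le> 200 * (2 powr \<alpha> * z) * (2 * (K powr \<gamma> * (1000 * c0) powr a * z powr a) / (2 * q - 1))"
        using N2 xa z q01 by (intro mult_left_mono divide_right_mono) auto
      also have "\<dots> = (C2 / 1000) * K powr \<gamma> * (z * z powr a)"
      proof -
        define E where "E = 2 * q - 1"
        show ?thesis unfolding C2_def E_def[symmetric] by simp
      qed
      also have "\<dots> = 1 / 1000 * (C2 * K powr \<gamma> * z powr (1 / \<alpha>))" unfolding zz by simp
      also have "\<dots> \<le> 1 / 1000 * M" using small[of C2] C1(1) by (simp add: C_def)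
      finally show ?thesis .
    qed
    show ?thesis using h1 h2 h3 N(2) by blast
  qed
  moreover have "0 < C" using C1(1) C2 by (simp add: C_def)
  ultimately show ?thesis by blast
qed

context mild
begin

lemma mass_nonneg: "even p \<Longrightarrow> 0 \<le> mass p t"
  unfolding mass_def by (cases "(\<lambda>x. tfun chi0 phi (w t) x ^ p) integrable_on {0..1}")
    (auto intro!: integral_nonneg simp: not_integrable_integral)

lemma Lp_norm_eq: "even p \<Longrightarrow> Lp_norm p (tfun chi0 phi (w t)) = mass p t powr (1 / real p)"
  by (simp add: Lp_norm_def mass_def power_even_abs)

text \<open>The decay estimate, started at the last time at which the mass equals a level \<open>L\<close> strictly between
  \<open>M\<^sup>p\<close> and the mass at time \<open>t\<close>, contradicts the increase from \<open>L\<close> up to time \<open>t\<close>.\<close>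
lemma mass_above_threshold:
  assumes t: "0 < t" "t \<le> T" and k: "even k" and M: "0 < M"
    and above: "M ^ (k + 2) < mass (k + 2) t"
    and decay: "\<And>a. 0 < a \<Longrightarrow> a < t \<Longrightarrow> (\<And>s. s \<in> {a..t} \<Longrightarrow> M ^ (k + 2) < mass (k + 2) s) \<Longrightarrow>
      mass (k + 2) a powr (- 2 / real (k + 2)) + chi / 4 * (t - a) \<le> mass (k + 2) t powr (- 2 / real (k + 2))"
    and s: "0 < s" "s \<le> t"
  shows "M ^ (k + 2) < mass (k + 2) s"
proof (rule ccontr)
  assume not: "\<not> M ^ (k + 2) < mass (k + 2) s"
  let ?F = "mass (k + 2)"
  \<comment> \<open>The level \<open>M ^ (k + 2)\<close> itself cannot be the start:
    \<open>decay\<close> asks for a strict inequality on the closed interval, starting time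
    included.\<close>
  define L where "L = (M ^ (k + 2) + ?F t) / 2"
  have L: "M ^ (k + 2) < L" "L < ?F t" using above by (simp_all add: L_def)
  have cont: "continuous_on {s..t} ?F"
    by (rule continuous_on_subset[OF continuous_mass[OF s(1)]]) (use t in auto)
  define S where "S = {r \<in> {s..t}. ?F r \<le> L}"
  have "closed ({s..t} \<inter> ?F -` {..L})"
    by (rule continuous_closed_preimage[OF cont closed_atLeastAtMost closed_atMost])
  then have "compact ({s..t} \<inter> ({s..t} \<inter> ?F -` {..L}))" by (rule compact_Int_closed[OF compact_Icc])
  moreover have "{s..t} \<inter> ({s..t} \<inter> ?F -` {..L}) = S" by (auto simp: S_def)
  ultimately have "compact S" by (simp only:)
  moreover have "s \<in> S" using not L s by (simp add: S_def)
  ultimately obtain r where r: "r \<in> S" "\<And>r'. r' \<in> S \<Longrightarrow> r' \<le> r"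
    using compact_attains_sup[of S] by blast
  have rst: "s \<le> r" "r \<le> t" "?F r \<le> L" using r(1) by (auto simp: S_def)
  have "\<exists>x\<ge>r. x \<le> t \<and> ?F x = L"
    using L rst by (intro IVT' continuous_on_subset[OF cont]) auto
  then obtain x where x: "r \<le> x" "x \<le> t" "?F x = L" by blast
  then have "x \<in> S" using rst by (simp add: S_def)
  then have "x = r" using r(2) x by fastforce
  then have rL: "?F r = L" using x by simp
  then have rt: "r < t" using rst L by (cases "r = t") auto
  have ge: "L \<le> ?F r'" if "r' \<in> {r..t}" for r'
  proof (cases "r' = r")
    case False
    then have "r' \<notin> S" using r(2)[of r'] that by auto
    then show ?thesis using that rst by (auto simp: S_def)
  next
    case True
    then show ?thesis using rL by (simp only: order_refl)
  qed
  have "?F r powr (- 2 / real (k + 2)) + chi / 4 * (t - r) \<le> ?F t powr (- 2 / real (k + 2))"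
  proof (rule decay[OF _ rt])
    show "0 < r" using s rst by linarith
    show "M ^ (k + 2) < ?F s'" if "s' \<in> {r..t}" for s' using ge[OF that] L(1) by linarith
  qed
  moreover have "0 < chi / 4 * (t - r)" using chi_pos rt by simp
  moreover have "0 < M ^ (k + 2)" using M by simp
  then have "?F t powr (- 2 / real (k + 2)) \<le> ?F r powr (- 2 / real (k + 2))"
    unfolding rL using L by (intro powr_mono2') auto
  ultimately show False by linarith
qed

lemma Lp_norm_bound:
  assumes t: "t \<in> {0<..T}" and k: "even k" and M: "0 < M"
    and h1: "B / (1 - q) + \<bar>m\<bar> \<le> 1 / 1000 * M"
    and h2: "N = 0 \<or> 200 * B * ((2 * q) ^ N / (2 * q - 1)) \<le> 1 / 1000 * M"
    and h3: "real (k + 2) * chi * (B * (q ^ N / (1 - q)))\<^sup>2 \<le> (1 / 1000)\<^sup>2"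
    and B: "B = 2 powr \<alpha> * sup_norm_CT chi0 phi t \<alpha> Z"
  shows "Lp_norm (k + 2) (tfun chi0 phi (w t)) \<le> max ((chi * t / 4) powr (- 1 / 2)) M"
proof (rule ccontr)
  assume not: "\<not> ?thesis"
  let ?F = "mass (k + 2)"
  define y where "y = Lp_norm (k + 2) (tfun chi0 phi (w t))"
  have yF: "y = ?F t powr (1 / real (k + 2))" unfolding y_def using k by (intro Lp_norm_eq) simp
  have y: "(chi * t / 4) powr (- 1 / 2) < y" "M < y" using not by (simp_all add: y_def)
  have F0: "0 < ?F t"
  proof -
    have "?F t \<noteq> 0"
    proof
      assume "?F t = 0"
      then have "y = 0" unfolding yF by simp
      then show False using y(2) M by simp
    qed
    moreover have "0 \<le> ?F t" using k by (intro mass_nonneg) simp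
    ultimately show ?thesis by linarith
  qed
  have Fy: "?F t = y ^ (k + 2)"
  proof -
    have "y powr real (k + 2) = ?F t" using F0 by (simp add: yF powr_powr)
    then show ?thesis using powr_realpow[of y "k + 2"] y(2) M by simp
  qed
  have above: "M ^ (k + 2) < ?F t" unfolding Fy using y(2) M by (intro power_strict_mono) auto
  have decay: "?F a powr (- 2 / real (k + 2)) + chi / 4 * (t - a) \<le> ?F t powr (- 2 / real (k + 2))"
    if "0 < a" "a < t" "\<And>s. s \<in> {a..t} \<Longrightarrow> M ^ (k + 2) < ?F s" for a
  proof (rule mass_decay[OF that(1,2) _ k M _ that(3) h1 h2 h3])
    show "t \<le> T" using t by simp
    show "decays q B (Z s)" if "s \<in> {a..t}" for s
      unfolding B using that \<open>0 < a\<close> t by (intro decays_Z) auto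
  qed
  \<comment> \<open>Since the mass is y^(k+2), this is y^(-2) at time \<open>t\<close>.\<close>
  let ?h = "?F t powr (- 2 / real (k + 2))"
  have bound: "chi / 4 * (t - a) \<le> ?h" if a: "0 < a" "a < t" for a
  proof -
    have "?F a powr (- 2 / real (k + 2)) + chi / 4 * (t - a) \<le> ?h"
    proof (rule decay[OF a])
      fix s assume s: "s \<in> {a..t}"
      show "M ^ (k + 2) < ?F s"
      proof (rule mass_above_threshold[OF _ _ k M above])
        show "0 < t" "t \<le> T" "0 < s" "s \<le> t" using t a s by simp_all
        show "?F a' powr (- 2 / real (k + 2)) + chi / 4 * (t - a') \<le> ?F t powr (- 2 / real (k + 2))"
          if "0 < a'" "a' < t" "\<And>s. s \<in> {a'..t} \<Longrightarrow> M ^ (k + 2) < ?F s" for a'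
          by (rule decay[OF that])
      qed
    qed
    \<comment> \<open>All that is kept of the state at time \<open>a\<close>, so nothing about
      \<zeta> enters and the limit to time 0 needs no control of \<open>w\<close> there.\<close>
    moreover have "0 \<le> ?F a powr (- 2 / real (k + 2))" by simp
    ultimately show ?thesis by linarith
  qed
  have ht: "chi * t / 4 \<le> ?h"
  proof (rule tendsto_upperbound[of "\<lambda>a. chi / 4 * (t - a)" _ "at_right 0"])
    have "((\<lambda>a. chi / 4 * (t - a)) \<longlongrightarrow> chi / 4 * (t - 0)) (at_right 0)" by (intro tendsto_intros)
    then show "((\<lambda>a. chi / 4 * (t - a)) \<longlongrightarrow> chi * t / 4) (at_right 0)" by simp
    show "\<forall>\<^sub>F a in at_right 0. chi / 4 * (t - a) \<le> ?h"
    proof -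
      have "\<forall>\<^sub>F a in at_right 0. a \<in> {0<..<t}" using t by (intro eventually_at_right_real) simp
      then show ?thesis by (rule eventually_mono) (use bound in simp)
    qed
  qed simp
  have "(- 2 / p) * (- 1 / 2) = 1 / p" for p :: real by simp
  then have "?h powr (- 1 / 2) = y" unfolding yF by (simp only: powr_powr)
  moreover have "?h powr (- 1 / 2) \<le> (chi * t / 4) powr (- 1 / 2)"
    using ht chi_pos t by (intro powr_mono2') auto
  ultimately show False using y(1) by linarith
qed

end

theorem theorem4p4:
  fixes chi0 phi :: "real \<Rightarrow> real" and \<alpha>\<^sub>0 \<alpha> \<eta> T :: real
  assumes partition: "dyadic_partition chi0 phi"
    and a0: "-1/2 < \<alpha>\<^sub>0" "\<alpha>\<^sub>0 < 0"
    and a: "0 < \<alpha>" "\<alpha> < \<alpha>\<^sub>0 + 1/2"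
    and eta: "(\<alpha> - \<alpha>\<^sub>0) / 2 < \<eta>" "\<eta> < 1/4"
    and T: "T > 0"
  shows "\<exists>C>0. \<forall>(Z :: real \<Rightarrow> tdistr) (p :: nat) (chi :: real) (\<mm> :: real) (\<zeta> :: tdistr) (w :: real \<Rightarrow> tdistr).
     CT_besov0 chi0 phi T \<alpha> Z \<longrightarrow> even p \<longrightarrow> p \<ge> 2 \<longrightarrow> chi > 0 \<longrightarrow> (\<mm> = 0 \<or> \<mm> = 1) \<longrightarrow>
     besov chi0 phi \<alpha>\<^sub>0 \<zeta> \<longrightarrow> tmean \<zeta> = complex_of_real \<mm> \<longrightarrow>
     mild_solution chi0 phi \<eta> \<alpha> T chi \<zeta> Z w \<longrightarrow>
     (\<forall>t\<in>{0<..T}.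
        Lp_norm p (tfun chi0 phi (w t)) \<le>
          max ((chi * t / 4) powr (-1/2))
            (max (C * (max (real p) chi) powr ((real p * (1 + \<alpha>) + 2 + \<alpha>) / (\<alpha> * (real p + 2)))
                    * (sup_norm_CT chi0 phi t \<alpha> Z) powr (1 / \<alpha>))
                 (C * (max (real p) chi) powr ((real p + 1) / (real p + 2)) * \<mm>)))"
proof -
  have \<alpha>1: "\<alpha> < 1" using a0 a by linarith
  have "0 < (\<alpha> - \<alpha>\<^sub>0) / 2" using a0 a by simp
  then have \<eta>0: "0 < \<eta>" using eta by linarith
  obtain C where C: "0 < C" and thr: "\<And>p chi z m M. 2 \<le> p \<Longrightarrow> 0 < chi \<Longrightarrow> 0 \<le> z \<Longrightarrow> (m = 0 \<or> m = 1) \<Longrightarrow>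
    (chi * T / 4) powr (- 1 / 2) \<le> M \<Longrightarrow>
    C * max p chi powr ((p * (1 + \<alpha>) + 2 + \<alpha>) / (\<alpha> * (p + 2))) * z powr (1 / \<alpha>) \<le> M \<Longrightarrow>
    C * max p chi powr ((p + 1) / (p + 2)) * m \<le> M \<Longrightarrow>
    (\<exists>N. (2 powr \<alpha> * z) / (1 - 2 powr - \<alpha>) + \<bar>m\<bar> \<le> 1 / 1000 * M \<and>
      (N = 0 \<or> 200 * (2 powr \<alpha> * z) * ((2 * 2 powr - \<alpha>) ^ N / (2 * 2 powr - \<alpha> - 1)) \<le> 1 / 1000 * M) \<and>
      p * chi * ((2 powr \<alpha> * z) * ((2 powr - \<alpha>) ^ N / (1 - 2 powr - \<alpha>)))\<^sup>2 \<le> (1 / 1000)\<^sup>2)"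
    using thresholds[OF a(1) \<alpha>1 T refl] by blast
  show ?thesis
  proof (intro exI[of _ C] conjI C allI impI ballI)
    fix Z :: "real \<Rightarrow> tdistr" and p :: nat and chi \<mm> :: real and \<zeta> :: tdistr and w :: "real \<Rightarrow> tdistr" and t :: real
    assume Z: "CT_besov0 chi0 phi T \<alpha> Z" and p: "even p" "2 \<le> p" and chi: "0 < chi"
      and \<mm>: "\<mm> = 0 \<or> \<mm> = 1" and mean: "tmean \<zeta> = complex_of_real \<mm>"
      and mild: "mild_solution chi0 phi \<eta> \<alpha> T chi \<zeta> Z w" and t: "t \<in> {0<..T}"
    interpret mild chi0 phi \<alpha> \<eta> T chi \<mm> \<zeta> Z w
      by unfold_locales (fact partition a(1) \<alpha>1 \<eta>0 chi Z mean mild)+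
    define z where "z = sup_norm_CT chi0 phi t \<alpha> Z"
    define M2 where "M2 = max (C * (max (real p) chi) powr ((real p * (1 + \<alpha>) + 2 + \<alpha>) / (\<alpha> * (real p + 2))) * z powr (1 / \<alpha>))
                 (C * (max (real p) chi) powr ((real p + 1) / (real p + 2)) * \<mm>)"
    \<comment> \<open>\<open>C\<close> is chosen before \<open>t\<close>, so the interpolation uses
      the final time \<open>T\<close>. The added term costs nothing, as it is at most
      \<open>(chi * t / 4) powr (- 1 / 2)\<close>.\<close>
    define M where "M = max ((chi * T / 4) powr (- 1 / 2)) M2"
    have M0: "0 < M" using chi T by (simp add: M_def less_max_iff_disj)
    have z0: "0 \<le> z"
    proof -
      have "decays q (2 powr \<alpha> * z) (Z t)" unfolding z_def using t by (intro decays_Z) auto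
      from decays_nonneg[OF this] show ?thesis by (simp add: zero_le_mult_iff)
    qed
    have "(chi * T / 4) powr (- 1 / 2) \<le> M"
      "C * max (real p) chi powr ((real p * (1 + \<alpha>) + 2 + \<alpha>) / (\<alpha> * (real p + 2))) * z powr (1 / \<alpha>) \<le> M"
      "C * max (real p) chi powr ((real p + 1) / (real p + 2)) * \<mm> \<le> M"
      by (simp_all add: M_def M2_def)
    from thr[OF _ chi z0 \<mm> this] p(2)
    obtain N where N: "(2 powr \<alpha> * z) / (1 - q) + \<bar>\<mm>\<bar> \<le> 1 / 1000 * M"
      "N = 0 \<or> 200 * (2 powr \<alpha> * z) * ((2 * q) ^ N / (2 * q - 1)) \<le> 1 / 1000 * M"
      "real p * chi * ((2 powr \<alpha> * z) * (q ^ N / (1 - q)))\<^sup>2 \<le> (1 / 1000)\<^sup>2"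
      unfolding q_def by auto
    obtain k where k: "p = k + 2" using p(2) by (metis add.commute le_iff_add)
    have "Lp_norm (k + 2) (tfun chi0 phi (w t)) \<le> max ((chi * t / 4) powr (- 1 / 2)) M"
    proof (rule Lp_norm_bound[OF t _ M0 N(1,2) _ ])
      show "even k" using p(1) k by simp
      show "real (k + 2) * chi * ((2 powr \<alpha> * z) * (q ^ N / (1 - q)))\<^sup>2 \<le> (1 / 1000)\<^sup>2" using N(3) by (simp only: k)
    qed (simp add: z_def)
    moreover have "(chi * T / 4) powr (- 1 / 2) \<le> (chi * t / 4) powr (- 1 / 2)"
      using chi t by (intro powr_mono2') (auto intro!: divide_right_mono mult_left_mono)
    ultimately show "Lp_norm p (tfun chi0 phi (w t)) \<le>
          max ((chi * t / 4) powr (-1/2))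
            (max (C * (max (real p) chi) powr ((real p * (1 + \<alpha>) + 2 + \<alpha>) / (\<alpha> * (real p + 2)))
                    * (sup_norm_CT chi0 phi t \<alpha> Z) powr (1 / \<alpha>))
                 (C * (max (real p) chi) powr ((real p + 1) / (real p + 2)) * \<mm>))"
      unfolding k[symmetric] M_def M2_def z_def by linarith
  qed
qed

end
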